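(* Let $1 \leq p < \infty$ and let $\mathbf{w} = (\omega_k)_{k\geq 1}$ be a bounded sequence of strictly positive real numbers. Let $B_{\mathbf{w}} : \ell_p \to \ell_p$ be the unilateral weighted backward shift $B_{\mathbf{w}}(x_1, x_2, x_3, \ldots) = (\omega_1 x_2, \omega_2 x_3, \ldots)$. The following statements are equivalent: (i) The weight $\mathbf{w}$ satisfies $$\sum_{k \geq 1} (\omega_1 \omega_2 \cdots \omega_k)^{-p} < \infty \quad \text{and} \quad \sup_{n \geq 1} \inf_{k \geq 1} \prod_{j=1}^n \omega_{k+j} \leq 1.$$ (ii) $B_{\mathbf{w}}$ admits a $\mathscr{U}$-frequently hypercyclic subspace that contains no frequently hypercyclic vector for $B_{\mathbf{w}}$. (iii) $B_{\mathbf{w}}$ is $\mathscr{U}$-frequently hypercyclic and admits a hypercyclic subspace that contains no $\mathscr{U}$-frequently hypercyclic vector for $B_{\mathbf{w}}$.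
   Context: The scalar field $\mathbb{K}$ is $\mathbb{R}$ or $\mathbb{C}$. For $A \subset \mathbb{N}_0 = \{0,1,2,\dots\}$, the lower and upper asymptotic densities are $\underline{\mathrm{d}}(A) = \liminf_{N\to\infty} \frac{|A \cap \{0,\dots,N\}|}{N+1}$ and $\overline{\mathrm{d}}(A) = \limsup_{N\to\infty} \frac{|A \cap \{0,\dots,N\}|}{N+1}$. For a bounded linear operator $T$ on a Banach space $X$, $x \in X$ and $E\subset X$, let $\mathcal{N}_T(x,E) = \{n \in \mathbb{N}_0 : T^n x \in E\}$. A vector $x$ is hypercyclic for $T$ if $\{T^n x : n \ge 0\}$ is dense in $X$; it is frequently hypercyclic (resp. $\mathscr{U}$-frequently hypercyclic) for $T$ if $\underline{\mathrm{d}}(\mathcal{N}_T(x,U)) > 0$ (resp. $\overline{\mathrm{d}}(\mathcal{N}_T(x,U)) > 0$) for every non-empty open $U \subset X$. $T$ is $\mathscr{U}$-frequently hypercyclic if it has a $\mathscr{U}$-frequently hypercyclic vector. A hypercyclic subspace (resp. $\mathscr{U}$-frequently hypercyclic subspace) for $T$ is a closed infinite-dimensional subspace of $X$ all of whose nonzero vectors are hypercyclic (resp. $\mathscr{U}$-frequently hypercyclic) for $T$. *)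

theory Defs
  imports "HOL-Analysis.Analysis" "HOL-Library.Liminf_Limsup"
begin

text \<open>Sequences are indexed from 0: the paper's x_1, x_2, ... are x 0, x 1, ...
  Weights are indexed as in the paper: w 1, w 2, ... (w 0 is irrelevant).
  The scalar field is a type 'a of class real_normed_field + banach
  (i.e. a complete real normed field: up to isomorphism R or C).\<close>

definition lp :: "real \<Rightarrow> (nat \<Rightarrow> 'a::real_normed_field) set" where
  "lp p = {x. summable (\<lambda>n. norm (x n) powr p)}"

definition lp_norm :: "real \<Rightarrow> (nat \<Rightarrow> 'a::real_normed_field) \<Rightarrow> real" where
  "lp_norm p x = (\<Sum>n. norm (x n) powr p) powr (1 / p)"

definition lp_dist :: "real \<Rightarrow> (nat \<Rightarrow> 'a::real_normed_field) \<Rightarrow> (nat \<Rightarrow> 'a) \<Rightarrow> real" where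
  "lp_dist p x y = lp_norm p (\<lambda>n. x n - y n)"

definition lp_open :: "real \<Rightarrow> (nat \<Rightarrow> 'a::real_normed_field) set \<Rightarrow> bool" where
  "lp_open p U \<longleftrightarrow> U \<subseteq> lp p \<and>
     (\<forall>x\<in>U. \<exists>e>0. {y \<in> lp p. lp_dist p y x < e} \<subseteq> U)"

text \<open>Unilateral weighted backward shift: (B x)_n = w_n x_{n+1} (paper indexing).\<close>
definition bshift :: "(nat \<Rightarrow> real) \<Rightarrow> (nat \<Rightarrow> 'a::real_normed_field) \<Rightarrow> (nat \<Rightarrow> 'a)" where
  "bshift w x = (\<lambda>n. of_real (w (Suc n)) * x (Suc n))"

definition N_T :: "(('b \<Rightarrow> 'b)) \<Rightarrow> 'b \<Rightarrow> 'b set \<Rightarrow> nat set" where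
  "N_T T x E = {n. (T ^^ n) x \<in> E}"

definition lower_density :: "nat set \<Rightarrow> ereal" where
  "lower_density A = liminf (\<lambda>N. ereal (real (card (A \<inter> {0..N})) / real (N + 1)))"

definition upper_density :: "nat set \<Rightarrow> ereal" where
  "upper_density A = limsup (\<lambda>N. ereal (real (card (A \<inter> {0..N})) / real (N + 1)))"

definition lp_hypercyclic_vec :: "real \<Rightarrow> ((nat \<Rightarrow> 'a::real_normed_field) \<Rightarrow> (nat \<Rightarrow> 'a)) \<Rightarrow> (nat \<Rightarrow> 'a) \<Rightarrow> bool" where
  "lp_hypercyclic_vec p T x \<longleftrightarrow> x \<in> lp p \<and>
     (\<forall>U. lp_open p U \<and> U \<noteq> {} \<longrightarrow> (\<exists>n. (T ^^ n) x \<in> U))"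

definition lp_freq_hypercyclic_vec :: "real \<Rightarrow> ((nat \<Rightarrow> 'a::real_normed_field) \<Rightarrow> (nat \<Rightarrow> 'a)) \<Rightarrow> (nat \<Rightarrow> 'a) \<Rightarrow> bool" where
  "lp_freq_hypercyclic_vec p T x \<longleftrightarrow> x \<in> lp p \<and>
     (\<forall>U. lp_open p U \<and> U \<noteq> {} \<longrightarrow> lower_density (N_T T x U) > 0)"

definition lp_U_freq_hypercyclic_vec :: "real \<Rightarrow> ((nat \<Rightarrow> 'a::real_normed_field) \<Rightarrow> (nat \<Rightarrow> 'a)) \<Rightarrow> (nat \<Rightarrow> 'a) \<Rightarrow> bool" where
  "lp_U_freq_hypercyclic_vec p T x \<longleftrightarrow> x \<in> lp p \<and>
     (\<forall>U. lp_open p U \<and> U \<noteq> {} \<longrightarrow> upper_density (N_T T x U) > 0)"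

definition lp_U_freq_hypercyclic :: "real \<Rightarrow> ((nat \<Rightarrow> 'a::real_normed_field) \<Rightarrow> (nat \<Rightarrow> 'a)) \<Rightarrow> bool" where
  "lp_U_freq_hypercyclic p T \<longleftrightarrow> (\<exists>x. lp_U_freq_hypercyclic_vec p T x)"

definition fin_span :: "(nat \<Rightarrow> 'a::real_normed_field) set \<Rightarrow> (nat \<Rightarrow> 'a) set" where
  "fin_span F = {x. \<exists>c. x = (\<lambda>n. \<Sum>f\<in>F. c f * f n)}"

definition lp_closed_inf_dim_subspace :: "real \<Rightarrow> (nat \<Rightarrow> 'a::real_normed_field) set \<Rightarrow> bool" where
  "lp_closed_inf_dim_subspace p M \<longleftrightarrow>
     M \<subseteq> lp p \<and> (\<lambda>n. 0) \<in> M \<and>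
     (\<forall>x\<in>M. \<forall>y\<in>M. (\<lambda>n. x n + y n) \<in> M) \<and>
     (\<forall>c. \<forall>x\<in>M. (\<lambda>n. c * x n) \<in> M) \<and>
     (\<forall>x\<in>lp p. (\<forall>e>0. \<exists>y\<in>M. lp_dist p y x < e) \<longrightarrow> x \<in> M) \<and>
     \<not> (\<exists>F. finite F \<and> M \<subseteq> fin_span F)"

end

theory Submission
  imports Defs "HOL-Complex_Analysis.Great_Picard" "HOL-Library.Function_Algebras"
begin

text \<open>Write \<open>W k = w 1 \<cdots> w k\<close>, so that the \<open>k\<close>-th coordinate of \<open>T\<^sup>n x\<close> is \<open>W (k + n) / W k\<close> times \<open>x (k + n)\<close>.

  Necessity. If \<open>x\<close> is U-frequently hypercyclic, the times \<open>A\<close> at which the orbit is close to the first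
  unit vector satisfy \<open>\<Sum> {W k powr - p | n + k \<in> A} \<le> D\<close> for all \<open>n \<in> A\<close>; since \<open>A\<close> has positive
  upper density, its difference set is syndetic enough to bound the whole series. If all products
  of \<open>n\<close> consecutive weights are at least \<open>c > 1\<close>, then \<open>T\<^sup>n\<close> expands every tail, and a vector of the
  given subspace whose tails decay slowly has an orbit bounded away from \<open>0\<close>.

  Sufficiency. The condition on the products yields arbitrarily large \<open>k\<close> such that the
  unit vector \<open>e k\<close> has \<open>\<parallel>T\<^sup>n (e k)\<parallel> \<le> 2\<close> for \<open>n \<le> N\<close>, where \<open>N\<close> is prescribed. The subspace is spanned by
  disjointly supported vectors, each made of one such unit vector and of small copies of finite targets.
  Long runs of copies of one target give positive upper density, and the
  choice of \<open>k\<close> far beyond the run destroys the lower density; isolated copies at sparse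
  times only give hypercyclicity.\<close>

section \<open>Density of a countable subset of the scalar field\<close>

text \<open>The subspace contains infinite combinations of its generating vectors, so at a visiting
  time the images of infinitely many unit vectors have to be controlled at once. Each is only
  bounded by 2; smallness comes from the coefficients. Coefficient number \<open>i\<close> of a
  vector \<open>x\<close> in \<open>M\<close> is the coordinate of \<open>x\<close> at
  \<open>\<kappa> (Suc i)\<close>, so the coefficients of the later unit vectors form part of a tail
  of \<open>x\<close>. The copies of targets, in contrast, are small because the series converges.
  The period \<open>g j\<close> must be large against the size \<open>B j\<close> of the target, so
  that the copies in a run do not disturb each other, while the proportion of visits is about
  \<open>1 / (1 + g j)\<close>. Hence the period may depend on the target and the precision, but
  must not grow with the stage: every combination of vector, target and period recurs in infinitely
  many stages. This calls for a countable dense family of targets. The scalars are given only by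
  axioms, so their separability comes first, through real quadratics, as no complex structure is
  available on the field.\<close>

text \<open>The complex number \<open>z\<close> only indexes a conjugate pair of roots. If
  \<open>\<alpha>\<close> is a square root of \<open>z\<close>, the quadratic of \<open>z\<close> at
  \<open>u ^ 2\<close> is the product of the quadratics of \<open>\<alpha>\<close> and
  \<open>- \<alpha>\<close> at \<open>u\<close>. The norm is multiplicative, so squaring the
  argument squares the lower bound.\<close>

lemma norm_quadratic_power:
  fixes y :: "'a::real_normed_field"
  assumes "0 \<le> \<mu>"
    and "\<And>z::complex. \<mu>\<^sup>2 \<le> norm (y\<^sup>2 - 2 * of_real (Re z) * y + of_real ((cmod z)\<^sup>2))"
  shows "(\<mu> ^ (2 ^ j))\<^sup>2 \<le> norm ((y ^ (2 ^ j))\<^sup>2 - 2 * of_real (Re z) * y ^ (2 ^ j) + of_real ((cmod z)\<^sup>2))"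
proof (induction j arbitrary: z)
  case 0
  then show ?case using assms by simp
next
  case (Suc j)
  define u where "u = y ^ (2 ^ j)"
  define \<alpha> where "\<alpha> = csqrt z"
  have z: "z = \<alpha>\<^sup>2" by (simp add: \<alpha>_def)
  have cz: "(cmod z)\<^sup>2 = ((cmod \<alpha>)\<^sup>2)\<^sup>2" by (simp add: z norm_power)
  have rez: "Re z = 2 * (Re \<alpha>)\<^sup>2 - (cmod \<alpha>)\<^sup>2"
    by (simp add: z cmod_power2) (simp add: power2_eq_square)
  define a b :: 'a where "a = of_real (Re \<alpha>)" and "b = of_real ((cmod \<alpha>)\<^sup>2)"
  have split: "(u\<^sup>2)\<^sup>2 - 2 * of_real (Re z) * u\<^sup>2 + of_real ((cmod z)\<^sup>2) =
      (u\<^sup>2 - 2 * a * u + b) * (u\<^sup>2 - 2 * (- a) * u + b)"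
    unfolding cz rez of_real_diff of_real_mult of_real_power[of _ 2] of_real_numeral a_def b_def
    by (simp add: algebra_simps power2_eq_square)
  have "(\<mu> ^ (2 ^ j))\<^sup>2 * (\<mu> ^ (2 ^ j))\<^sup>2 \<le> norm (u\<^sup>2 - 2 * a * u + b) * norm (u\<^sup>2 - 2 * (- a) * u + b)"
    using Suc.IH[of \<alpha>] Suc.IH[of "- \<alpha>"] assms(1)
    by (intro mult_mono) (auto simp: u_def a_def b_def)
  then have "(\<mu> ^ (2 ^ j))\<^sup>2 * (\<mu> ^ (2 ^ j))\<^sup>2 \<le>
      norm ((u\<^sup>2)\<^sup>2 - 2 * of_real (Re z) * u\<^sup>2 + of_real ((cmod z)\<^sup>2))"
    by (simp only: norm_mult split)
  moreover have "y ^ (2 ^ Suc j) = u\<^sup>2" "(\<mu> ^ (2 ^ Suc j)) = (\<mu> ^ (2 ^ j))\<^sup>2"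
    by (simp_all add: u_def power_mult[symmetric] mult.commute)
  ultimately show ?case by (simp add: power2_eq_square)
qed

text \<open>Ostrowski's argument: let \<open>m\<close> be the minimum over \<open>z\<close> of \<open>\<bar>(\<xi> - z) (\<xi> - cnj z)\<bar>\<close>, attained
  at \<open>z0\<close>, and \<open>\<eta> = \<xi> - Re z0\<close>. If \<open>m > 0\<close>, then \<open>\<bar>\<eta>\<^sup>2 + \<tau>\<bar> = m\<close> propagates from \<open>\<tau>\<close> to \<open>\<tau> + m / 2\<close>,
  because \<open>h\<^bsup>2^k\<^esup> - \<epsilon>\<^bsup>2^k\<^esup>\<close> with \<open>h = \<eta>\<^sup>2 + \<tau>\<close> and \<open>\<epsilon> = m / 2\<close> has the factor \<open>h + \<epsilon>\<close> and all its
  other factors are products of real quadratics in \<open>\<xi>\<close>; but \<open>\<bar>\<eta>\<^sup>2 + \<tau>\<bar> = m\<close> bounds \<open>\<tau>\<close>.\<close>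

lemma real_normed_field_quadratic_root:
  fixes \<xi> :: "'a::real_normed_field"
  obtains s t :: real where "(\<xi> - of_real s)\<^sup>2 = - of_real (t\<^sup>2)"
proof -
  define f where "f z = norm (\<xi>\<^sup>2 - 2 * of_real (Re z) * \<xi> + of_real ((cmod z)\<^sup>2))" for z :: complex
  have f_nonneg: "0 \<le> f z" for z by (simp add: f_def)
  \<comment> \<open>Outside this disc \<open>f z\<close> is at least
    \<open>norm \<xi> ^ 2 = f 0\<close>, so a minimum over the disc is a global one.\<close>
  define R where "R = 3 * norm \<xi> + 1"
  have "continuous_on (cball 0 R) f"
    unfolding f_def by (intro continuous_intros)
  then obtain z0 where z0: "z0 \<in> cball 0 R" and min0: "\<And>z. z \<in> cball 0 R \<Longrightarrow> f z0 \<le> f z"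
    using continuous_attains_inf[of "cball (0::complex) R" f] norm_ge_zero[of \<xi>]
    by (auto simp: R_def simp del: norm_ge_zero)
  have min: "f z0 \<le> f z" for z
  proof (cases "z \<in> cball 0 R")
    case False
    then have big: "3 * norm \<xi> \<le> cmod z" by (auto simp: R_def)
    have "(cmod z)\<^sup>2 = norm (of_real ((cmod z)\<^sup>2) :: 'a)" by (simp add: norm_power)
    also have "\<dots> \<le> f z + norm (\<xi>\<^sup>2 - 2 * of_real (Re z) * \<xi>)"
      unfolding f_def by norm
    also have "norm (\<xi>\<^sup>2 - 2 * of_real (Re z) * \<xi>) \<le> norm \<xi> ^ 2 + 2 * \<bar>Re z\<bar> * norm \<xi>"
      by (rule order_trans[OF norm_triangle_ineq4]) (simp add: norm_mult norm_power)
    also have "2 * \<bar>Re z\<bar> * norm \<xi> \<le> 2 * cmod z * norm \<xi>"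
      by (intro mult_right_mono mult_left_mono abs_Re_le_cmod) auto
    finally have "(cmod z)\<^sup>2 - 2 * cmod z * norm \<xi> \<le> f z + norm \<xi> ^ 2" by simp
    moreover have "norm \<xi> * (3 * norm \<xi> - 2 * norm \<xi>) \<le> cmod z * (cmod z - 2 * norm \<xi>)"
      using big norm_ge_zero[of \<xi>] by (intro mult_mono) linarith+
    moreover have "3 * (norm \<xi> * norm \<xi>) \<le> cmod z * norm \<xi>"
      using mult_right_mono[OF big norm_ge_zero[of \<xi>]] by simp
    moreover have "3 * (norm \<xi> * cmod z) \<le> cmod z * cmod z"
      using mult_right_mono[OF big norm_ge_zero[of z]] by simp
    ultimately have "norm \<xi> ^ 2 \<le> f z"
      by (simp add: power2_eq_square algebra_simps)
    moreover have "f z0 \<le> norm \<xi> ^ 2"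
      using min0[of 0] by (simp add: R_def f_def norm_power)
    ultimately show ?thesis by simp
  qed (use min0 in auto)
  define m where "m = f z0"
  define \<eta> :: 'a where "\<eta> = \<xi> - of_real (Re z0)"
  have f_eta: "f (of_real (Re z0) + z) = norm (\<eta>\<^sup>2 - 2 * of_real (Re z) * \<eta> + of_real ((cmod z)\<^sup>2))" for z
  proof -
    have "\<xi>\<^sup>2 - 2 * of_real (Re (of_real (Re z0) + z)) * \<xi> + of_real ((cmod (of_real (Re z0) + z))\<^sup>2)
      = \<eta>\<^sup>2 - 2 * of_real (Re z) * \<eta> + of_real ((cmod z)\<^sup>2)"
    proof -
      have c: "(cmod (of_real (Re z0) + z))\<^sup>2 = (Re z0)\<^sup>2 + 2 * Re z0 * Re z + (cmod z)\<^sup>2"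
        unfolding cmod_power2 by (simp add: power2_eq_square algebra_simps)
      show ?thesis unfolding c by (simp add: \<eta>_def power2_eq_square algebra_simps)
    qed
    then show ?thesis by (simp add: f_def)
  qed
  have step: "norm (\<eta>\<^sup>2 + of_real (\<tau> + m / 2)) = m"
    if \<tau>: "0 \<le> \<tau>" and eq: "norm (\<eta>\<^sup>2 + of_real \<tau>) = m" and "0 < m" for \<tau>
  proof -
    define h where "h = \<eta>\<^sup>2 + of_real \<tau>"
    define \<epsilon> where "\<epsilon> = m / 2"
    \<comment> \<open>With \<open>\<alpha>\<close> a square root of \<open>z - \<tau>\<close>, the
      quadratic of \<open>z\<close> at \<open>h\<close> splits into those of \<open>\<alpha>\<close>
      and \<open>- \<alpha>\<close> at \<open>\<eta>\<close>, each of norm at least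
      \<open>m\<close>.\<close>
    have P: "m\<^sup>2 \<le> norm (h\<^sup>2 - 2 * of_real (Re z) * h + of_real ((cmod z)\<^sup>2))" for z
    proof -
      define \<alpha> where "\<alpha> = csqrt (z - of_real \<tau>)"
      have z: "z = of_real \<tau> + \<alpha>\<^sup>2" by (simp add: \<alpha>_def)
      define a b where "a = Re \<alpha>" and "b = Im \<alpha>"
      have re: "Re z = \<tau> + a\<^sup>2 - b\<^sup>2" and im: "Im z = 2 * a * b"
        by (simp_all add: z a_def b_def power2_eq_square)
      have cz: "(cmod z)\<^sup>2 = (\<tau> + a\<^sup>2 - b\<^sup>2)\<^sup>2 + (2 * a * b)\<^sup>2"
        unfolding cmod_power2 re im ..
      have c\<alpha>: "(cmod \<alpha>)\<^sup>2 = a\<^sup>2 + b\<^sup>2" "(cmod (- \<alpha>))\<^sup>2 = a\<^sup>2 + b\<^sup>2"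
        by (simp_all only: cmod_power2 a_def b_def norm_minus_cancel)
      have "h\<^sup>2 - 2 * of_real (Re z) * h + of_real ((cmod z)\<^sup>2) =
          (\<eta>\<^sup>2 - 2 * of_real (Re \<alpha>) * \<eta> + of_real ((cmod \<alpha>)\<^sup>2)) * (\<eta>\<^sup>2 - 2 * of_real (Re (- \<alpha>)) * \<eta> + of_real ((cmod (- \<alpha>))\<^sup>2))"
        unfolding cz c\<alpha> re by (simp add: h_def a_def[symmetric] power2_eq_square algebra_simps)
      then have "norm (h\<^sup>2 - 2 * of_real (Re z) * h + of_real ((cmod z)\<^sup>2)) =
          f (of_real (Re z0) + \<alpha>) * f (of_real (Re z0) + (- \<alpha>))"
        by (simp only: norm_mult f_eta)
      also have "\<dots> \<ge> m * m"
        using min f_nonneg unfolding m_def by (intro mult_mono) auto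
      finally show ?thesis by (simp add: power2_eq_square)
    qed
    have Pj: "m ^ (2 ^ j) \<le> norm (h ^ (2 ^ j) - of_real r)" for j r
    proof -
      have eq: "(h ^ (2 ^ j))\<^sup>2 - 2 * of_real (Re (of_real r)) * h ^ (2 ^ j) + of_real ((cmod (of_real r))\<^sup>2)
          = (h ^ (2 ^ j) - of_real r)\<^sup>2"
        by (simp add: power2_eq_square algebra_simps)
      have "(m ^ (2 ^ j))\<^sup>2 \<le> (norm (h ^ (2 ^ j) - of_real r))\<^sup>2"
        using norm_quadratic_power[of m h j "of_real r", OF _ P] \<open>0 < m\<close>
        unfolding eq by (simp add: norm_power)
      then show ?thesis by (rule power2_le_imp_le) simp
    qed
    \<comment> \<open>The difference of powers factors as \<open>(h - \<epsilon>) (h + \<epsilon>)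
      (h^2 + \<epsilon>^2) (h^4 + \<epsilon>^4) ...\<close>, and \<open>Pj\<close> bounds every
      factor except \<open>h + \<epsilon>\<close> from below. The exponents add up to
      \<open>2 ^ Suc k - 1\<close>; the extra \<open>m\<close> on the right rounds this up.\<close>
    have upper: "norm (h + of_real \<epsilon>) * m ^ (2 ^ Suc k)
        \<le> m * norm (h ^ (2 ^ Suc k) - of_real (\<epsilon> ^ (2 ^ Suc k)))" for k
    proof (induction k)
      case 0
      have "norm (h + of_real \<epsilon>) * m \<le> norm (h + of_real \<epsilon>) * norm (h - of_real \<epsilon>)"
        using Pj[of 0 \<epsilon>] by (intro mult_left_mono) auto
      also have "\<dots> = norm (h\<^sup>2 - of_real (\<epsilon>\<^sup>2))"
        by (simp add: norm_mult[symmetric] power2_eq_square algebra_simps)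
      finally have "m * (norm (h + of_real \<epsilon>) * m) \<le> m * norm (h\<^sup>2 - of_real (\<epsilon>\<^sup>2))"
        using \<open>0 < m\<close> by (intro mult_left_mono) auto
      then show ?case by (simp add: power2_eq_square algebra_simps)
    next
      case (Suc k)
      define u e where "u = h ^ (2 ^ Suc k)" and "e = \<epsilon> ^ (2 ^ Suc k)"
      have sq: "h ^ (2 ^ Suc (Suc k)) = u\<^sup>2" "\<epsilon> ^ (2 ^ Suc (Suc k)) = e\<^sup>2"
        "m ^ (2 ^ Suc (Suc k)) = m ^ (2 ^ Suc k) * m ^ (2 ^ Suc k)"
        by (simp_all add: u_def e_def power_mult[symmetric] power_add[symmetric] mult.commute)
      have "norm (h + of_real \<epsilon>) * m ^ (2 ^ Suc k) * m ^ (2 ^ Suc k)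
          \<le> m * norm (u - of_real e) * norm (u - of_real (- e))"
        using Suc.IH Pj[of "Suc k" "- e"] \<open>0 < m\<close> 
        unfolding u_def e_def by (intro mult_mono[of "norm (h + of_real \<epsilon>) * m ^ (2 ^ Suc k)"]) auto
      also have "\<dots> = m * norm (u\<^sup>2 - of_real (e\<^sup>2))"
        by (simp add: norm_mult[symmetric] power2_eq_square algebra_simps)
      finally show ?case unfolding sq by (simp add: mult.assoc)
    qed
    have normh: "norm h = m" using eq by (simp add: h_def)
    have "norm (h + of_real \<epsilon>) \<le> m + m * (1 / 2) ^ k" for k
    proof -
      define n :: nat where "n = 2 ^ Suc k"
      have "norm (h + of_real \<epsilon>) * m ^ n \<le> m * norm (h ^ n - of_real (\<epsilon> ^ n))"
        using upper[of k] by (simp add: n_def)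
      also have "\<dots> \<le> m * (m ^ n + (m / 2) ^ n)"
        using \<open>0 < m\<close> normh by (intro mult_left_mono order_trans[OF norm_triangle_ineq4])
          (auto simp: norm_power \<epsilon>_def)
      also have "\<dots> = (m + m * (1 / 2) ^ n) * m ^ n"
        by (simp add: power_divide algebra_simps)
      finally have "norm (h + of_real \<epsilon>) \<le> m + m * (1 / 2) ^ n"
        using \<open>0 < m\<close> by (simp add: mult_le_cancel_right)
      moreover have "(1 / 2 :: real) ^ n \<le> (1 / 2) ^ k"
        unfolding n_def by (intro power_decreasing) (use less_exp[of "Suc k"] in \<open>auto intro: less_imp_le\<close>)
      ultimately show ?thesis
        using \<open>0 < m\<close> by (smt (verit) mult_left_mono)
    qed
    moreover have "(\<lambda>k. m + m * (1 / 2) ^ k) \<longlonglongrightarrow> m + m * 0"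
      by (intro tendsto_intros LIMSEQ_power_zero) auto
    ultimately have "norm (h + of_real \<epsilon>) \<le> m"
      by (intro LIMSEQ_le_const[where X = "\<lambda>k. m + m * (1 / 2) ^ k"]) auto
    moreover have "m \<le> norm (h + of_real \<epsilon>)" using Pj[of 0 "- \<epsilon>"] by simp
    ultimately show ?thesis by (simp add: h_def \<epsilon>_def add.assoc)
  qed
  have eta0: "norm (\<eta>\<^sup>2 + of_real ((Im z0)\<^sup>2)) = m"
    using f_eta[of "\<i> * of_real (Im z0)"] complex_eq[of z0]
    by (simp add: m_def norm_mult norm_power mult.commute)
  have "m = 0"
  proof (rule ccontr)
    assume "m \<noteq> 0"
    then have "0 < m" using norm_ge_zero by (auto simp: m_def f_def less_le)
    have all: "norm (\<eta>\<^sup>2 + of_real ((Im z0)\<^sup>2 + real i * (m / 2))) = m" for i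
    proof (induction i)
      case (Suc i)
      show ?case
        using step[OF _ Suc.IH \<open>0 < m\<close>] \<open>0 < m\<close> by (simp add: algebra_simps add_divide_distrib)
    qed (use eta0 in simp)
    \<comment> \<open>Five is the first number of steps of length \<open>m / 2\<close> that exceeds
      \<open>2 * m\<close>, the largest possible distance between two elements of norm
      \<open>m\<close>.\<close>
    have "norm (of_real (5 * (m / 2)) :: 'a) \<le>
        norm (\<eta>\<^sup>2 + of_real ((Im z0)\<^sup>2 + real 5 * (m / 2))) + norm (\<eta>\<^sup>2 + of_real ((Im z0)\<^sup>2))"
      by (rule order_trans[OF _ norm_triangle_ineq4]) (simp add: algebra_simps)
    also have "\<dots> = 2 * m" using all[of 5] eta0 by simp
    finally show False using \<open>0 < m\<close> unfolding norm_of_real by simp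
  qed
  then have "\<eta>\<^sup>2 = - of_real ((Im z0)\<^sup>2)"
    using eta0 by (simp add: eq_neg_iff_add_eq_0)
  then show ?thesis using that unfolding \<eta>_def by blast
qed

text \<open>Gelfand--Mazur: the scalar field is the real or the complex numbers.\<close>

lemma real_normed_field_generated:
  obtains \<iota> :: "'a::real_normed_field" where "\<And>x. \<exists>a b. x = of_real a + of_real b * \<iota>"
proof (cases "\<forall>x::'a. \<exists>a. x = of_real a")
  case True
  show ?thesis
  proof (rule that[of 0])
    show "\<exists>a b. x = of_real a + of_real b * (0::'a)" for x using True by auto
  qed
next
  case False
  then obtain \<xi> :: 'a where \<xi>: "\<And>a. \<xi> \<noteq> of_real a" by blast
  obtain s t where st: "(\<xi> - of_real s)\<^sup>2 = - of_real (t\<^sup>2)" by (rule real_normed_field_quadratic_root)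
  have "t \<noteq> 0"
  proof
    assume "t = 0"
    then have "\<xi> = of_real s" using st by simp
    then show False using \<xi> by blast
  qed
  define \<iota> where "\<iota> = (\<xi> - of_real s) / of_real t"
  have i2: "\<iota>\<^sup>2 = -1" using st \<open>t \<noteq> 0\<close> by (simp add: \<iota>_def power_divide)
  show ?thesis
  proof (rule that[of \<iota>])
    fix x :: 'a
    obtain a b where ab: "(x - of_real a)\<^sup>2 = - of_real (b\<^sup>2)" by (rule real_normed_field_quadratic_root)
    also have "\<dots> = (of_real b * \<iota>)\<^sup>2" by (simp add: power_mult_distrib i2)
    finally consider "x - of_real a = of_real b * \<iota>" | "x - of_real a = - (of_real b * \<iota>)"
      by (auto simp: power2_eq_iff)
    then show "\<exists>a b. x = of_real a + of_real b * \<iota>"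
    proof cases
      case 1 then show ?thesis by (metis add.commute diff_add_cancel)
    next
      case 2
      then have "x = of_real a + of_real (- b) * \<iota>" by (simp add: algebra_simps eq_diff_eq)
      then show ?thesis by blast
    qed
  qed
qed

lemma dense_sequence_exists:
  obtains D :: "nat \<Rightarrow> 'a::real_normed_field" where "\<And>x e. 0 < e \<Longrightarrow> \<exists>i. norm (D i - x) < e"
proof -
  obtain \<iota> :: 'a where \<iota>: "\<And>x. \<exists>a b. x = of_real a + of_real b * \<iota>"
    by (rule real_normed_field_generated) blast
  define E where "E q = (of_real (of_rat (fst q)) + of_real (of_rat (snd q)) * \<iota> :: 'a)" for q :: "rat \<times> rat"
  show ?thesis
  proof (rule that[of "\<lambda>n. E (from_nat n)"])
    fix x :: 'a and e :: real assume "0 < e"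
    obtain a b where x: "x = of_real a + of_real b * \<iota>" using \<iota> by blast
    define d where "d = e / (2 * (1 + norm \<iota>))"
    have "0 < d" using \<open>0 < e\<close> by (simp add: d_def add_pos_nonneg)
    obtain q where q: "a < of_rat q" "of_rat q < a + d" using of_rat_dense[of a "a + d"] \<open>0 < d\<close> by auto
    obtain r where r: "b < of_rat r" "of_rat r < b + d" using of_rat_dense[of b "b + d"] \<open>0 < d\<close> by auto
    have "E (q, r) - x = of_real (of_rat q - a) + of_real (of_rat r - b) * \<iota>"
      by (simp add: E_def x algebra_simps)
    also have "norm \<dots> \<le> \<bar>of_rat q - a\<bar> + \<bar>of_rat r - b\<bar> * norm \<iota>"
      by (rule order_trans[OF norm_triangle_ineq]) (simp only: norm_mult norm_of_real order_refl)
    also have "\<dots> \<le> d + d * norm \<iota>"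
      using q r by (intro add_mono mult_right_mono) auto
    also have "\<dots> = e / 2" by (simp add: d_def field_simps add_nonneg_eq_0_iff)
    finally have "norm (E (q, r) - x) < e" using \<open>0 < e\<close> by simp
    then show "\<exists>i. norm (E (from_nat i) - x) < e"
      by (metis from_nat_to_nat)
  qed
qed

section \<open>The space of p-summable sequences\<close>

text \<open>Convexity of the power function at \<open>a / (1 - \<theta>)\<close> and
  \<open>b / \<theta>\<close>. The weight \<open>\<theta>\<close> stays free: it is fixed once for
  all coordinates from the two norms, which yields Minkowski's inequality without Hoelder's.\<close>

lemma powr_add_le_convex:
  fixes a b p \<theta> :: real
  assumes "1 \<le> p" "0 < \<theta>" "\<theta> < 1" "0 \<le> a" "0 \<le> b"
  shows "(a + b) powr p \<le> (1 - \<theta>) powr (1 - p) * a powr p + \<theta> powr (1 - p) * b powr p"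
proof -
  have scale: "t * ((y / t) powr p) = t powr (1 - p) * y powr p" if "0 < t" "0 \<le> y" for t y :: real
    using that by (simp add: powr_divide powr_diff)
  consider "a = 0" | "b = 0" | "0 < a" "0 < b" using assms by linarith
  then show ?thesis
  proof cases
    case 1
    have "1 \<le> \<theta> powr (1 - p)"
      using assms powr_mono2'[of "1 - p" \<theta> 1] by simp
    from mult_right_mono[OF this, of "b powr p"] show ?thesis using 1 assms by simp
  next
    case 2
    have "1 \<le> (1 - \<theta>) powr (1 - p)"
      using assms powr_mono2'[of "1 - p" "1 - \<theta>" 1] by simp
    from mult_right_mono[OF this, of "a powr p"] show ?thesis using 2 assms by simp
  next
    case 3
    have "((1 - \<theta>) *\<^sub>R (a / (1 - \<theta>)) + \<theta> *\<^sub>R (b / \<theta>)) powr p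
        \<le> (1 - \<theta>) * (a / (1 - \<theta>)) powr p + \<theta> * (b / \<theta>) powr p"
      by (rule convex_onD[OF powr_convex[OF assms(1)]]) (use assms 3 in auto)
    then show ?thesis using assms 3 by (simp add: scale)
  qed
qed

lemma powr_add_le:
  fixes a b p :: real
  assumes "1 \<le> p" "0 \<le> a" "0 \<le> b"
  shows "(a + b) powr p \<le> 2 powr p * (a powr p + b powr p)"
proof -
  have "(a + b) powr p \<le> (2 * max a b) powr p"
    using assms by (intro powr_mono2) auto
  also have "\<dots> = 2 powr p * max (a powr p) (b powr p)"
    using assms powr_mono2[of p a b] powr_mono2[of p b a]
    by (cases "a \<le> b") (auto simp: powr_mult max_def)
  also have "\<dots> \<le> 2 powr p * (a powr p + b powr p)"
    by (intro mult_left_mono) auto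
  finally show ?thesis .
qed

lemma powr_le_iff_root:
  fixes a b p :: real
  assumes "0 < p" "0 \<le> a" "0 \<le> b"
  shows "a powr (1 / p) < b \<longleftrightarrow> a < b powr p"
proof -
  have "a = (a powr (1 / p)) powr p" using assms by (simp add: powr_powr)
  moreover have "(a powr (1 / p)) powr p < b powr p \<longleftrightarrow> a powr (1 / p) < b"
    using assms powr_less_mono2[of p "a powr (1 / p)" b] powr_mono2[of p b "a powr (1 / p)"]
    by (auto simp: not_less[symmetric])
  ultimately show ?thesis by metis
qed

lemma lp_add:
  assumes "1 \<le> p" "x \<in> lp p" "y \<in> lp p"
  shows "(\<lambda>n. x n + y n) \<in> lp p"
proof -
  have "norm (norm (x n + y n) powr p) \<le> 2 powr p * (norm (x n) powr p + norm (y n) powr p)" for n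
    using powr_add_le[of p "norm (x n)" "norm (y n)"] assms(1)
      powr_mono2[of p "norm (x n + y n)" "norm (x n) + norm (y n)"] norm_triangle_ineq[of "x n" "y n"]
    by simp
  then show ?thesis
    using assms unfolding lp_def
    by (auto intro!: summable_comparison_test'[of "\<lambda>n. 2 powr p * (norm (x n) powr p + norm (y n) powr p)"]
        summable_mult summable_add)
qed

lemma lp_scale:
  assumes "x \<in> lp p"
  shows "(\<lambda>n. c * x n) \<in> lp p"
  using assms summable_mult[of "\<lambda>n. norm (x n) powr p" "norm c powr p"]
  by (simp add: lp_def norm_mult powr_mult)

lemma lp_diff:
  assumes "1 \<le> p" "x \<in> lp p" "y \<in> lp p"
  shows "(\<lambda>n. x n - y n) \<in> lp p"
  using lp_add[OF assms(1,2) lp_scale[OF assms(3), of "-1"]] by simp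

lemma lp_zero: "(\<lambda>n. 0) \<in> lp p"
  by (simp add: lp_def)

lemma lp_norm_nonneg: "0 \<le> lp_norm p x"
  by (simp add: lp_norm_def)

lemma lp_norm_less_iff:
  assumes "0 < p" "x \<in> lp p" "0 \<le> e"
  shows "lp_norm p x < e \<longleftrightarrow> (\<Sum>n. norm (x n) powr p) < e powr p"
  using assms unfolding lp_norm_def lp_def
  by (intro powr_le_iff_root) (auto intro!: suminf_nonneg)

lemma lp_norm_powr:
  assumes "0 < p" "x \<in> lp p"
  shows "lp_norm p x powr p = (\<Sum>n. norm (x n) powr p)"
  using assms unfolding lp_norm_def lp_def
  by (simp add: powr_powr suminf_nonneg)

lemma norm_le_lp_norm:
  assumes "0 < p" "x \<in> lp p"
  shows "norm (x n) \<le> lp_norm p x"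
proof (rule ccontr)
  assume "\<not> ?thesis"
  then have "(\<Sum>n. norm (x n) powr p) < norm (x n) powr p"
    using lp_norm_less_iff[of p x "norm (x n)"] assms by simp
  moreover have "(\<Sum>n\<in>{n}. norm (x n) powr p) \<le> (\<Sum>n. norm (x n) powr p)"
    using assms by (intro sum_le_suminf) (auto simp: lp_def)
  ultimately show False by simp
qed

lemma lp_norm_triangle:
  assumes "1 \<le> p" "x \<in> lp p" "y \<in> lp p"
  shows "lp_norm p (\<lambda>n. x n + y n) \<le> lp_norm p x + lp_norm p y"
proof -
  define A B where "A = lp_norm p x" and "B = lp_norm p y"
  have p: "0 < p" using assms by simp
  \<comment> \<open>Strict upper bounds replace the norms themselves, so that \<open>a\<close> and
    \<open>b\<close> are positive and \<open>\<theta>\<close> lies strictly between 0 and 1 even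
    when a norm vanishes.\<close>
  have key: "lp_norm p (\<lambda>n. x n + y n) \<le> a + b" if "A < a" "B < b" for a b
  proof -
    have pos: "0 < a" "0 < b" using that lp_norm_nonneg[of p x] lp_norm_nonneg[of p y]
      by (auto simp: A_def B_def)
    \<comment> \<open>For this weight the convex bound with \<open>a\<close> and \<open>b\<close>
      collapses to exactly \<open>(a + b) powr p\<close>.\<close>
    define \<theta> where "\<theta> = b / (a + b)"
    have th: "0 < \<theta>" "\<theta> < 1" "1 - \<theta> = a / (a + b)" using pos by (auto simp: \<theta>_def field_simps)
    define f where "f n = (1 - \<theta>) powr (1 - p) * norm (x n) powr p + \<theta> powr (1 - p) * norm (y n) powr p" for n
    have sf: "summable f" unfolding f_def
      using assms by (intro summable_add summable_mult) (auto simp: lp_def)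
    have le: "norm (x n + y n) powr p \<le> f n" for n
      unfolding f_def
      by (rule order_trans[OF powr_mono2 powr_add_le_convex])
        (use p assms(1) th norm_triangle_ineq in auto)
    have sxy: "(\<lambda>n. x n + y n) \<in> lp p" using lp_add assms by blast
    have "(\<Sum>n. norm (x n + y n) powr p) \<le> suminf f"
      using sxy sf le by (intro suminf_le) (auto simp: lp_def)
    also have "\<dots> = (1 - \<theta>) powr (1 - p) * A powr p + \<theta> powr (1 - p) * B powr p"
      unfolding f_def A_def B_def lp_norm_powr[OF p assms(2)] lp_norm_powr[OF p assms(3)]
      using assms by (subst suminf_add[symmetric]) (auto simp: lp_def suminf_mult intro!: summable_mult)
    also have "\<dots> < (1 - \<theta>) powr (1 - p) * a powr p + \<theta> powr (1 - p) * b powr p"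
      using th that p by (intro add_strict_mono mult_strict_left_mono powr_less_mono2)
        (auto simp: A_def B_def lp_norm_nonneg)
    also have "\<dots> = (a + b) powr p"
    proof -
      have eq: "(t / s) powr (1 - p) * t powr p = s powr (p - 1) * t" if "0 < t" "0 < s" for t s :: real
      proof -
        have "(t / s) powr (1 - p) * t powr p = (t powr (1 - p) * t powr p) / s powr (1 - p)"
          using that by (simp add: powr_divide)
        also have "\<dots> = t / s powr (1 - p)" using that by (simp add: powr_add[symmetric])
        also have "\<dots> = s powr (p - 1) * t" using that powr_minus_divide[of s "1 - p"] by simp
        finally show ?thesis .
      qed
      have "(1 - \<theta>) powr (1 - p) * a powr p = (a + b) powr (p - 1) * a"
        using pos unfolding th(3) by (intro eq) auto
      moreover have "\<theta> powr (1 - p) * b powr p = (a + b) powr (p - 1) * b"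
        using pos unfolding \<theta>_def by (intro eq) auto
      moreover have "(a + b) powr p = (a + b) powr (p - 1) * (a + b)"
        using pos by (simp add: powr_diff)
      ultimately show ?thesis by (simp add: distrib_left)
    qed
    finally show ?thesis using lp_norm_less_iff[OF p sxy, of "a + b"] pos by simp
  qed
  show ?thesis
  proof (rule field_le_epsilon)
    fix e :: real assume "0 < e"
    then show "lp_norm p (\<lambda>n. x n + y n) \<le> lp_norm p x + lp_norm p y + e"
      using key[of "A + e / 2" "B + e / 2"] by (simp add: A_def B_def)
  qed
qed

lemma lp_dist_triangle:
  assumes "1 \<le> p" "x \<in> lp p" "y \<in> lp p" "z \<in> lp p"
  shows "lp_dist p x z \<le> lp_dist p x y + lp_dist p y z"
  using lp_norm_triangle[OF assms(1) lp_diff[OF assms(1,2,3)] lp_diff[OF assms(1,3,4)]]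
  by (simp add: lp_dist_def)

lemma lp_dist_refl [simp]: "0 < p \<Longrightarrow> lp_dist p x x = 0"
  by (simp add: lp_dist_def lp_norm_def)

lemma lp_open_ball:
  assumes "1 \<le> p" "a \<in> lp p"
  shows "lp_open p {z \<in> lp p. lp_dist p z a < r}"
  unfolding lp_open_def
proof (intro conjI ballI)
  fix x assume x: "x \<in> {z \<in> lp p. lp_dist p z a < r}"
  show "\<exists>e>0. {y \<in> lp p. lp_dist p y x < e} \<subseteq> {z \<in> lp p. lp_dist p z a < r}"
  proof (intro exI conjI)
    show "0 < r - lp_dist p x a" using x by simp
    show "{y \<in> lp p. lp_dist p y x < r - lp_dist p x a} \<subseteq> {z \<in> lp p. lp_dist p z a < r}"
      using x lp_dist_triangle[OF assms(1) _ _ assms(2)] by fastforce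
  qed
qed auto

lemma lp_open_coordinate:
  assumes "1 \<le> p"
  shows "lp_open p {z \<in> lp p. r < norm (z 0)}"
  unfolding lp_open_def
proof (intro conjI ballI)
  fix x :: "nat \<Rightarrow> 'a" assume x: "x \<in> {z \<in> lp p. r < norm (z 0)}"
  show "\<exists>e>0. {y \<in> lp p. lp_dist p y x < e} \<subseteq> {z \<in> lp p. r < norm (z 0)}"
  proof (intro exI conjI subsetI)
    show "0 < norm (x 0) - r" using x by simp
    fix y assume y: "y \<in> {y \<in> lp p. lp_dist p y x < norm (x 0) - r}"
    have "norm (y 0 - x 0) \<le> lp_dist p y x"
      unfolding lp_dist_def using norm_le_lp_norm[OF _ lp_diff[OF assms], of y x 0] x y assms by auto
    then have "r < norm (y 0)" using y norm_triangle_ineq2[of "x 0" "y 0"]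
      by (simp add: norm_minus_commute)
    then show "y \<in> {z \<in> lp p. r < norm (z 0)}" using y by simp
  qed
qed auto

text \<open>Norm estimates can thus be carried out on finite sums, with membership in the space as a
  by-product.\<close>

lemma lp_normI:
  assumes p: "0 < p" and c: "0 \<le> c" and bound: "\<And>L. (\<Sum>n<L. norm (x n) powr p) \<le> c powr p"
  shows "x \<in> lp p" "lp_norm p x \<le> c"
proof -
  have s: "summable (\<lambda>n. norm (x n) powr p)"
    by (rule summableI_nonneg_bounded) (use bound in auto)
  then show "x \<in> lp p" by (simp add: lp_def)
  have "(\<Sum>n. norm (x n) powr p) \<le> c powr p"
    by (rule suminf_le_const[OF s bound])
  then have "lp_norm p x \<le> (c powr p) powr (1 / p)"
    unfolding lp_norm_def using p s by (intro powr_mono2) (auto intro!: suminf_nonneg)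
  then show "lp_norm p x \<le> c"
    using p c by (simp add: powr_powr)
qed

section \<open>Sets of positive upper density\<close>

lemma limsup_pos_subsequence:
  assumes "upper_density A > 0"
  obtains \<delta> :: real and N :: "nat \<Rightarrow> nat" where "0 < \<delta>" "strict_mono N"
    "\<forall>i. \<delta> * real (N i + 1) \<le> real (card (A \<inter> {0..N i}))"
proof -
  obtain \<delta> where d: "0 < ereal \<delta>" "ereal \<delta> < upper_density A"
    using assms ereal_dense2 by blast
  have "\<exists>\<^sub>F n in sequentially. ereal \<delta> < ereal (real (card (A \<inter> {0..n})) / real (n + 1))"
  proof (rule ccontr)
    assume "\<not> ?thesis"
    then have "\<forall>\<^sub>F n in sequentially. ereal (real (card (A \<inter> {0..n})) / real (n + 1)) \<le> ereal \<delta>"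
      by (simp add: frequently_def not_less)
    then have "upper_density A \<le> ereal \<delta>"
      unfolding upper_density_def by (rule Limsup_bounded)
    then show False using d by simp
  qed
  then have "infinite {n. \<delta> < real (card (A \<inter> {0..n})) / real (n + 1)}"
    by (simp add: frequently_sequentially cofinite_eq_sequentially[symmetric] frequently_cofinite)
  then obtain N :: "nat \<Rightarrow> nat" where N: "strict_mono N"
    "\<And>i. N i \<in> {n. \<delta> < real (card (A \<inter> {0..n})) / real (n + 1)}"
    using infinite_enumerate by blast
  show ?thesis
  proof (rule that[OF _ N(1)])
    show "\<forall>i. \<delta> * real (N i + 1) \<le> real (card (A \<inter> {0..N i}))"
      using N(2) by (simp add: field_simps less_imp_le)
  qed (use d in simp)
qed

lemma card_shift_le:
  "real (card {n. n \<le> N \<and> n + s \<in> A \<and> n + t \<in> A}) \<le> real (card {n. n \<le> N \<and> n \<in> A \<and> n + (t - s) \<in> A}) + real s"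
  if "s \<le> t" for s t N :: nat
proof -
  have "(\<lambda>n. n + s) ` {n. n \<le> N \<and> n + s \<in> A \<and> n + t \<in> A} \<subseteq>
      {n. n \<le> N \<and> n \<in> A \<and> n + (t - s) \<in> A} \<union> {N<..N + s}"
    using that by (auto simp: not_le add.commute add.left_commute)
  then have "card ((\<lambda>n. n + s) ` {n. n \<le> N \<and> n + s \<in> A \<and> n + t \<in> A}) \<le>
      card ({n. n \<le> N \<and> n \<in> A \<and> n + (t - s) \<in> A} \<union> {N<..N + s})"
    by (intro card_mono) auto
  also have "\<dots> \<le> card {n. n \<le> N \<and> n \<in> A \<and> n + (t - s) \<in> A} + s"
    using card_Un_le[of "{n. n \<le> N \<and> n \<in> A \<and> n + (t - s) \<in> A}" "{N<..N + s}"] by simp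
  also have "card ((\<lambda>n. n + s) ` {n. n \<le> N \<and> n + s \<in> A \<and> n + t \<in> A}) =
      card {n. n \<le> N \<and> n + s \<in> A \<and> n + t \<in> A}"
    by (intro card_image) auto
  finally show ?thesis by linarith
qed

lemma card_shift_ge:
  "real (card (A \<inter> {0..N})) - real s \<le> real (card {n. n \<le> N \<and> n + s \<in> A})" for s N :: nat
proof -
  have "A \<inter> {0..N} \<subseteq> (\<lambda>n. n + s) ` {n. n \<le> N \<and> n + s \<in> A} \<union> {0..<s}"
  proof
    fix n assume n: "n \<in> A \<inter> {0..N}"
    show "n \<in> (\<lambda>n. n + s) ` {n. n \<le> N \<and> n + s \<in> A} \<union> {0..<s}"
    proof (cases "n < s")
      case False
      then have "n = (n - s) + s" "n - s \<in> {n. n \<le> N \<and> n + s \<in> A}" using n by auto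
      then show ?thesis by blast
    qed auto
  qed
  then have "card (A \<inter> {0..N}) \<le> card ((\<lambda>n. n + s) ` {n. n \<le> N \<and> n + s \<in> A} \<union> {0..<s})"
    by (intro card_mono) auto
  also have "\<dots> \<le> card ((\<lambda>n. n + s) ` {n. n \<le> N \<and> n + s \<in> A}) + s"
    using card_Un_le[of "(\<lambda>n. n + s) ` {n. n \<le> N \<and> n + s \<in> A}" "{0..<s}"] by simp
  also have "\<dots> \<le> card {n. n \<le> N \<and> n + s \<in> A} + s"
    using card_image_le[of "{n. n \<le> N \<and> n + s \<in> A}" "\<lambda>n. n + s"] by simp
  finally show ?thesis by linarith
qed

lemma sum_of_bool_atMost:
  "(\<Sum>n\<le>(N::nat). of_bool (P n) :: real) = real (card {n. n \<le> N \<and> P n})"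
  by (simp add: Int_def)

text \<open>The Cauchy--Schwarz inequality is applied to the number \<open>f n\<close> of shifts that contain \<open>n\<close>.\<close>

lemma card_almost_disjoint_shifts:
  fixes A :: "nat set" and S :: "nat set" and d :: "nat \<Rightarrow> real"
  assumes S: "finite S" and \<delta>: "0 < \<delta>" and N: "strict_mono N"
    and dens: "\<And>i. \<delta> * real (N i + 1) \<le> real (card (A \<inter> {0..N i}))"
    and lim: "\<And>k. (\<lambda>i. real (card {n. n \<le> N i \<and> n \<in> A \<and> n + k \<in> A}) / real (N i + 1)) \<longlonglongrightarrow> d k"
    and sep: "\<And>s t. s \<in> S \<Longrightarrow> t \<in> S \<Longrightarrow> s < t \<Longrightarrow> d (t - s) \<le> \<delta>\<^sup>2 / 2"
  shows "real (card S) \<le> 2 / \<delta>\<^sup>2"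
proof -
  define r where "r = real (card S)"
  define M where "M i = real (N i + 1)" for i
  define c where "c i k = real (card {n. n \<le> N i \<and> n \<in> A \<and> n + k \<in> A})" for i k
  define m where "m = real (Max (insert 0 S))"
  have m: "real s \<le> m" if "s \<in> S" for s unfolding m_def using S that by simp
  have M: "0 < M i" for i by (simp add: M_def)
  define f where "f n = (\<Sum>s\<in>S. of_bool (n + s \<in> A) :: real)" for n
  have f1: "r * (\<delta> * M i - m) \<le> (\<Sum>n\<le>N i. f n)" for i
  proof -
    have "(\<Sum>n\<le>N i. f n) = (\<Sum>s\<in>S. real (card {n. n \<le> N i \<and> n + s \<in> A}))"
      unfolding f_def by (subst sum.swap) (simp only: sum_of_bool_atMost)
    also have "\<dots> \<ge> (\<Sum>s\<in>S. \<delta> * M i - m)"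
      using dens[of i] m by (intro sum_mono order_trans[OF _ card_shift_ge]) (auto simp: M_def intro: diff_mono)
    finally show ?thesis by (simp add: r_def)
  qed
  \<comment> \<open>Diagonal pairs are counted trivially. An off-diagonal pair is a correlation at
    the difference of the two shifts, and \<open>m\<close> bounds the error of moving the
    window.\<close>
  define e where "e i = (\<Sum>s\<in>S. \<Sum>t\<in>S. if s = t then M i else c i (max s t - min s t) + m)" for i
  have f2: "(\<Sum>n\<le>N i. (f n)\<^sup>2) \<le> e i" for i
  proof -
    have "(\<Sum>n\<le>N i. (f n)\<^sup>2) = (\<Sum>n\<le>N i. \<Sum>s\<in>S. \<Sum>t\<in>S. of_bool (n + s \<in> A \<and> n + t \<in> A))"
      by (simp add: f_def power2_eq_square sum_product of_bool_conj)
    also have "\<dots> = (\<Sum>s\<in>S. \<Sum>t\<in>S. \<Sum>n\<le>N i. of_bool (n + s \<in> A \<and> n + t \<in> A))"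
      by (subst sum.swap) (intro sum.cong refl sum.swap)
    also have "\<dots> = (\<Sum>s\<in>S. \<Sum>t\<in>S. real (card {n. n \<le> N i \<and> n + s \<in> A \<and> n + t \<in> A}))"
      by (simp only: sum_of_bool_atMost)
    also have "\<dots> \<le> e i"
      unfolding e_def
    proof (intro sum_mono)
      fix s t assume st: "s \<in> S" "t \<in> S"
      show "real (card {n. n \<le> N i \<and> n + s \<in> A \<and> n + t \<in> A})
          \<le> (if s = t then M i else c i (max s t - min s t) + m)"
      proof (cases s t rule: linorder_cases)
        case less
        then show ?thesis using card_shift_le[of s t "N i" A] m[of s] st by (simp add: c_def)
      next
        case equal
        have "card {n. n \<le> N i \<and> n + s \<in> A \<and> n + t \<in> A} \<le> card {..N i}"
          by (intro card_mono) auto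
        then show ?thesis using equal by (simp add: M_def)
      next
        case greater
        then show ?thesis using card_shift_le[of t s "N i" A] m[of t] st by (simp add: c_def conj_commute)
      qed
    qed
    finally show ?thesis .
  qed
  have Minf: "filterlim M at_top sequentially"
    using filterlim_compose[OF filterlim_real_sequentially
        filterlim_compose[OF filterlim_Suc filterlim_subseq[OF N]]]
    by (simp add: M_def[abs_def] add.commute)
  have lim0: "(\<lambda>i. m / M i) \<longlonglongrightarrow> 0" by (rule real_tendsto_divide_at_top[OF tendsto_const Minf])
  have limc: "(\<lambda>i. c i k / M i) \<longlonglongrightarrow> d k" for k using lim by (simp add: c_def M_def)
  have lime: "(\<lambda>i. e i / M i) \<longlonglongrightarrow> (\<Sum>s\<in>S. \<Sum>t\<in>S. if s = t then 1 else d (max s t - min s t) + 0)"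
  proof -
    have "(\<lambda>i. (if s = t then M i else c i (max s t - min s t) + m) / M i)
       \<longlonglongrightarrow> (if s = t then 1 else d (max s t - min s t) + 0)" for s t
    proof (cases "s = t")
      case True
      moreover have "M i \<noteq> 0" for i using M[of i] by simp
      ultimately show ?thesis by simp
    next
      case False
      then show ?thesis using tendsto_add[OF limc lim0] by (simp add: add_divide_distrib)
    qed
    then show ?thesis unfolding e_def sum_divide_distrib by (intro tendsto_sum)
  qed
  have "(\<lambda>i. (r * (\<delta> - m / M i))) \<longlonglongrightarrow> r * (\<delta> - 0)"
    by (intro tendsto_intros lim0)
  then have liml: "(\<lambda>i. (r * (\<delta> - m / M i))\<^sup>2) \<longlonglongrightarrow> (r * \<delta>)\<^sup>2"
    using tendsto_power[where n = 2] by fastforce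
  have ev: "\<forall>\<^sub>F i in sequentially. (r * (\<delta> - m / M i))\<^sup>2 \<le> e i / M i"
  proof -
    have "\<forall>\<^sub>F i in sequentially. m / M i < \<delta>" using order_tendstoD(2)[OF lim0 \<delta>] .
    then show ?thesis
    proof eventually_elim
      case (elim i)
      then have "0 \<le> \<delta> * M i - m" using M[of i] by (simp add: field_simps)
      then have nn: "0 \<le> r * (\<delta> * M i - m)" by (simp add: r_def)
      have "(r * (\<delta> * M i - m))\<^sup>2 \<le> (\<Sum>n\<le>N i. f n)\<^sup>2" by (rule power_mono[OF f1 nn])
      also have "\<dots> \<le> (\<Sum>n\<le>N i. 1\<^sup>2) * (\<Sum>n\<le>N i. (f n)\<^sup>2)"
        using Cauchy_Schwarz_ineq_sum[of "\<lambda>_. 1" f "{..N i}"] by simp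
      also have "\<dots> \<le> M i * e i"
        using f2[of i] by (auto simp: M_def intro!: mult_mono sum_nonneg)
      finally have "(r * (\<delta> * M i - m))\<^sup>2 / (M i)\<^sup>2 \<le> M i * e i / (M i)\<^sup>2"
        by (intro divide_right_mono) auto
      moreover have "(r * (\<delta> * M i - m))\<^sup>2 / (M i)\<^sup>2 = (r * (\<delta> - m / M i))\<^sup>2"
      proof -
        have "r * (\<delta> - m / M i) = r * (\<delta> * M i - m) / M i"
          using M[of i] by (simp add: field_simps)
        then show ?thesis by (simp only: power_divide)
      qed
      moreover have "M i * e i / (M i)\<^sup>2 = e i / M i" using M[of i] by (simp add: power2_eq_square)
      ultimately show ?case by simp
    qed
  qed
  have "(r * \<delta>)\<^sup>2 \<le> (\<Sum>s\<in>S. \<Sum>t\<in>S. if s = t then 1 else d (max s t - min s t) + 0)"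
    by (rule tendsto_le[OF _ lime liml ev]) simp
  \<comment> \<open>The squared mean contributes \<open>(r * \<delta>)^2\<close>. The threshold is
    half of \<open>\<delta>^2\<close>, so the off-diagonal terms absorb only half of it, and the
    other half is at most the diagonal \<open>r\<close>.\<close>
  also have "\<dots> \<le> (\<Sum>s\<in>S. \<Sum>t\<in>S. (if s = t then 1 else 0) + \<delta>\<^sup>2 / 2)"
  proof (intro sum_mono)
    fix s t assume st: "s \<in> S" "t \<in> S"
    then show "(if s = t then 1 else d (max s t - min s t) + 0) \<le> (if s = t then 1 else 0) + \<delta>\<^sup>2 / 2"
      using sep[of s t] sep[of t s] by (cases s t rule: linorder_cases) auto
  qed
  also have "\<dots> = r + r\<^sup>2 * (\<delta>\<^sup>2 / 2)"
    using S by (simp add: sum.distrib r_def power2_eq_square distrib_left)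
  finally have "(r * \<delta>)\<^sup>2 \<le> r + r\<^sup>2 * (\<delta>\<^sup>2 / 2)" .
  moreover have "r\<^sup>2 * (\<delta>\<^sup>2 / 2) = (r * \<delta>)\<^sup>2 / 2" "r * (r * (\<delta>\<^sup>2 / 2)) = (r * \<delta>)\<^sup>2 / 2"
    by (simp_all add: power_mult_distrib power2_eq_square)
  ultimately have *: "r * (r * (\<delta>\<^sup>2 / 2)) \<le> r * 1" by linarith
  show ?thesis
  proof (cases "r = 0")
    case False
    then have "r * (\<delta>\<^sup>2 / 2) \<le> 1" using * by (simp add: r_def mult_le_cancel_left)
    then show ?thesis using \<delta> by (simp add: r_def field_simps)
  qed (use r_def in simp)
qed

text \<open>Following Bayart and Ruzsa: along a subsequence on which all correlations
  \<open>d k\<close> of \<open>A\<close> and \<open>A - k\<close> converge, the set of \<open>k\<close> with \<open>d k > \<delta>\<^sup>2 / 2\<close> is syndetic, because a maximal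
  separated set of shifts is finite. As \<open>v\<close> decreases at most geometrically, \<open>v\<close> is
  dominated by its values on that set.\<close>

lemma summable_of_bounded_difference_sums:
  fixes v :: "nat \<Rightarrow> real"
  assumes A: "upper_density A > 0"
    and v: "\<And>k. 0 \<le> v k" and C: "1 \<le> C" "\<And>k. v k \<le> C * v (Suc k)"
    and D: "\<And>n K. n \<in> A \<Longrightarrow> (\<Sum>k<K. v k * of_bool (n + k \<in> A)) \<le> D"
  shows "summable v"
proof -
  obtain \<delta> and N0 :: "nat \<Rightarrow> nat" where N0: "0 < \<delta>" "strict_mono N0"
    "\<forall>i. \<delta> * real (N0 i + 1) \<le> real (card (A \<inter> {0..N0 i}))"
    using limsup_pos_subsequence[OF A] by blast
  define c where "c M k = real (card {n. n \<le> M \<and> n \<in> A \<and> n + k \<in> A}) / real (M + 1)" for M k :: nat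
  have c_nonneg: "0 \<le> c M k" for M k by (simp add: c_def)
  have c_le: "norm (c M k) \<le> 1" for M k
  proof -
    have "card {n. n \<le> M \<and> n \<in> A \<and> n + k \<in> A} \<le> card {..M}" by (intro card_mono) auto
    then show ?thesis by (simp add: c_def)
  qed
  \<comment> \<open>Diagonal extraction over the countably many \<open>k\<close>; all correlations
    lie between 0 and 1.\<close>
  obtain \<kappa> where \<kappa>: "strict_mono (\<kappa> :: nat \<Rightarrow> nat)"
    "\<And>k. k \<in> (UNIV :: nat set) \<Longrightarrow> \<exists>l. (\<lambda>i. c (N0 (\<kappa> i)) k) \<longlonglongrightarrow> l"
    by (rule function_convergent_subsequence[of "UNIV :: nat set" "\<lambda>i. c (N0 i)" 1])
      (use c_le in simp, use c_le in simp, rule that)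
  define N where "N = N0 \<circ> \<kappa>"
  have N: "strict_mono N" "\<And>i. \<delta> * real (N i + 1) \<le> real (card (A \<inter> {0..N i}))"
    using N0 \<kappa> by (auto simp: N_def strict_mono_o simp del: of_nat_add)
  define d where "d k = lim (\<lambda>i. c (N i) k)" for k
  have d: "(\<lambda>i. c (N i) k) \<longlonglongrightarrow> d k" for k
    using \<kappa>(2)[of k] by (auto simp: d_def N_def convergent_LIMSEQ_iff[symmetric] convergent_def)
  have d_nonneg: "0 \<le> d k" for k by (rule LIMSEQ_le_const[OF d]) (use c_nonneg in auto)
  obtain n0 where "n0 \<in> A"
  proof -
    have "0 < real (card (A \<inter> {0..N 0}))"
      using N(2)[of 0] N0(1) by (smt (verit) mult_pos_pos of_nat_0_less_iff add_gr_0 less_one)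
    then show ?thesis using that by (auto simp: card_gt_0_iff)
  qed
  then have D0: "0 \<le> D" using D[of n0 0] by simp
  have vd: "(\<Sum>k<K. v k * d k) \<le> D" for K
  proof (rule LIMSEQ_le_const2)
    show "(\<lambda>i. \<Sum>k<K. v k * c (N i) k) \<longlonglongrightarrow> (\<Sum>k<K. v k * d k)"
      by (intro tendsto_intros d)
    have "(\<Sum>k<K. v k * c M k) \<le> D" for M
    proof -
      have "(\<Sum>k<K. v k * real (card {n. n \<le> M \<and> n \<in> A \<and> n + k \<in> A}))
          = (\<Sum>k<K. \<Sum>n\<le>M. v k * of_bool (n \<in> A \<and> n + k \<in> A))"
        by (simp only: sum_distrib_left[symmetric] sum_of_bool_atMost)
      also have "\<dots> = (\<Sum>n\<le>M. \<Sum>k<K. v k * of_bool (n \<in> A \<and> n + k \<in> A))" by (rule sum.swap)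
      also have "\<dots> \<le> (\<Sum>n\<le>M. D)"
      proof (rule sum_mono)
        show "(\<Sum>k<K. v k * of_bool (n \<in> A \<and> n + k \<in> A)) \<le> D" for n
          using D[of n K] D0 by (cases "n \<in> A") auto
      qed
      finally have "(\<Sum>k<K. v k * real (card {n. n \<le> M \<and> n \<in> A \<and> n + k \<in> A})) \<le> D * real (M + 1)"
        by (simp add: mult.commute)
      then show ?thesis by (simp add: c_def sum_divide_distrib[symmetric] divide_le_eq del: of_nat_add of_nat_Suc)
    qed
    then show "\<exists>i0. \<forall>i\<ge>i0. (\<Sum>k<K. v k * c (N i) k) \<le> D" by blast
  qed
  define sep where "sep S \<longleftrightarrow> finite S \<and> (\<forall>s\<in>S. \<forall>t\<in>S. s < t \<longrightarrow> d (t - s) \<le> \<delta>\<^sup>2 / 2)" for S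
  have sep_card: "card S \<le> nat \<lfloor>2 / \<delta>\<^sup>2\<rfloor>" if "sep S" for S
    using card_almost_disjoint_shifts[of S \<delta> N A d] N0(1) N d that
    by (simp add: sep_def c_def le_nat_floor)
  obtain S where S: "sep S" "\<And>S'. sep S' \<Longrightarrow> card S' \<le> card S"
  proof -
    have "\<exists>S. sep S \<and> (\<forall>S'. sep S' \<longrightarrow> card S' \<le> card S)"
      by (rule ex_has_greatest_nat[of sep "{}" card "nat \<lfloor>2 / \<delta>\<^sup>2\<rfloor> + 1"])
        (use sep_card in \<open>auto simp: sep_def less_Suc_eq_le\<close>)
    then show ?thesis using that by blast
  qed
  have finS: "finite S" using S(1) by (simp add: sep_def)
  define m where "m = Max (insert 0 S)"
  have m: "s \<le> m" if "s \<in> S" for s unfolding m_def using finS that by simp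
  \<comment> \<open>A failure at \<open>k\<close> would allow \<open>k + m + 1\<close>, which
    exceeds every element of \<open>S\<close>, to be added to \<open>S\<close>, against
    maximality.\<close>
  have hit: "\<exists>s\<in>S. \<delta>\<^sup>2 / 2 < d (k + m + 1 - s)" for k
  proof (rule ccontr)
    assume none: "\<not> ?thesis"
    have new: "k + m + 1 \<notin> S" using m[of "k + m + 1"] by auto
    have "sep (insert (k + m + 1) S)"
      using S(1) none m unfolding sep_def by (fastforce simp: not_less)
    from S(2)[OF this] show False using finS new by simp
  qed
  have vC: "v k \<le> C ^ j * v (k + j)" for k j
  proof (induction j)
    case (Suc j)
    have "C ^ j * v (k + j) \<le> C ^ j * (C * v (Suc (k + j)))"
      using C by (intro mult_left_mono) auto
    with Suc show ?case by (simp add: mult.assoc mult.left_commute)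
  qed simp
  define B where "B = C ^ (m + 1) * (2 / \<delta>\<^sup>2)"
  have B: "0 \<le> B" using C by (simp add: B_def)
  have vk: "v k \<le> B * (\<Sum>s\<in>S. v (k + (m + 1 - s)) * d (k + (m + 1 - s)))" for k
  proof -
    obtain s where s: "s \<in> S" "\<delta>\<^sup>2 / 2 < d (k + m + 1 - s)" using hit by blast
    define j where "j = m + 1 - s"
    have kj: "k + m + 1 - s = k + j" using m[OF s(1)] by (simp add: j_def)
    have "v k \<le> C ^ j * v (k + j)" by (rule vC)
    also have "\<dots> \<le> C ^ (m + 1) * v (k + j)"
      using C v by (intro mult_right_mono power_increasing) (auto simp: j_def)
    also have "\<dots> \<le> C ^ (m + 1) * (v (k + j) * (2 / \<delta>\<^sup>2 * d (k + j)))"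
    proof (intro mult_left_mono)
      have "1 \<le> 2 / \<delta>\<^sup>2 * d (k + j)" using s(2) N0(1) unfolding kj by (simp add: field_simps)
      from mult_left_mono[OF this v] show "v (k + j) \<le> v (k + j) * (2 / \<delta>\<^sup>2 * d (k + j))" by simp
    qed (use C in auto)
    also have "\<dots> = B * (v (k + j) * d (k + j))" by (simp add: B_def)
    also have "v (k + j) * d (k + j) \<le> (\<Sum>s\<in>S. v (k + (m + 1 - s)) * d (k + (m + 1 - s)))"
      unfolding j_def by (rule member_le_sum[OF s(1)]) (use v d_nonneg finS in auto)
    finally show ?thesis using B by (simp add: mult_left_mono)
  qed
  have shift: "(\<Sum>k<K. v (k + j) * d (k + j)) \<le> D" for K j
  proof -
    have "(\<Sum>k<K. v (k + j) * d (k + j)) = (\<Sum>k\<in>{j..<K + j}. v k * d k)"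
      using sum.shift_bounds_nat_ivl[of "\<lambda>k. v k * d k" 0 j K] by (simp add: lessThan_atLeast0)
    also have "\<dots> \<le> (\<Sum>k<K + j. v k * d k)"
      by (rule sum_mono2) (use v d_nonneg in auto)
    finally show ?thesis using vd[of "K + j"] by simp
  qed
  show ?thesis
  proof (rule summableI_nonneg_bounded[OF v])
    fix K
    have "(\<Sum>k<K. v k) \<le> (\<Sum>k<K. B * (\<Sum>s\<in>S. v (k + (m + 1 - s)) * d (k + (m + 1 - s))))"
      by (rule sum_mono[OF vk])
    also have "\<dots> = B * (\<Sum>s\<in>S. \<Sum>k<K. v (k + (m + 1 - s)) * d (k + (m + 1 - s)))"
      by (subst sum.swap) (simp add: sum_distrib_left)
    also have "\<dots> \<le> B * (\<Sum>s\<in>S. D)"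
      using B by (intro mult_left_mono sum_mono shift)
    finally show "(\<Sum>k<K. v k) \<le> B * (\<Sum>s\<in>S. D)" .
  qed
qed

section \<open>Tails of sequences and vectors of a subspace that vanish initially\<close>

lemma sum_norm_le_lp_norm:
  assumes "0 < p" "x \<in> lp p" "finite F"
  shows "(\<Sum>n\<in>F. norm (x n) powr p) \<le> lp_norm p x powr p"
  unfolding lp_norm_powr[OF assms(1,2)]
  using assms by (intro sum_le_suminf) (auto simp: lp_def)

lemma lp_norm_scale:
  assumes "0 < p" "x \<in> lp p"
  shows "lp_norm p (\<lambda>n. c * x n) = norm c * lp_norm p x"
  using assms
  by (simp add: lp_norm_def lp_def norm_mult powr_mult suminf_mult suminf_nonneg powr_powr)

lemma lp_norm_mono:
  assumes "0 < p" "y \<in> lp p" "\<And>n. norm (x n) \<le> norm (y n)"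
  shows "x \<in> lp p" "lp_norm p x \<le> lp_norm p y"
proof -
  have *: "(\<Sum>n<L. norm (x n) powr p) \<le> lp_norm p y powr p" for L
  proof -
    have "(\<Sum>n<L. norm (x n) powr p) \<le> (\<Sum>n<L. norm (y n) powr p)"
      using assms(1,3) by (intro sum_mono powr_mono2) auto
    also have "\<dots> \<le> lp_norm p y powr p"
      by (intro sum_norm_le_lp_norm assms finite_lessThan)
    finally show ?thesis .
  qed
  show "x \<in> lp p" "lp_norm p x \<le> lp_norm p y"
    by (rule lp_normI[OF assms(1) lp_norm_nonneg *])+
qed

definition tail :: "nat \<Rightarrow> (nat \<Rightarrow> 'a::zero) \<Rightarrow> nat \<Rightarrow> 'a" where
  "tail k x = (\<lambda>n. if n < k then 0 else x n)"

lemma tail_lp: "0 < p \<Longrightarrow> x \<in> lp p \<Longrightarrow> tail k x \<in> lp p"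
  by (rule lp_norm_mono(1)) (auto simp: tail_def)

lemma lp_norm_tail_tendsto_zero:
  assumes "0 < p" "x \<in> lp p" "0 < e"
  obtains K where "\<And>k. K \<le> k \<Longrightarrow> lp_norm p (tail k x) < e"
proof -
  have s: "summable (\<lambda>n. norm (x n) powr p)" using assms by (simp add: lp_def)
  have "0 < e powr p" using assms by simp
  from suminf_exist_split[OF this s]
  obtain K where K: "\<And>k. K \<le> k \<Longrightarrow> norm (\<Sum>i. norm (x (i + k)) powr p) < e powr p" by blast
  show ?thesis
  proof (rule that)
    fix k assume "K \<le> k"
    have st: "summable (\<lambda>n. norm (tail k x n) powr p)" using tail_lp[OF assms(1,2)] by (simp add: lp_def)
    have "(\<Sum>n. norm (tail k x n) powr p) = (\<Sum>i. norm (tail k x (i + k)) powr p) + (\<Sum>n<k. norm (tail k x n) powr p)"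
      by (rule suminf_split_initial_segment[OF st])
    also have "\<dots> = (\<Sum>i. norm (x (i + k)) powr p)" by (simp add: tail_def)
    also have "\<dots> < e powr p" using K[OF \<open>K \<le> k\<close>] by (simp add: abs_less_iff)
    finally show "lp_norm p (tail k x) < e"
      using lp_norm_less_iff[OF assms(1) tail_lp[OF assms(1,2)]] assms(3) by simp
  qed
qed

text \<open>Prescribing one more zero coordinate costs at most one dimension: any \<open>g\<close>
  that is nonzero at \<open>j\<close> serves to clear coordinate \<open>j\<close> of the others.
  Contraposed, an infinite-dimensional subspace has nonzero vectors vanishing on any initial
  segment.\<close>

lemma fin_span_of_vanishing_trivial:
  assumes zero: "(\<lambda>n. 0) \<in> M" and add: "\<And>x y. x \<in> M \<Longrightarrow> y \<in> M \<Longrightarrow> (\<lambda>n. x n + y n) \<in> M"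
    and scale: "\<And>c x. x \<in> M \<Longrightarrow> (\<lambda>n. c * x n) \<in> M"
    and triv: "\<And>x. x \<in> M \<Longrightarrow> (\<forall>i<k. x i = 0) \<Longrightarrow> x = (\<lambda>n. 0)"
  shows "\<exists>F. finite F \<and> M \<subseteq> fin_span F"
proof -
  have "\<exists>F. finite F \<and> {x \<in> M. \<forall>i<j. x i = 0} \<subseteq> fin_span F" if "j \<le> k" for j
    using that
  proof (induction rule: inc_induct)
    case base
    have "x \<in> fin_span {}" if "x \<in> M" "\<forall>i<k. x i = 0" for x
      unfolding triv[OF that] by (simp add: fin_span_def)
    then have "{x \<in> M. \<forall>i<k. x i = 0} \<subseteq> fin_span {}" by blast
    then show ?case by blast
  next
    case (step j)
    then obtain F where F: "finite F" "{x \<in> M. \<forall>i<Suc j. x i = 0} \<subseteq> fin_span F" by blast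
    show ?case
    proof (cases "\<exists>g\<in>M. (\<forall>i<j. g i = 0) \<and> g j \<noteq> 0")
      case False
      then have "{x \<in> M. \<forall>i<j. x i = 0} \<subseteq> {x \<in> M. \<forall>i<Suc j. x i = 0}" by (auto simp: less_Suc_eq)
      from order_trans[OF this F(2)] show ?thesis using F(1) by (intro exI[of _ F] conjI)
    next
      case True
      then obtain g where g: "g \<in> M" "\<And>i. i < j \<Longrightarrow> g i = 0" "g j \<noteq> 0" by blast
      have "x \<in> fin_span (insert g F)" if x: "x \<in> M" "\<forall>i<j. x i = 0" for x
      proof -
        define b where "b = x j / g j"
        define y where "y n = x n + (- b) * g n" for n
        have "y \<in> M" unfolding y_def[abs_def] by (intro add x scale g)
        moreover have "\<forall>i<Suc j. y i = 0" using x g by (auto simp: y_def b_def less_Suc_eq)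
        ultimately have "y \<in> fin_span F" using F(2) by blast
        then obtain c where c: "y = (\<lambda>n. \<Sum>f\<in>F. c f * f n)" by (auto simp: fin_span_def)
        have xy: "x n = y n + b * g n" for n by (simp add: y_def)
        \<comment> \<open>\<open>fin_span\<close> sums over a set, so if \<open>g\<close> already
          belongs to \<open>F\<close>, its coefficient has to be increased instead of set.\<close>
        show ?thesis
        proof (cases "g \<in> F")
          case True
          have "x n = (\<Sum>f\<in>insert g F. (c(g := c g + b)) f * f n)" for n
          proof -
            have "(\<Sum>f\<in>F. (c(g := c g + b)) f * f n) = (\<Sum>f\<in>F. c f * f n + (if f = g then b * g n else 0))"
              by (intro sum.cong) (auto simp: distrib_right)
            then show ?thesis using True F(1) by (simp add: xy c sum.distrib insert_absorb)
          qed
          then show ?thesis by (auto simp: fin_span_def intro!: exI[of _ "c(g := c g + b)"])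
        next
          case False
          have "x n = (\<Sum>f\<in>insert g F. (c(g := b)) f * f n)" for n
          proof -
            have "(\<Sum>f\<in>F. (c(g := b)) f * f n) = (\<Sum>f\<in>F. c f * f n)"
              using False by (intro sum.cong) auto
            then show ?thesis using False F(1) by (simp add: xy c add.commute)
          qed
          then show ?thesis by (auto simp: fin_span_def intro!: exI[of _ "c(g := b)"])
        qed
      qed
      then show ?thesis using F(1) by (intro exI[of _ "insert g F"]) auto
    qed
  qed
  from this[of 0] show ?thesis by simp
qed

lemma inf_dim_subspace_vanishing:
  assumes p: "0 < p" and M: "lp_closed_inf_dim_subspace p M"
  obtains x where "x \<in> M" "\<And>i. i < k \<Longrightarrow> x i = 0" "lp_norm p x = 1"
proof -
  have "\<exists>x\<in>M. (\<forall>i<k. x i = 0) \<and> x \<noteq> (\<lambda>n. 0)"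
  proof (rule ccontr)
    assume none: "\<not> ?thesis"
    have "\<exists>F. finite F \<and> M \<subseteq> fin_span F"
    proof (rule fin_span_of_vanishing_trivial[of M k])
      fix x assume "x \<in> M" "\<forall>i<k. x i = 0"
      then show "x = (\<lambda>n. 0)" using none by metis
    qed (use M in \<open>simp_all add: lp_closed_inf_dim_subspace_def\<close>)
    then show False using M unfolding lp_closed_inf_dim_subspace_def by blast
  qed
  then obtain x where x: "x \<in> M" "\<And>i. i < k \<Longrightarrow> x i = 0" "x \<noteq> (\<lambda>n. 0)" by blast
  have xl: "x \<in> lp p" using M x(1) by (auto simp: lp_closed_inf_dim_subspace_def)
  obtain i where "x i \<noteq> 0" using x(3) by blast
  then have pos: "0 < lp_norm p x" using norm_le_lp_norm[OF p xl, of i]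
    by (smt (verit) zero_less_norm_iff)
  show ?thesis
  proof (rule that)
    show "(\<lambda>n. of_real (1 / lp_norm p x) * x n) \<in> M"
      using M x(1) unfolding lp_closed_inf_dim_subspace_def by blast
    show "lp_norm p (\<lambda>n. of_real (1 / lp_norm p x) * x n) = 1"
      unfolding lp_norm_scale[OF p xl] norm_of_real using pos by simp
  qed (use x(2) in auto)
qed

section \<open>Necessity\<close>

locale weighted_shift =
  fixes p :: real and w :: "nat \<Rightarrow> real"
  assumes p: "1 \<le> p"
    and wpos: "\<And>k. 1 \<le> k \<Longrightarrow> 0 < w k"
    and wbdd: "bdd_above (w ` {1..})"
begin

definition W :: "nat \<Rightarrow> real" where "W k = (\<Prod>j\<in>{1..k}. w j)"

lemma p0: "0 < p" using p by simp

lemma W_pos [simp]: "0 < W k"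
  unfolding W_def using wpos by (intro prod_pos) auto

lemma W_neq0 [simp]: "W k \<noteq> 0" using W_pos[of k] by linarith

lemma W_0 [simp]: "W 0 = 1" by (simp add: W_def)

lemma W_Suc: "W (Suc k) = W k * w (Suc k)" by (simp add: W_def)

lemma W_add: "W (k + n) = W k * (\<Prod>j\<in>{1..n}. w (k + j))"
  by (induction n) (simp_all add: W_Suc mult.assoc)

text \<open>The maximum with 1 makes \<open>C ^ n\<close> increasing in \<open>n\<close> even if all
  weights are below 1.\<close>

definition C :: real where "C = max 1 (SUP k\<in>{1..}. w k)"

lemma C1: "1 \<le> C" by (simp add: C_def)

lemma w_le_C: "w (Suc k) \<le> C"
  unfolding C_def using wbdd by (intro max.coboundedI2 cSUP_upper) auto

lemma W_le: "W (k + n) \<le> C ^ n * W k"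
proof (induction n)
  case (Suc n)
  have "W (k + n) * w (Suc (k + n)) \<le> (C ^ n * W k) * C"
    using Suc w_le_C[of "k + n"] wpos[of "Suc (k + n)"] C1
    by (intro mult_mono) (auto simp: less_imp_le)
  then show ?case by (simp add: W_Suc algebra_simps)
qed simp

lemma bshift_power: "(bshift w ^^ n) x k = of_real (W (k + n) / W k) * x (k + n)"
proof (induction n arbitrary: k)
  case (Suc n)
  have "(bshift w ^^ Suc n) x k = of_real (w (Suc k)) * (bshift w ^^ n) x (Suc k)"
    by (simp add: bshift_def)
  also have "\<dots> = of_real (w (Suc k) * (W (Suc k + n) / W (Suc k))) * x (k + Suc n)"
    unfolding Suc.IH by simp
  also have "w (Suc k) * (W (Suc k + n) / W (Suc k)) = W (k + Suc n) / W k"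
    using wpos[of "Suc k"] by (simp add: W_Suc[of k])
  finally show ?case .
qed simp

lemma norm_bshift_power: "norm ((bshift w ^^ n) x k) = W (k + n) / W k * norm (x (k + n))"
  by (simp only: bshift_power norm_mult norm_of_real) (simp add: less_imp_le)

lemma bshift_power_lp:
  assumes "x \<in> lp p"
  shows "(bshift w ^^ n) x \<in> lp p" "lp_norm p ((bshift w ^^ n) x) \<le> C ^ n * lp_norm p x"
proof -
  have Cn: "0 \<le> C ^ n" using C1 by simp
  have *: "(\<Sum>k<L. norm ((bshift w ^^ n) x k) powr p) \<le> (C ^ n * lp_norm p x) powr p" for L
  proof -
    have "(\<Sum>k<L. norm ((bshift w ^^ n) x k) powr p) \<le> (\<Sum>k<L. (C ^ n) powr p * norm (x (k + n)) powr p)"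
    proof (rule sum_mono)
      fix k
      have "norm ((bshift w ^^ n) x k) \<le> C ^ n * norm (x (k + n))"
        unfolding norm_bshift_power using W_le[of k n]
        by (intro mult_right_mono) (auto simp: divide_le_eq)
      from powr_mono2[OF _ _ this, of p] 
      show "norm ((bshift w ^^ n) x k) powr p \<le> (C ^ n) powr p * norm (x (k + n)) powr p"
        using p Cn by (simp add: powr_mult)
    qed
    also have "\<dots> = (C ^ n) powr p * (\<Sum>k\<in>{n..<L + n}. norm (x k) powr p)"
      using sum.shift_bounds_nat_ivl[of "\<lambda>k. norm (x k) powr p" 0 n L]
      by (simp add: lessThan_atLeast0 sum_distrib_left)
    also have "\<dots> \<le> (C ^ n) powr p * lp_norm p x powr p"
      by (intro mult_left_mono sum_norm_le_lp_norm p0 assms) auto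
    finally show ?thesis using Cn by (simp add: powr_mult lp_norm_nonneg)
  qed
  have "0 \<le> C ^ n * lp_norm p x" using Cn lp_norm_nonneg[of p x] by (rule mult_nonneg_nonneg)
  from lp_normI[OF p0 this *]
  show "(bshift w ^^ n) x \<in> lp p" "lp_norm p ((bshift w ^^ n) x) \<le> C ^ n * lp_norm p x" by auto
qed

lemma W_powr_le: "W k powr - p \<le> C powr p * W (Suc k) powr - p"
proof -
  have "W (Suc k) \<le> C * W k" using W_le[of k 1] by simp
  then have "(C * W k) powr - p \<le> W (Suc k) powr - p"
    using p by (intro powr_mono2') auto
  then have "C powr p * (C * W k) powr - p \<le> C powr p * W (Suc k) powr - p"
    by (intro mult_left_mono) auto
  moreover have "C powr p * (C * W k) powr - p = W k powr - p"
    using C1 by (simp add: powr_mult powr_minus)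
  ultimately show ?thesis by simp
qed

text \<open>Coordinate \<open>k\<close> of the image at time \<open>n\<close> equals, up to division
  by \<open>W k\<close>, coordinate 0 at time \<open>n + k\<close>. If both times are visits near
  the first unit vector, the former has norm at least \<open>1 / (2 * W k)\<close>, while the image
  at time \<open>n\<close> has bounded norm. Hence the sums over differences of visits are bounded
  by \<open>D\<close>.\<close>

lemma summable_of_U_freq_hypercyclic_vec:
  fixes x :: "nat \<Rightarrow> 'a::real_normed_field"
  assumes x: "lp_U_freq_hypercyclic_vec p (bshift w) x"
  shows "summable (\<lambda>k. W k powr - p)"
proof -
  define e0 :: "nat \<Rightarrow> 'a" where "e0 n = (if n = 0 then 1 else 0)" for n
  have e0: "e0 \<in> lp p" unfolding lp_def e0_def using p
    by (auto intro!: summable_finite[of "{0}"] split: if_splits)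
  define U where "U = {z \<in> lp p. lp_dist p z e0 < 1 / 2}"
  have "lp_open p U" unfolding U_def by (rule lp_open_ball[OF p e0])
  moreover have "e0 \<in> U" using e0 p0 by (simp add: U_def)
  ultimately have dens: "upper_density (N_T (bshift w) x U) > 0"
    using x unfolding lp_U_freq_hypercyclic_vec_def by blast
  have near: "norm ((bshift w ^^ n) x k - e0 k) \<le> 1 / 2" if "n \<in> N_T (bshift w) x U" for n k
    using norm_le_lp_norm[OF p0 lp_diff[OF p _ e0], of "(bshift w ^^ n) x" k] that
    by (auto simp: N_T_def U_def lp_dist_def)
  have big: "1 / 2 \<le> W n * norm (x n)" if "n \<in> N_T (bshift w) x U" for n
  proof -
    have "norm ((bshift w ^^ n) x 0 - 1) \<le> 1 / 2" using near[OF that, of 0] by (simp add: e0_def)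
    then have "1 / 2 \<le> norm ((bshift w ^^ n) x 0)"
      using norm_triangle_ineq2[of 1 "(bshift w ^^ n) x 0"] by (simp add: norm_minus_commute)
    then show ?thesis by (simp add: norm_bshift_power)
  qed
  define D where "D = 2 powr p * (1 / 2 + lp_norm p e0) powr p"
  have "(\<Sum>k<K. W k powr - p * of_bool (n + k \<in> N_T (bshift w) x U)) \<le> D"
    if n: "n \<in> N_T (bshift w) x U" for n K
  proof -
    define z where "z = (bshift w ^^ n) x"
    have z: "z \<in> lp p" "lp_dist p z e0 < 1 / 2" using n by (auto simp: N_T_def U_def z_def)
    have zn: "lp_norm p z \<le> 1 / 2 + lp_norm p e0"
      using lp_norm_triangle[OF p lp_diff[OF p z(1) e0] e0] z(2) by (simp add: lp_dist_def)
    have "(\<Sum>k<K. W k powr - p * of_bool (n + k \<in> N_T (bshift w) x U))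
        \<le> (\<Sum>k<K. 2 powr p * norm (z k) powr p)"
    proof (rule sum_mono)
      fix k
      show "W k powr - p * of_bool (n + k \<in> N_T (bshift w) x U) \<le> 2 powr p * norm (z k) powr p"
      proof (cases "n + k \<in> N_T (bshift w) x U")
        case True
        have "1 / W k \<le> 2 * norm (z k)"
          using big[OF True] by (simp add: z_def norm_bshift_power field_simps)
        then have "(1 / W k) powr p \<le> (2 * norm (z k)) powr p"
          using p by (intro powr_mono2) (auto simp: less_imp_le)
        then show ?thesis using True by (simp add: powr_mult powr_divide powr_minus_divide)
      qed simp
    qed
    also have "\<dots> = 2 powr p * (\<Sum>k<K. norm (z k) powr p)" by (simp add: sum_distrib_left)
    also have "\<dots> \<le> 2 powr p * (lp_norm p z powr p)"
      by (intro mult_left_mono sum_norm_le_lp_norm p0 z) auto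
    also have "\<dots> \<le> D"
      unfolding D_def using zn p by (intro mult_left_mono powr_mono2) (auto simp: lp_norm_nonneg)
    finally show ?thesis .
  qed
  from summable_of_bounded_difference_sums[OF dens _ _ W_powr_le this]
  show ?thesis using C1 p by (simp add: ge_one_powr_ge_zero)
qed

end

section \<open>Slowly decaying tails and orbits bounded away from zero\<close>

lemma tail_mono_lp_norm:
  assumes "0 < p" "x \<in> lp p" "j \<le> k"
  shows "lp_norm p (tail k x) \<le> lp_norm p (tail j x)"
  using assms by (intro lp_norm_mono(2) tail_lp) (auto simp: tail_def)

lemma lp_norm_tail_le:
  assumes "0 < p" "x \<in> lp p"
  shows "lp_norm p (tail k x) \<le> lp_norm p x"
  using assms by (intro lp_norm_mono(2)) (auto simp: tail_def)

lemma lp_norm_tail_add: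
  assumes "1 \<le> p" "x \<in> lp p" "y \<in> lp p"
  shows "lp_norm p (tail k (\<lambda>n. x n + y n)) \<le> lp_norm p (tail k x) + lp_norm p (tail k y)"
proof -
  have "tail k (\<lambda>n. x n + y n) = (\<lambda>n. tail k x n + tail k y n)"
    by (auto simp: tail_def)
  then show ?thesis
    using lp_norm_triangle[OF assms(1) tail_lp tail_lp, of x y k k] assms by simp
qed

text \<open>The vector is a gliding hump \<open>\<Sum> 4\<^sup>-\<^sup>i x\<^sub>i\<close> with \<open>x\<^sub>i \<in> M\<close> vanishing on the first
  \<open>k\<^sub>i\<close> coordinates; the bound \<open>h\<close> prescribes how fast the \<open>k\<^sub>i\<close> have to grow.\<close>

lemma inf_dim_subspace_slow_tail:
  fixes M :: "(nat \<Rightarrow> 'a::real_normed_field) set" and h :: "nat \<Rightarrow> nat"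
  assumes p: "1 \<le> p" and M: "lp_closed_inf_dim_subspace p M"
  obtains x and k :: "nat \<Rightarrow> nat" where "x \<in> M" "strict_mono k" "\<And>i. h i \<le> k i"
    "\<And>i. (1 / 4) ^ (i + 2) \<le> lp_norm p (tail (k (Suc i)) x)"
proof -
  have p0: "0 < p" using p by simp
  have Mlp: "M \<subseteq> lp p" and Madd: "\<And>x y. x \<in> M \<Longrightarrow> y \<in> M \<Longrightarrow> (\<lambda>n. x n + y n) \<in> M"
    and Mscale: "\<And>c x. x \<in> M \<Longrightarrow> (\<lambda>n. c * x n) \<in> M" and M0: "(\<lambda>n. 0) \<in> M"
    and Mclosed: "\<And>x. x \<in> lp p \<Longrightarrow> (\<And>e. 0 < e \<Longrightarrow> \<exists>y\<in>M. lp_dist p y x < e) \<Longrightarrow> x \<in> M"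
    using M unfolding lp_closed_inf_dim_subspace_def by blast+
  \<comment> \<open>The next hump starts where the tail of the current sum is at most a quarter of
    the next coefficient, so that it dominates what came before.\<close>
  define step where "step i s s' \<longleftrightarrow> (\<exists>x\<in>M. (\<forall>m<snd s'. x m = 0) \<and> lp_norm p x = 1 \<and>
      fst s' = (\<lambda>n. fst s n + of_real ((1 / 4) ^ Suc i) * x n)) \<and> snd s < snd s' \<and>
      lp_norm p (tail (snd s') (fst s)) \<le> (1 / 4) ^ Suc i / 4"
    for i and s s' :: "(nat \<Rightarrow> 'a) \<times> nat"
  have ex: "\<exists>s. \<forall>i. (fst (s i) \<in> M \<and> h i \<le> snd (s i)) \<and> step i (s i) (s (Suc i))"
  proof (rule dependent_nat_choice)
    show "\<exists>s. fst s \<in> M \<and> h 0 \<le> snd s" using M0 by (intro exI[of _ "(\<lambda>n. 0, h 0)"]) simp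
    fix s i assume s: "fst s \<in> M \<and> h i \<le> snd s"
    then have sl: "fst s \<in> lp p" using Mlp by blast
    have e: "0 < (1 / 4 :: real) ^ Suc i / 4" by simp
    obtain K where K: "\<And>k. K \<le> k \<Longrightarrow> lp_norm p (tail k (fst s)) < (1 / 4) ^ Suc i / 4"
      by (rule lp_norm_tail_tendsto_zero[OF p0 sl e]) (rule that)
    define k' where "k' = K + h (Suc i) + snd s + 1"
    obtain x where x: "x \<in> M" "\<And>m. m < k' \<Longrightarrow> x m = 0" "lp_norm p x = 1"
      by (rule inf_dim_subspace_vanishing[OF p0 M, of k']) (rule that)
    define y where "y = (\<lambda>n. fst s n + of_real ((1 / 4) ^ Suc i) * x n)"
    have "y \<in> M" unfolding y_def using s x by (intro Madd Mscale) auto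
    moreover have "step i s (y, k')"
      unfolding step_def using x K[of k']
      by (auto simp: y_def k'_def less_imp_le)
    ultimately show "\<exists>s'. (fst s' \<in> M \<and> h (Suc i) \<le> snd s') \<and> step i s s'"
      by (intro exI[of _ "(y, k')"]) (simp add: k'_def)
  qed
  then obtain s where s: "\<And>i. fst (s i) \<in> M" "\<And>i. h i \<le> snd (s i)" "\<And>i. step i (s i) (s (Suc i))"
    by blast
  define y k where "y i = fst (s i)" and "k i = snd (s i)" for i
  have ylp: "y i \<in> lp p" for i using s(1) Mlp by (auto simp: y_def)
  obtain z where z: "\<And>i. z i \<in> M" "\<And>i m. m < k (Suc i) \<Longrightarrow> z i m = 0" "\<And>i. lp_norm p (z i) = 1"
    "\<And>i n. y (Suc i) n = y i n + of_real ((1 / 4) ^ Suc i) * z i n"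
  proof -
    have "\<forall>i. \<exists>x. x \<in> M \<and> (\<forall>m<k (Suc i). x m = 0) \<and> lp_norm p x = 1 \<and>
      y (Suc i) = (\<lambda>n. y i n + of_real ((1 / 4) ^ Suc i) * x n)"
      using s(3) unfolding step_def y_def k_def by blast
    from choice[OF this] obtain z where "\<forall>i. z i \<in> M \<and> (\<forall>m<k (Suc i). z i m = 0) \<and> lp_norm p (z i) = 1 \<and>
      y (Suc i) = (\<lambda>n. y i n + of_real ((1 / 4) ^ Suc i) * z i n)" ..
    then show ?thesis by (intro that[of z]) auto
  qed
  have kmono: "strict_mono k"
    using s(3) unfolding step_def k_def by (intro strict_monoI_Suc) blast
  have ytail: "lp_norm p (tail (k (Suc i)) (y i)) \<le> (1 / 4) ^ Suc i / 4" for i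
    using s(3)[of i] unfolding step_def y_def k_def by blast
  have zlp: "z i \<in> lp p" for i using z(1) Mlp by blast
  have azn: "lp_norm p (\<lambda>n. of_real ((1 / 4) ^ Suc i) * z i n) = (1 / 4) ^ Suc i" for i
    unfolding lp_norm_scale[OF p0 zlp] z(3) norm_of_real by simp
  have stable: "y (i + d) m = y i m" if "m < k (Suc i)" for i d m
  proof (induction d)
    case (Suc d)
    have "k (Suc i) \<le> k (Suc (i + d))" using kmono by (simp add: strict_mono_less_eq)
    then show ?case using Suc z(2)[of m "i + d"] z(4)[of "i + d" m] that by simp
  qed simp
  have ydist: "lp_norm p (\<lambda>n. y (i + d) n - y i n) \<le> (1 / 4) ^ i / 3 - (1 / 4) ^ (i + d) / 3" for i d
  proof (induction d)
    case 0
    then show ?case using p0 by (simp add: lp_norm_def)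
  next
    case (Suc d)
    have "lp_norm p (\<lambda>n. y (i + Suc d) n - y i n) =
        lp_norm p (\<lambda>n. (y (i + d) n - y i n) + of_real ((1 / 4) ^ Suc (i + d)) * z (i + d) n)"
      using z(4)[of "i + d"] by (simp add: algebra_simps)
    also have "\<dots> \<le> lp_norm p (\<lambda>n. y (i + d) n - y i n) + lp_norm p (\<lambda>n. of_real ((1 / 4) ^ Suc (i + d)) * z (i + d) n)"
      by (rule lp_norm_triangle[OF p lp_diff[OF p ylp ylp] lp_scale[OF zlp]])
    also have "\<dots> \<le> (1 / 4) ^ i / 3 - (1 / 4) ^ (i + d) / 3 + (1 / 4) ^ Suc (i + d)"
      unfolding azn by (intro add_right_mono Suc.IH)
    also have "\<dots> = (1 / 4) ^ i / 3 - (1 / 4) ^ (i + Suc d) / 3" by simp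
    finally show ?case .
  qed
  \<comment> \<open>Coordinate \<open>m\<close> no longer changes after stage \<open>m\<close>,
    because later humps start beyond \<open>k (Suc m) > m\<close>.\<close>
  define x where "x m = y m m" for m
  have xy: "x m = y i m" if "m \<le> i" for m i
  proof -
    have "m < k (Suc m)" using strict_mono_imp_increasing[OF kmono, of "Suc m"] by simp
    from stable[OF this, of "i - m"] show ?thesis using that by (simp add: x_def)
  qed
  have diff: "(\<lambda>n. x n - y i n) \<in> lp p" "lp_norm p (\<lambda>n. x n - y i n) \<le> (1 / 4) ^ i / 3" for i
  proof -
    have bound: "(\<Sum>n<L. norm (x n - y i n) powr p) \<le> ((1 / 4) ^ i / 3) powr p" for L
    proof -
      have "(\<Sum>n<L. norm (x n - y i n) powr p) = (\<Sum>n<L. norm (y (i + L) n - y i n) powr p)"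
        by (intro sum.cong refl) (simp add: xy[of _ "i + L"])
      also have "\<dots> \<le> lp_norm p (\<lambda>n. y (i + L) n - y i n) powr p"
        by (rule sum_norm_le_lp_norm[OF p0 lp_diff[OF p ylp ylp]]) simp
      also have "\<dots> \<le> ((1 / 4) ^ i / 3) powr p"
      proof (rule powr_mono2)
        have "0 \<le> (1 / 4 :: real) ^ (i + L) / 3" by simp
        then show "lp_norm p (\<lambda>n. y (i + L) n - y i n) \<le> (1 / 4) ^ i / 3"
          using ydist[of i L] by linarith
      qed (use p0 lp_norm_nonneg in auto)
      finally show ?thesis .
    qed
    have nn: "0 \<le> (1 / 4 :: real) ^ i / 3" by simp
    from lp_normI[OF p0 nn bound]
    show "(\<lambda>n. x n - y i n) \<in> lp p" "lp_norm p (\<lambda>n. x n - y i n) \<le> (1 / 4) ^ i / 3" .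
  qed
  have xlp: "x \<in> lp p" using lp_add[OF p diff(1)[of 0] ylp[of 0]] by simp
  show ?thesis
  proof (rule that)
    show "x \<in> M"
    proof (rule Mclosed[OF xlp])
      fix e :: real assume "0 < e"
      then obtain i where i: "(1 / 4 :: real) ^ i < e" using real_arch_pow_inv[of e "1 / 4"] by auto
      have "lp_dist p (y i) x = lp_norm p (\<lambda>n. x n - y i n)"
        by (simp add: lp_dist_def lp_norm_def norm_minus_commute)
      also have "\<dots> \<le> (1 / 4) ^ i / 3" by (rule diff(2))
      also have "\<dots> < e" using i \<open>0 < e\<close> by simp
      finally show "\<exists>y\<in>M. lp_dist p y x < e" using s(1)[of i] by (auto simp: y_def)
    qed
    show "strict_mono k" by (rule kmono)
    show "h i \<le> k i" for i using s(2) by (simp add: k_def)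
    show "(1 / 4) ^ (i + 2) \<le> lp_norm p (tail (k (Suc i)) x)" for i
    proof -
      let ?K = "k (Suc i)"
      define az where "az = (\<lambda>n. of_real ((1 / 4) ^ Suc i) * z i n)"
      have azlp: "az \<in> lp p" unfolding az_def by (rule lp_scale[OF zlp])
      have yneg: "(\<lambda>n. - y i n) \<in> lp p" "lp_norm p (tail ?K (\<lambda>n. - y i n)) = lp_norm p (tail ?K (y i))"
        using ylp[of i] by (auto simp: lp_def lp_norm_def tail_def if_distrib[of norm] cong: if_cong)
      have dneg: "(\<lambda>n. y (Suc i) n - x n) \<in> lp p"
        "lp_norm p (\<lambda>n. y (Suc i) n - x n) \<le> (1 / 4) ^ Suc i / 3"
        using diff[of "Suc i"] by (simp_all add: lp_def lp_norm_def norm_minus_commute)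
      have "tail ?K az = az" using z(2)[of _ i] by (auto simp: tail_def az_def)
      then have "(1 / 4) ^ Suc i = lp_norm p (tail ?K az)"
        using azn[of i] by (simp add: az_def)
      also have "az = (\<lambda>n. (x n + (- y i n)) + (y (Suc i) n - x n))"
        using z(4)[of i] by (auto simp: az_def)
      also have "lp_norm p (tail ?K \<dots>) \<le> lp_norm p (tail ?K (\<lambda>n. x n + (- y i n))) + lp_norm p (tail ?K (\<lambda>n. y (Suc i) n - x n))"
        by (rule lp_norm_tail_add[OF p lp_add[OF p xlp yneg(1)] dneg(1)])
      also have "\<dots> \<le> (lp_norm p (tail ?K x) + lp_norm p (tail ?K (y i))) + (1 / 4) ^ Suc i / 3"
        using lp_norm_tail_add[OF p xlp yneg(1), of ?K] lp_norm_tail_le[OF p0 dneg(1), of ?K] dneg(2)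
        unfolding yneg(2) by linarith
      also have "\<dots> \<le> lp_norm p (tail ?K x) + (1 / 4) ^ Suc i / 4 + (1 / 4) ^ Suc i / 3"
        using ytail[of i] by simp
      \<comment> \<open>The old humps take a quarter and the later ones a third of
        \<open>(1 / 4) ^ Suc i\<close>; the remaining 5/12 exceed a quarter.\<close>
      finally have "(1 / 4) ^ Suc i \<le> lp_norm p (tail ?K x) + (1 / 4) ^ Suc i / 4 + (1 / 4) ^ Suc i / 3" .
      moreover have "(1 / 4 :: real) ^ (i + 2) = (1 / 4) ^ i / 16" "(1 / 4 :: real) ^ Suc i = (1 / 4) ^ i / 4"
        "0 \<le> (1 / 4 :: real) ^ i"
        by (simp_all add: power_add power2_eq_square)
      ultimately show ?thesis by linarith
    qed
  qed
qed

context weighted_shift begin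

text \<open>The expansion is known only for \<open>k \<ge> 1\<close>, since the infimum in the
  weight condition omits \<open>k = 0\<close>. Coordinate 0 of the image is therefore dropped, which
  is why the tail starts at \<open>n * j + 1\<close>.\<close>

lemma lp_norm_bshift_power_ge:
  assumes c: "0 < c" "\<And>k. 1 \<le> k \<Longrightarrow> c * W k \<le> W (k + n)"
    and x: "x \<in> lp p"
  shows "c ^ j * lp_norm p (tail (n * j + 1) x) \<le> lp_norm p ((bshift w ^^ (n * j)) x)"
proof -
  define R where "R = lp_norm p ((bshift w ^^ (n * j)) x)"
  have cj: "c ^ j * W k \<le> W (k + n * j)" if "1 \<le> k" for k
  proof (induction j)
    case (Suc j)
    have "c ^ Suc j * W k = c * (c ^ j * W k)" by simp
    also have "\<dots> \<le> c * W (k + n * j)" using Suc c(1) by (intro mult_left_mono) auto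
    also have "\<dots> \<le> W (k + n * j + n)" using that by (intro c(2)) simp
    finally show ?case by (simp add: algebra_simps)
  qed simp
  have bound: "(\<Sum>m<L. norm (tail (n * j + 1) x m) powr p) \<le> (R / c ^ j) powr p" for L
  proof -
    have "(\<Sum>m<L. norm (tail (n * j + 1) x m) powr p) \<le> (\<Sum>m<n * j + 1 + L. norm (tail (n * j + 1) x m) powr p)"
      by (rule sum_mono2) auto
    also have "\<dots> = (\<Sum>m\<in>{n * j + 1..<n * j + 1 + L}. norm (x m) powr p)"
      using p0 by (intro sum.mono_neutral_cong_right) (auto simp: tail_def)
    also have "\<dots> = (\<Sum>k\<in>{1..<1 + L}. norm (x (k + n * j)) powr p)"
      using sum.shift_bounds_nat_ivl[of "\<lambda>m. norm (x m) powr p" 1 "n * j" "1 + L"]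
      by (simp add: add.commute add.left_commute)
    also have "\<dots> \<le> (\<Sum>k\<in>{1..<1 + L}. norm ((bshift w ^^ (n * j)) x k) powr p / (c ^ j) powr p)"
    proof (rule sum_mono)
      fix k assume "k \<in> {1..<1 + L}"
      then have "c ^ j \<le> W (k + n * j) / W k" using cj[of k] by (simp add: le_divide_eq)
      from mult_right_mono[OF this, of "norm (x (k + n * j))"]
      have "c ^ j * norm (x (k + n * j)) \<le> norm ((bshift w ^^ (n * j)) x k)"
        unfolding norm_bshift_power by simp
      then have "norm (x (k + n * j)) \<le> norm ((bshift w ^^ (n * j)) x k) / c ^ j"
        using c(1) by (simp add: pos_le_divide_eq mult.commute)
      then have "norm (x (k + n * j)) powr p \<le> (norm ((bshift w ^^ (n * j)) x k) / c ^ j) powr p"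
        using p0 by (intro powr_mono2) auto
      then show "norm (x (k + n * j)) powr p \<le> norm ((bshift w ^^ (n * j)) x k) powr p / (c ^ j) powr p"
        using c(1) by (simp add: powr_divide)
    qed
    also have "\<dots> = (\<Sum>k\<in>{1..<1 + L}. norm ((bshift w ^^ (n * j)) x k) powr p) / (c ^ j) powr p"
      by (rule sum_divide_distrib[symmetric])
    also have "\<dots> \<le> R powr p / (c ^ j) powr p"
      unfolding R_def
      by (intro divide_right_mono sum_norm_le_lp_norm p0 bshift_power_lp(1) x) auto
    also have "\<dots> = (R / c ^ j) powr p"
      using c(1) by (simp add: powr_divide R_def lp_norm_nonneg)
    finally show ?thesis .
  qed
  have "0 \<le> R / c ^ j" using c(1) by (simp add: R_def lp_norm_nonneg)
  from lp_normI(2)[OF p0 this bound] show ?thesis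
    using c(1) by (simp add: R_def le_divide_eq mult.commute)
qed

text \<open>Between \<open>k i\<close> and \<open>k (Suc i)\<close> the tail of \<open>x\<close> is
  at least \<open>(1 / 4) ^ (i + 2)\<close>. The position \<open>k i\<close> is chosen so late that
  at least \<open>q i\<close> expansions by \<open>c\<close> have happened by then, and these
  outweigh the decay.\<close>

lemma lp_norm_orbit_bounded_below:
  fixes M :: "(nat \<Rightarrow> 'a::real_normed_field) set"
  assumes M: "lp_closed_inf_dim_subspace p M"
    and c: "1 < c" "\<And>k. 1 \<le> k \<Longrightarrow> c * W k \<le> W (k + n)" and n: "1 \<le> n"
  obtains x \<delta> where "x \<in> M" "x \<noteq> (\<lambda>n. 0)" "0 < \<delta>" "\<And>N. \<delta> \<le> lp_norm p ((bshift w ^^ N) x)"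
proof -
  have "\<exists>m. 4 ^ (i + 2) < c ^ m" for i :: nat
    using real_arch_pow[OF c(1)] by blast
  then obtain q where q: "\<And>i. 4 ^ (i + 2) < c ^ q i" for i :: nat by metis
  obtain x :: "nat \<Rightarrow> 'a" and k :: "nat \<Rightarrow> nat" where x: "x \<in> M" and k: "strict_mono k" "\<And>i. n * q i \<le> k i"
    and slow: "\<And>i. (1 / 4) ^ (i + 2) \<le> lp_norm p (tail (k (Suc i)) x)"
    by (rule inf_dim_subspace_slow_tail[OF p M, of "\<lambda>i. n * q i"]) (rule that)
  have xlp: "x \<in> lp p" using M x by (auto simp: lp_closed_inf_dim_subspace_def)
  have big: "1 \<le> lp_norm p ((bshift w ^^ (n * j)) x)" if j: "k 0 \<le> n * j" for j
  proof -
    define i where "i = (GREATEST i. k i \<le> n * j)"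
    have bd: "i \<le> n * j" if "k i \<le> n * j" for i
      using strict_mono_imp_increasing[OF k(1), of i] that by simp
    have ki: "k i \<le> n * j" unfolding i_def by (rule GreatestI_nat[of _ 0 "n * j"]) (use j bd in auto)
    have ki': "n * j < k (Suc i)"
    proof (rule ccontr)
      assume "\<not> ?thesis"
      then have "Suc i \<le> i" unfolding i_def by (intro Greatest_le_nat[of _ _ "n * j"]) (use bd in auto)
      then show False by simp
    qed
    have "n * q i \<le> n * j" using k(2)[of i] ki by linarith
    then have qj: "q i \<le> j" using n by simp
    have "1 = 4 ^ (i + 2) * (1 / 4 :: real) ^ (i + 2)" by (simp add: power_mult_distrib[symmetric])
    also have "\<dots> \<le> c ^ q i * lp_norm p (tail (k (Suc i)) x)"
      using q[of i] slow[of i] c(1) by (intro mult_mono) auto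
    also have "\<dots> \<le> c ^ j * lp_norm p (tail (n * j + 1) x)"
      using c(1) qj ki' by (intro mult_mono power_increasing tail_mono_lp_norm p0 xlp) (auto simp: lp_norm_nonneg)
    also have "\<dots> \<le> lp_norm p ((bshift w ^^ (n * j)) x)"
      by (rule lp_norm_bshift_power_ge[OF _ c(2) xlp]) (use c(1) in auto)
    finally show ?thesis .
  qed
  \<comment> \<open>From any time \<open>N\<close>, a multiple of \<open>n\<close> that is at least
    \<open>k 0\<close> is reached within \<open>n + n * k 0\<close> further steps, each expanding
    the norm by at most \<open>C\<close>.\<close>
  define \<delta> where "\<delta> = 1 / C ^ (n + n * k 0)"
  show ?thesis
  proof (rule that[OF x])
    show "0 < \<delta>" using C1 by (simp add: \<delta>_def)
    show "\<delta> \<le> lp_norm p ((bshift w ^^ N) x)" for N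
    proof -
      define j where "j = N div n + 1 + k 0"
      have nj: "n * j = n * (N div n) + n + n * k 0" by (simp add: j_def algebra_simps)
      have N: "n * (N div n) + N mod n = N" "N mod n < n" using n by auto
      have le: "N \<le> n * j" "n * j - N \<le> n + n * k 0" using N nj by linarith+
      have "k 0 \<le> n * k 0" using n by simp
      then have "k 0 \<le> n * j" using nj by linarith
      then have "1 \<le> lp_norm p ((bshift w ^^ (n * j)) x)" by (rule big)
      also have "(bshift w ^^ (n * j)) x = (bshift w ^^ (n * j - N)) ((bshift w ^^ N) x)"
        by (metis comp_apply funpow_add le(1) le_add_diff_inverse2)
      also have "lp_norm p \<dots> \<le> C ^ (n * j - N) * lp_norm p ((bshift w ^^ N) x)"
        by (rule bshift_power_lp(2)[OF bshift_power_lp(1)[OF xlp]])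
      also have "\<dots> \<le> C ^ (n + n * k 0) * lp_norm p ((bshift w ^^ N) x)"
        using C1 le(2) by (intro mult_right_mono power_increasing) (auto simp: lp_norm_nonneg)
      finally show ?thesis using C1 by (simp add: \<delta>_def divide_le_eq mult.commute)
    qed
    show "x \<noteq> (\<lambda>n. 0)"
    proof
      assume "x = (\<lambda>n. 0)"
      then have "lp_norm p (tail (k (Suc 0)) x) = 0" using p0 by (simp add: tail_def lp_norm_def)
      then show False using slow[of 0] by simp
    qed
  qed
qed

lemma not_hypercyclic_of_orbit_bounded_below:
  assumes "0 < \<delta>" "\<And>N. \<delta> \<le> lp_norm p ((bshift w ^^ N) x)"
  shows "\<not> lp_hypercyclic_vec p (bshift w) x"
proof
  assume hc: "lp_hypercyclic_vec p (bshift w) x"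
  define U where "U = {z \<in> lp p. lp_dist p z (\<lambda>n. 0 :: 'a) < \<delta>}"
  have "lp_open p U" unfolding U_def by (rule lp_open_ball[OF p lp_zero])
  moreover have "(\<lambda>n. 0) \<in> U" using assms(1) p0 by (simp add: U_def lp_zero)
  ultimately obtain N where "(bshift w ^^ N) x \<in> U"
    using hc unfolding lp_hypercyclic_vec_def by blast
  then show False using assms(2)[of N] by (simp add: U_def lp_dist_def)
qed

lemma INF_le_one_of_hypercyclic_subspace:
  fixes M :: "(nat \<Rightarrow> 'a::real_normed_field) set"
  assumes M: "lp_closed_inf_dim_subspace p M"
    and hc: "\<And>x. x \<in> M \<Longrightarrow> x \<noteq> (\<lambda>n. 0) \<Longrightarrow> lp_hypercyclic_vec p (bshift w) x"
    and n: "1 \<le> n"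
  shows "(INF k\<in>{1..}. \<Prod>j\<in>{1..n}. w (k + j)) \<le> 1"
proof (rule ccontr)
  define c where "c = (INF k\<in>{1..}. \<Prod>j\<in>{1..n}. w (k + j))"
  assume "\<not> ?thesis"
  then have c: "1 < c" by (simp add: c_def)
  have "c * W k \<le> W (k + n)" if "1 \<le> k" for k
  proof -
    have "c \<le> (\<Prod>j\<in>{1..n}. w (k + j))"
      unfolding c_def using that wpos
      by (intro cINF_lower bdd_belowI2[of _ 0] prod_nonneg) (auto simp: less_imp_le)
    then show ?thesis unfolding W_add by (simp add: mult.commute)
  qed
  from lp_norm_orbit_bounded_below[OF M c this n]
  obtain x \<delta> where x: "x \<in> M" "x \<noteq> (\<lambda>n. 0)" "0 < \<delta>" "\<And>N. \<delta> \<le> lp_norm p ((bshift w ^^ N) x)"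
    by metis
  show False using not_hypercyclic_of_orbit_bounded_below[OF x(3,4)] hc[OF x(1,2)] by blast
qed


section \<open>Positions where the weight products grow slowly\<close>

lemma W_at_top:
  assumes "summable (\<lambda>k. W k powr - p)"
  shows "filterlim W at_top sequentially"
proof -
  have z: "(\<lambda>k. W k powr - p) \<longlonglongrightarrow> 0" by (rule summable_LIMSEQ_zero[OF assms])
  show ?thesis
    unfolding filterlim_at_top_gt[where c = 0]
  proof (intro allI impI)
    fix Z :: real assume Z: "0 < Z"
    then have "\<forall>\<^sub>F k in sequentially. W k powr - p < Z powr - p"
      by (intro order_tendstoD(2)[OF z]) simp
    then show "\<forall>\<^sub>F k in sequentially. Z \<le> W k"
    proof eventually_elim
      case (elim k)
      show ?case
      proof (rule ccontr)
        assume "\<not> ?thesis"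
        then have "Z powr - p \<le> W k powr - p" using p0 by (intro powr_mono2') auto
        then show False using elim by simp
      qed
    qed
  qed
qed

text \<open>Otherwise every \<open>k \<ge> m\<close> could be moved back by at most \<open>N\<close> steps while halving the
  weight \<open>W\<close>; iterating, \<open>W\<close> would grow geometrically.\<close>

lemma slow_growth_points:
  assumes sum: "summable (\<lambda>k. W k powr - p)"
    and inf: "\<And>n. 1 \<le> n \<Longrightarrow> (INF k\<in>{1..}. \<Prod>j\<in>{1..n}. w (k + j)) \<le> 1"
  shows "\<exists>k\<ge>m. N \<le> k \<and> (\<forall>n\<le>N. W k \<le> 2 * W (k - n))"
proof (rule ccontr)
  assume "\<not> ?thesis"
  then have none: "\<exists>n\<le>N. 2 * W (k - n) < W k" if "m \<le> k" "N \<le> k" for k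
    using that by (meson not_less)
  define m' where "m' = m + N + 1"
  have halve: "\<exists>n. 1 \<le> n \<and> n \<le> N \<and> 2 * W (k - n) < W k" if "m' \<le> k" for k
  proof -
    have "m \<le> k" "N \<le> k" using that by (simp_all add: m'_def)
    from none[OF this] obtain n where n: "n \<le> N" "2 * W (k - n) < W k" by blast
    then have "n \<noteq> 0" using W_pos[of k] by (intro notI) simp
    then show ?thesis using n by (intro exI[of _ n]) auto
  qed
  have N1: "1 \<le> N" using halve[of m'] by auto
  \<comment> \<open>The rate per unit step: moving back by \<open>n \<le> N\<close> with the product
    halved gains at least the factor \<open>\<beta> ^ n\<close>.\<close>
  define \<beta> where "\<beta> = 2 powr (1 / real N)"
  have \<beta>: "1 < \<beta>" unfolding \<beta>_def using N1 by simp
  have \<beta>N: "\<beta> ^ n \<le> 2" if "n \<le> N" for n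
  proof -
    have "\<beta> ^ n \<le> \<beta> ^ N" using that \<beta> by (intro power_increasing) auto
    also have "\<dots> = 2" unfolding \<beta>_def using N1 by (simp add: powr_realpow[symmetric] powr_powr)
    finally show ?thesis .
  qed
  have chain: "\<exists>r. L \<le> r \<and> r \<le> L + N \<and> r \<le> k \<and> \<beta> ^ r * W (k - r) \<le> W k" if "m' + L \<le> k" for k L
    using that
  proof (induction L)
    case 0
    then show ?case by (intro exI[of _ 0]) simp
  next
    case (Suc L)
    then obtain r where r: "L \<le> r" "r \<le> L + N" "r \<le> k" "\<beta> ^ r * W (k - r) \<le> W k" by auto
    show ?case
    proof (cases "r = L")
      case False
      then show ?thesis using r by (intro exI[of _ r]) auto
    next
      case True
      have "m' \<le> k - r" using Suc.prems True by simp
      then obtain n where n: "1 \<le> n" "n \<le> N" "2 * W (k - r - n) < W (k - r)" using halve by blast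
      have "\<beta> ^ (r + n) * W (k - (r + n)) = \<beta> ^ r * (\<beta> ^ n * W (k - r - n))"
        by (simp add: power_add)
      also have "\<dots> \<le> \<beta> ^ r * (2 * W (k - r - n))"
        using \<beta>N[OF n(2)] \<beta> by (intro mult_left_mono mult_right_mono) (auto simp: less_imp_le)
      also have "\<dots> \<le> \<beta> ^ r * W (k - r)"
        using n(3) \<beta> by (intro mult_left_mono) auto
      also have "\<dots> \<le> W k" by (rule r(4))
      finally show ?thesis using n True Suc.prems by (intro exI[of _ "r + n"]) (auto simp: m'_def)
    qed
  qed
  \<comment> \<open>The chain may overshoot \<open>L\<close> by up to \<open>N\<close> steps, which
    costs at most \<open>C ^ N\<close>; the growth by \<open>\<beta>\<close> pays for this and
    leaves a factor 2.\<close>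
  obtain L1 where L1: "2 * C ^ N < \<beta> ^ L1" using real_arch_pow[OF \<beta>] by blast
  have grow: "2 * W k \<le> W (k + L)" if "m' \<le> k" "L1 \<le> L" for k L
  proof -
    have "m' + L \<le> k + L" using that(1) by simp
    from chain[OF this] obtain r
      where r: "L \<le> r" "r \<le> L + N" "r \<le> k + L" "\<beta> ^ r * W (k + L - r) \<le> W (k + L)" by blast
    have "W k \<le> C ^ (r - L) * W (k + L - r)"
      using W_le[of "k + L - r" "r - L"] r by simp
    also have "\<dots> \<le> C ^ N * W (k + L - r)"
      using C1 r by (intro mult_right_mono power_increasing) (auto simp: less_imp_le)
    finally have "2 * W k \<le> 2 * C ^ N * W (k + L - r)" by simp
    also have "\<dots> \<le> \<beta> ^ L1 * W (k + L - r)"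
      using L1 by (intro mult_right_mono) (auto simp: less_imp_le)
    also have "\<dots> \<le> \<beta> ^ r * W (k + L - r)"
      using \<beta> r that by (intro mult_right_mono power_increasing) (auto simp: less_imp_le)
    finally show ?thesis using r(4) by simp
  qed
  \<comment> \<open>Only finitely many \<open>k < m'\<close> escape the growth estimate; for them
    the divergence of \<open>W\<close> suffices.\<close>
  define B where "B = (\<Sum>k<m'. 2 * W k)"
  obtain L2 where L2: "\<And>k. L2 \<le> k \<Longrightarrow> B \<le> W k"
    using W_at_top[OF sum] unfolding filterlim_at_top eventually_sequentially by blast
  define L where "L = L1 + L2 + 1"
  have all: "2 * W k \<le> W (k + L)" for k
  proof (cases "m' \<le> k")
    case True
    then show ?thesis by (intro grow) (auto simp: L_def)
  next
    case False
    then have "2 * W k \<le> B" unfolding B_def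
      by (intro member_le_sum) (auto simp: less_imp_le)
    also have "\<dots> \<le> W (k + L)" by (rule L2) (simp add: L_def)
    finally show ?thesis .
  qed
  have "2 \<le> (INF k\<in>{1..}. \<Prod>j\<in>{1..L}. w (k + j))"
  proof (rule cINF_greatest)
    fix k :: nat assume "k \<in> {1..}"
    have "2 * W k \<le> W k * (\<Prod>j\<in>{1..L}. w (k + j))" using all[of k] by (simp only: W_add)
    then show "2 \<le> (\<Prod>j\<in>{1..L}. w (k + j))"
      using W_pos[of k] by (simp add: mult.commute[of 2] del: W_pos)
  qed auto
  then show False using inf[of L] by (simp add: L_def)
qed

end

section \<open>Sufficiency\<close>

context weighted_shift begin

definition V :: "nat \<Rightarrow> real" where "V n = (\<Sum>i. W (i + n) powr - p)"

lemma sum_le_V: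
  assumes "summable (\<lambda>k. W k powr - p)"
  shows "(\<Sum>k\<in>{n..<L}. W k powr - p) \<le> V n"
proof -
  have "(\<Sum>k\<in>{n..<L}. W k powr - p) \<le> (\<Sum>k\<in>{0 + n..<L + n}. W k powr - p)"
    by (rule sum_mono2) auto
  also have "\<dots> = (\<Sum>i<L. W (i + n) powr - p)"
    by (subst sum.shift_bounds_nat_ivl) (simp add: lessThan_atLeast0)
  also have "\<dots> \<le> V n"
    unfolding V_def by (intro sum_le_suminf summable_ignore_initial_segment assms) auto
  finally show ?thesis .
qed

lemma V_tendsto_0:
  assumes "summable (\<lambda>k. W k powr - p)"
  shows "V \<longlonglongrightarrow> 0"
  unfolding V_def using suminf_exist_split2[OF assms] by simp

end

text \<open>In stage \<open>j\<close> the target \<open>t j\<close> is copied \<open>Q j\<close> times, with period \<open>g j\<close>, into the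
  coordinates from \<open>m j\<close> on; these coordinates belong to the vector number \<open>\<iota> j\<close>. The stage
  ends with the coordinate \<open>\<kappa> (Suc j)\<close>, which carries the unit vector of vector number \<open>j\<close>.\<close>

locale staged_blocks = weighted_shift +
  fixes t :: "nat \<Rightarrow> nat \<Rightarrow> 'a::real_normed_field" and B :: "nat \<Rightarrow> real"
    and \<iota> g Q \<kappa> m :: "nat \<Rightarrow> nat"
  assumes sumW: "summable (\<lambda>k. W k powr - p)"
    and g_pos: "\<And>j. 1 \<le> g j"
    and t_supp: "\<And>j s. g j \<le> s \<Longrightarrow> t j s = 0"
    and t_le_B: "\<And>j s. (W s * norm (t j s)) powr p \<le> B j"
    and BV: "\<And>j. B j * V (m j - \<kappa> j) \<le> (1 / 2) ^ j"
    and \<kappa>_less_m: "\<And>j. \<kappa> j < m j"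
    and end_le_\<kappa>: "\<And>j. m j + g j * Q j \<le> \<kappa> (Suc j)"
    and slow: "\<And>j n. n \<le> m j + g j * Q j \<Longrightarrow> W (\<kappa> (Suc j)) \<le> 2 * W (\<kappa> (Suc j) - n)"
begin

lemma \<kappa>_less_Suc: "\<kappa> j < \<kappa> (Suc j)"
  using \<kappa>_less_m[of j] end_le_\<kappa>[of j] by linarith

lemma strict_mono_\<kappa>: "strict_mono \<kappa>"
  by (rule strict_monoI_Suc) (rule \<kappa>_less_Suc)

lemma le_\<kappa>: "j \<le> \<kappa> j"
  by (rule strict_mono_imp_increasing[OF strict_mono_\<kappa>])

lemma \<kappa>_le_iff: "\<kappa> i \<le> \<kappa> j \<longleftrightarrow> i \<le> j"
  by (rule strict_mono_less_eq[OF strict_mono_\<kappa>])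

lemma \<kappa>_eq_iff: "\<kappa> i = \<kappa> j \<longleftrightarrow> i = j"
  by (rule strict_mono_eq[OF strict_mono_\<kappa>])

lemma B_nonneg: "0 \<le> B j"
  by (rule order_trans[OF powr_ge_zero t_le_B])

text \<open>Stage \<open>j\<close> consists of the coordinates after \<open>\<kappa> j\<close> up to
  and including \<open>\<kappa> (Suc j)\<close>; those up to \<open>\<kappa> 0\<close> fall into
  stage 0 as well.\<close>

definition stage :: "nat \<Rightarrow> nat" where "stage n = (LEAST j. n \<le> \<kappa> (Suc j))"

lemma le_\<kappa>_stage: "n \<le> \<kappa> (Suc (stage n))"
  unfolding stage_def by (rule LeastI[of _ n]) (use le_\<kappa>[of "Suc n"] in simp)

lemma stage_le: "n \<le> \<kappa> (Suc j) \<Longrightarrow> stage n \<le> j"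
  unfolding stage_def by (rule Least_le)

lemma stage_eq: "\<kappa> j < n \<Longrightarrow> n \<le> \<kappa> (Suc j) \<Longrightarrow> stage n = j"
  using stage_le[of n j] le_\<kappa>_stage[of n] \<kappa>_le_iff[of "Suc (stage n)" j]
  by (meson Suc_leI le_less_trans linorder_not_less nat_less_le)

lemma stage_le_self: "stage n \<le> n"
  using stage_le[of n n] le_\<kappa>[of "Suc n"] by simp

lemma stage_\<kappa>: "stage (\<kappa> (Suc j)) = j"
  by (rule stage_eq[OF \<kappa>_less_Suc order_refl])

text \<open>The factor \<open>W s / W n\<close> is what the shift by \<open>n - s\<close> steps
  cancels, so at the time where a copy starts it appears as exactly \<open>t j\<close> on the first
  \<open>g j\<close> coordinates. All generating vectors are stored in this one sequence, as their
  supports are disjoint.\<close>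

definition \<phi> :: "nat \<Rightarrow> 'a" where
  "\<phi> n = (let j = stage n; s = (n - m j) mod g j in
     if n = \<kappa> (Suc j) then 1
     else if m j \<le> n \<and> n < m j + g j * Q j then of_real (W s / W n) * t j s else 0)"

definition owner :: "nat \<Rightarrow> nat" where
  "owner n = (if n = \<kappa> (Suc (stage n)) then stage n else \<iota> (stage n))"

lemma \<phi>_\<kappa>: "\<phi> (\<kappa> (Suc j)) = 1"
  by (simp add: \<phi>_def stage_\<kappa>)

lemma owner_\<kappa>: "owner (\<kappa> (Suc j)) = j"
  by (simp add: owner_def stage_\<kappa>)

lemma \<phi>_cases:
  obtains (unit) "n = \<kappa> (Suc (stage n))"
  | (block) "n \<noteq> \<kappa> (Suc (stage n))" "m (stage n) \<le> n" "n < m (stage n) + g (stage n) * Q (stage n)"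
      "\<phi> n = of_real (W ((n - m (stage n)) mod g (stage n)) / W n) * t (stage n) ((n - m (stage n)) mod g (stage n))"
  | (zero) "\<phi> n = 0"
proof (cases "n = \<kappa> (Suc (stage n))")
  case False
  then show ?thesis
    using block zero
    by (cases "m (stage n) \<le> n \<and> n < m (stage n) + g (stage n) * Q (stage n)") (auto simp: \<phi>_def Let_def)
qed (rule unit)

lemma norm_\<phi>_block:
  assumes "n \<noteq> \<kappa> (Suc (stage n))"
  shows "(W n * norm (\<phi> n)) powr p \<le> B (stage n)"
proof (cases n rule: \<phi>_cases)
  case block
  let ?s = "(n - m (stage n)) mod g (stage n)"
  have "norm (\<phi> n) = W ?s / W n * norm (t (stage n) ?s)"
    unfolding block(4) norm_mult norm_of_real by (simp add: less_imp_le)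
  then have "W n * norm (\<phi> n) = W ?s * norm (t (stage n) ?s)" by simp
  then show ?thesis using t_le_B by simp
qed (use assms B_nonneg in auto)

text \<open>A closed span given by coordinate equations: as \<open>\<phi>\<close> is 1 at
  \<open>\<kappa> (Suc i)\<close>, the coefficient \<open>a i\<close> is a coordinate of
  \<open>x\<close>, and the equations pass to limits.\<close>

definition M :: "(nat \<Rightarrow> 'a) set" where
  "M = {x \<in> lp p. \<exists>a. \<forall>n. x n = a (owner n) * \<phi> n}"

lemma M_coordinate: "x \<in> M \<Longrightarrow> x n = x (\<kappa> (Suc (owner n))) * \<phi> n"
  by (auto simp: M_def \<phi>_\<kappa> owner_\<kappa>)

lemma M_I: "x \<in> lp p \<Longrightarrow> (\<And>n. x n = a (owner n) * \<phi> n) \<Longrightarrow> x \<in> M"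
  by (auto simp: M_def)

lemma M_closed:
  assumes x: "x \<in> lp p" and appr: "\<And>e. 0 < e \<Longrightarrow> \<exists>y\<in>M. lp_dist p y x < e"
  shows "x \<in> M"
proof (rule M_I[OF x, where a = "\<lambda>i. x (\<kappa> (Suc i))"])
  fix n
  define k where "k = \<kappa> (Suc (owner n))"
  have "norm (x n - x k * \<phi> n) \<le> 0 + e" if "0 < e" for e
  proof -
    define d where "d = e / (1 + norm (\<phi> n))"
    have d: "0 < d" using that by (simp add: d_def add_pos_nonneg)
    obtain y where y: "y \<in> M" "lp_dist p y x < d" using appr[OF d] by blast
    have close: "norm (y i - x i) \<le> d" for i
      using norm_le_lp_norm[OF p0 lp_diff[OF p _ x], of y i] y by (auto simp: M_def lp_dist_def)
    have "x n - x k * \<phi> n = (y k - x k) * \<phi> n - (y n - x n)"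
      using M_coordinate[OF y(1), of n] by (simp add: k_def algebra_simps)
    also have "norm \<dots> \<le> norm (y k - x k) * norm (\<phi> n) + norm (y n - x n)"
      using norm_triangle_ineq4[of "(y k - x k) * \<phi> n" "y n - x n"] by (simp add: norm_mult)
    also have "\<dots> \<le> d * norm (\<phi> n) + d"
      by (rule add_mono[OF mult_right_mono[OF close norm_ge_zero] close])
    also have "\<dots> = d * (1 + norm (\<phi> n))" by (simp add: distrib_left)
    also have "\<dots> = e"
    proof -
      have "1 + norm (\<phi> n) \<noteq> 0" using norm_ge_zero[of "\<phi> n"] by linarith
      then show ?thesis by (simp add: d_def)
    qed
    finally show ?thesis by simp
  qed
  then have "norm (x n - x k * \<phi> n) \<le> 0" by (rule field_le_epsilon)
  then show "x n = x (\<kappa> (Suc (owner n))) * \<phi> n" by (simp add: k_def)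
qed

definition basis :: "nat \<Rightarrow> nat \<Rightarrow> 'a" where
  "basis i = (\<lambda>n. if owner n = i then \<phi> n else 0)"

lemma basis_\<kappa>: "basis i (\<kappa> (Suc j)) = (if i = j then 1 else 0)"
  by (simp add: basis_def owner_\<kappa> \<phi>_\<kappa>)

text \<open>A shift made no later than \<open>\<kappa> j\<close> carries block \<open>j\<close> to
  coordinates from \<open>m j - \<kappa> j\<close> on, where its entries have \<open>p\<close>-th
  powers at most \<open>B j * W s powr - p\<close>. So this bounds the disturbance by block
  \<open>j\<close> at all earlier visits.\<close>

lemma B_v_sum_le: "(\<Sum>s<L. if m j - \<kappa> j \<le> s then B j * W s powr - p else 0) \<le> (1 / 2) ^ j"
proof -
  have "(\<Sum>s<L. if m j - \<kappa> j \<le> s then B j * W s powr - p else 0) =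
      (\<Sum>s\<in>{m j - \<kappa> j..<L}. B j * W s powr - p)"
    by (rule sum.mono_neutral_cong_right) auto
  also have "\<dots> = B j * (\<Sum>s\<in>{m j - \<kappa> j..<L}. W s powr - p)"
    by (simp add: sum_distrib_left)
  also have "\<dots> \<le> B j * V (m j - \<kappa> j)"
    by (intro mult_left_mono sum_le_V sumW B_nonneg)
  also have "\<dots> \<le> (1 / 2) ^ j" by (rule BV)
  finally show ?thesis .
qed

lemma sum_half_powers_le: "(\<Sum>i\<in>{j..J}. (1 / 2 :: real) ^ i) \<le> 2 * (1 / 2) ^ j"
proof -
  have "(\<Sum>i\<in>{j..<j + L}. (1 / 2 :: real) ^ i) = 2 * (1 / 2) ^ j - 2 * (1 / 2) ^ (j + L)" for L
    by (induction L) auto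
  then have 1: "(\<Sum>i\<in>{j..<j + Suc J}. (1 / 2 :: real) ^ i) \<le> 2 * (1 / 2) ^ j" by simp
  have "(\<Sum>i\<in>{j..J}. (1 / 2 :: real) ^ i) \<le> (\<Sum>i\<in>{j..<j + Suc J}. (1 / 2 :: real) ^ i)"
    by (rule sum_mono2) auto
  with 1 show ?thesis by linarith
qed

lemma basis_lp: "basis i \<in> lp p"
proof -
  \<comment> \<open>The unit coordinate gives 1 and all blocks together at most 2, by the geometric
    series. Stages up to \<open>L\<close> suffice because \<open>stage n \<le> n\<close>.\<close>
  have "(\<Sum>n<L. norm (basis i n) powr p) \<le> 3" for L
  proof -
    have "(\<Sum>n<L. norm (basis i n) powr p) \<le>
      (\<Sum>n<L. (if n = \<kappa> (Suc i) then 1 else 0) + (\<Sum>j\<in>{0..L}. if m j - \<kappa> j \<le> n then B j * W n powr - p else 0))"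
    proof (rule sum_mono)
      fix n assume n: "n \<in> {..<L}"
      have nonneg: "0 \<le> (if m j - \<kappa> j \<le> n then B j * W n powr - p else 0)" for j
        by (simp add: B_nonneg)
      have sum_nn: "0 \<le> (\<Sum>j\<in>{0..L}. if m j - \<kappa> j \<le> n then B j * W n powr - p else 0)"
        by (rule sum_nonneg) (rule nonneg)
      show "norm (basis i n) powr p \<le>
        (if n = \<kappa> (Suc i) then 1 else 0) + (\<Sum>j\<in>{0..L}. if m j - \<kappa> j \<le> n then B j * W n powr - p else 0)"
      proof (cases n rule: \<phi>_cases)
        case unit
        define j where "j = stage n"
        have "norm (basis i n) powr p \<le> (if n = \<kappa> (Suc i) then 1 else 0)"
        proof -
          have nj: "n = \<kappa> (Suc j)" unfolding j_def by (rule unit)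
          show ?thesis unfolding nj basis_\<kappa> \<kappa>_eq_iff by simp
        qed
        then show ?thesis using sum_nn by linarith
      next
        case block
        have "norm (basis i n) powr p \<le> norm (\<phi> n) powr p" by (simp add: basis_def)
        also have "\<dots> = (W n * norm (\<phi> n)) powr p * W n powr - p"
          by (simp add: powr_mult powr_minus)
        also have "\<dots> \<le> B (stage n) * W n powr - p"
          by (intro mult_right_mono norm_\<phi>_block block(1)) auto
        also have "\<dots> = (if m (stage n) - \<kappa> (stage n) \<le> n then B (stage n) * W n powr - p else 0)"
          using block(2) by simp
        also have "\<dots> \<le> (\<Sum>j\<in>{0..L}. if m j - \<kappa> j \<le> n then B j * W n powr - p else 0)"
          by (rule member_le_sum) (use n stage_le_self[of n] nonneg in auto)
        finally show ?thesis by (rule order_trans) simp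
      next
        case zero
        then have "basis i n = 0" by (simp add: basis_def)
        then show ?thesis using sum_nn by simp
      qed
    qed
    also have "\<dots> = (\<Sum>n<L. if n = \<kappa> (Suc i) then 1 else 0) +
        (\<Sum>j\<in>{0..L}. \<Sum>n<L. if m j - \<kappa> j \<le> n then B j * W n powr - p else 0)"
      by (simp only: sum.distrib) (subst sum.swap, rule refl)
    also have "\<dots> \<le> 1 + (\<Sum>j\<in>{0..L}. (1 / 2) ^ j)"
      by (intro add_mono sum_mono B_v_sum_le) (simp add: sum.delta)
    also have "\<dots> \<le> 3" using sum_half_powers_le[of 0 L] by simp
    finally show ?thesis .
  qed
  then have *: "(\<Sum>n<L. norm (basis i n) powr p) \<le> (3 powr (1 / p)) powr p" for L
    using p0 by (simp add: powr_powr)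
  show ?thesis by (rule lp_normI(1)[OF p0 _ *]) simp
qed

lemma basis_M: "basis i \<in> M"
  by (rule M_I[OF basis_lp, where a = "\<lambda>k. if k = i then 1 else 0"]) (simp add: basis_def)

text \<open>Evaluation at the coordinates \<open>\<kappa> (Suc j)\<close> separates the generating
  vectors, so \<open>card F + 1\<close> of them are independent.\<close>

lemma M_not_fin_span: "\<not> (\<exists>F. finite F \<and> M \<subseteq> fin_span F)"
proof
  interpret vs: vector_space "\<lambda>c (x :: nat \<Rightarrow> 'a) n. c * x n"
    by standard (auto simp: algebra_simps)
  assume "\<exists>F. finite F \<and> M \<subseteq> fin_span F"
  then obtain F where F: "finite F" "M \<subseteq> fin_span F" by blast
  have sum_apply: "(\<Sum>f\<in>S. h f) k = (\<Sum>f\<in>S. h f k)" for h :: "(nat \<Rightarrow> 'a) \<Rightarrow> nat \<Rightarrow> 'a" and S k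
    by (induction S rule: infinite_finite_induct) auto
  have span: "fin_span F \<subseteq> vs.span F"
  proof
    fix x assume "x \<in> fin_span F"
    then obtain c where "x = (\<lambda>n. \<Sum>f\<in>F. c f * f n)" by (auto simp: fin_span_def)
    then have "x = (\<Sum>f\<in>F. (\<lambda>n. c f * f n))" by (auto simp: sum_apply)
    then show "x \<in> vs.span F" by (simp add: vs.span_sum vs.span_scale vs.span_base)
  qed
  have inj: "inj basis"
  proof (rule injI)
    fix i j assume "basis i = basis j"
    then have "basis i (\<kappa> (Suc j)) = basis j (\<kappa> (Suc j))" by simp
    then show "i = j" by (simp add: basis_\<kappa> split: if_splits)
  qed
  have indep: "vs.independent (basis ` {..card F})"
    unfolding vs.independent_explicit_finite_subsets
  proof (intro allI impI ballI)
    fix S u v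
    assume S: "S \<subseteq> basis ` {..card F}" "finite S" "(\<Sum>v\<in>S. (\<lambda>n. u v * v n)) = 0" and v: "v \<in> S"
    obtain j where j: "v = basis j" using S(1) v by blast
    have "0 = (\<Sum>v\<in>S. (\<lambda>n. u v * v n)) (\<kappa> (Suc j))" using S(3) by simp
    also have "\<dots> = (\<Sum>v\<in>S. u v * v (\<kappa> (Suc j)))" by (rule sum_apply)
    also have "\<dots> = (\<Sum>f\<in>S. if f = v then u v else 0)"
    proof (rule sum.cong[OF refl])
      fix f assume "f \<in> S"
      then obtain i where "f = basis i" using S(1) by blast
      then show "u f * f (\<kappa> (Suc j)) = (if f = v then u v else 0)"
        using injD[OF inj, of i j] by (auto simp: basis_\<kappa> j)
    qed
    also have "\<dots> = u v" using S(2) v by simp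
    finally show "u v = 0" by simp
  qed
  have "basis ` {..card F} \<subseteq> vs.span F" using basis_M F(2) span by blast
  from vs.independent_span_bound[OF F(1) indep this]
  have "card (basis ` {..card F}) \<le> card F" by simp
  moreover have "card (basis ` {..card F}) = card {..card F}"
    by (rule card_image[OF inj_on_subset[OF inj]]) simp
  ultimately show False by simp
qed

lemma M_subspace: "lp_closed_inf_dim_subspace p M"
  unfolding lp_closed_inf_dim_subspace_def
proof (intro conjI ballI allI impI)
  show "(\<lambda>n. 0) \<in> M" by (rule M_I[OF lp_zero, where a = "\<lambda>i. 0"]) simp
  show "(\<lambda>n. x n + y n) \<in> M" if xy: "x \<in> M" "y \<in> M" for x y
  proof (rule M_I[where a = "\<lambda>i. x (\<kappa> (Suc i)) + y (\<kappa> (Suc i))"])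
    show "(\<lambda>n. x n + y n) \<in> lp p" using xy lp_add[OF p] by (auto simp: M_def)
    show "x n + y n = (x (\<kappa> (Suc (owner n))) + y (\<kappa> (Suc (owner n)))) * \<phi> n" for n
      using M_coordinate[OF xy(1), of n] M_coordinate[OF xy(2), of n] by (simp add: distrib_right)
  qed
  show "(\<lambda>n. c * x n) \<in> M" if x: "x \<in> M" for c x
  proof (rule M_I[where a = "\<lambda>i. c * x (\<kappa> (Suc i))"])
    show "(\<lambda>n. c * x n) \<in> lp p" using x lp_scale by (auto simp: M_def)
    show "c * x n = c * x (\<kappa> (Suc (owner n))) * \<phi> n" for n
      using M_coordinate[OF x, of n] by simp
  qed
  show "x \<in> M" if "x \<in> lp p" "\<forall>e>0. \<exists>y\<in>M. lp_dist p y x < e" for x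
    using M_closed that by blast
  show "\<not> (\<exists>F. finite F \<and> M \<subseteq> fin_span F)" by (rule M_not_fin_span)
qed (auto simp: M_def)

text \<open>By time \<open>n\<close> all earlier stages have been shifted out, and the current copy
  sits on the coordinates below \<open>g j\<close> without error. Three disturbances remain: the
  rest of the same run, the blocks of later stages, and the unit coordinates from
  \<open>\<kappa> (Suc j)\<close> on.\<close>

lemma orbit_near_target:
  assumes x: "x \<in> M" and q: "q < Q j" and n: "n = m j + q * g j"
  shows "(\<Sum>s<L. norm ((bshift w ^^ n) x s - x (\<kappa> (Suc (\<iota> j))) * t j s) powr p)
    \<le> lp_norm p x powr p * (B j * V (g j)) + lp_norm p x powr p * (1 / 2) ^ j
      + 2 powr p * lp_norm p (tail (\<kappa> (Suc j)) x) powr p"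
proof -
  define A where "A = lp_norm p x"
  define K where "K = \<kappa> (Suc j)"
  have xlp: "x \<in> lp p" using x by (simp add: M_def)
  have A: "norm (x i) \<le> A" for i unfolding A_def by (rule norm_le_lp_norm[OF p0 xlp])
  have A0: "0 \<le> A" by (simp add: A_def lp_norm_nonneg)
  have nblock: "n + g j \<le> m j + g j * Q j"
  proof -
    have "(q + 1) * g j \<le> Q j * g j" using q by (intro mult_right_mono) auto
    then show ?thesis by (simp add: n algebra_simps)
  qed
  have nK: "n + g j \<le> K" using nblock end_le_\<kappa>[of j] by (simp add: K_def)
  define e where "e s = norm ((bshift w ^^ n) x s - x (\<kappa> (Suc (\<iota> j))) * t j s) powr p" for s
  \<comment> \<open>\<open>h1\<close> majorizes the later copies of the run, \<open>h2 i\<close> the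
    block of stage \<open>i\<close>, and \<open>h3\<close> the unit coordinates, where
    \<open>slow\<close> limits the expansion to the factor 2.\<close>
  define h1 where "h1 s = (if g j \<le> s then A powr p * (B j * W s powr - p) else 0)" for s
  define h2 where "h2 i s = A powr p * (if m i - \<kappa> i \<le> s then B i * W s powr - p else 0)" for i s
  define h3 where "h3 s = 2 powr p * norm (tail K x (s + n)) powr p" for s
  have h1_nonneg: "0 \<le> h1 s" and h2_nonneg: "0 \<le> h2 i s" and h3_nonneg: "0 \<le> h3 s" for s i
    by (auto simp: h1_def h2_def h3_def B_nonneg)
  have h2_sum_nonneg: "0 \<le> (\<Sum>i\<in>{Suc j..n + L}. h2 i s)" for s
    by (rule sum_nonneg) (rule h2_nonneg)
  have bound: "e s \<le> h1 s + (\<Sum>i\<in>{Suc j..n + L}. h2 i s) + h3 s" if s: "s < L" for s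
  proof (cases "s < g j")
    case True
    define c where "c = s + n"
    have cm: "m j \<le> c" "c < m j + g j * Q j" using True nblock by (auto simp: c_def n)
    have st: "stage c = j"
      using cm \<kappa>_less_m[of j] end_le_\<kappa>[of j] by (intro stage_eq) auto
    have ne: "c \<noteq> \<kappa> (Suc j)" using cm end_le_\<kappa>[of j] by simp
    have "(c - m j) mod g j = s" using True by (simp add: c_def n)
    then have "\<phi> c = of_real (W s / W c) * t j s" using cm ne by (simp add: \<phi>_def st Let_def)
    moreover have "owner c = \<iota> j" using ne by (simp add: owner_def st)
    ultimately have xc: "x c = x (\<kappa> (Suc (\<iota> j))) * (of_real (W s / W c) * t j s)"
      using M_coordinate[OF x, of c] by simp
    have "(bshift w ^^ n) x s = of_real (W c / W s) * x c"
      by (simp only: bshift_power c_def)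
    also have "\<dots> = of_real (W c / W s * (W s / W c)) * (x (\<kappa> (Suc (\<iota> j))) * t j s)"
      unfolding xc of_real_mult by (simp only: mult_ac)
    also have "\<dots> = x (\<kappa> (Suc (\<iota> j))) * t j s" by simp
    finally have "e s = 0" by (simp add: e_def)
    then show ?thesis using h1_nonneg[of s] h2_sum_nonneg[of s] h3_nonneg[of s] by simp
  next
    case False
    define c where "c = s + n"
    define i where "i = stage c"
    have es: "e s = (W c / W s * norm (x c)) powr p"
      using False t_supp[of j s] by (simp add: e_def norm_bshift_power c_def)
    have "\<kappa> j < c" using \<kappa>_less_m[of j] by (simp add: c_def n)
    then have ji: "j \<le> i"
    proof (rule contrapos_pp)
      assume "\<not> j \<le> i"
      then have "\<kappa> (Suc i) \<le> \<kappa> j" by (simp add: \<kappa>_le_iff)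
      then show "\<not> \<kappa> j < c" using le_\<kappa>_stage[of c] by (simp add: i_def)
    qed
    have iL: "i \<le> n + L" using stage_le_self[of c] s by (simp add: i_def c_def)
    show ?thesis
    proof (cases c rule: \<phi>_cases)
      case unit
      have c: "c = \<kappa> (Suc i)" unfolding i_def by (rule unit)
      have "K \<le> c" using ji by (simp add: c K_def \<kappa>_le_iff)
      have "n \<le> m i + g i * Q i"
      proof (cases "i = j")
        case False
        then have "K \<le> \<kappa> i" using ji by (simp add: K_def \<kappa>_le_iff)
        then show ?thesis using nK \<kappa>_less_m[of i] by linarith
      qed (use nblock in simp)
      from slow[OF this] have "W c \<le> 2 * W (c - n)" by (simp add: c)
      then have "W c / W s \<le> 2" by (simp add: c_def divide_le_eq)
      then have "W c / W s * norm (x c) \<le> 2 * norm (x c)" by (rule mult_right_mono) simp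
      then have "e s \<le> (2 * norm (x c)) powr p"
        unfolding es using p0 by (intro powr_mono2) (auto simp: less_imp_le)
      also have "\<dots> = h3 s" using \<open>K \<le> c\<close> by (simp add: h3_def tail_def powr_mult c_def)
      finally show ?thesis using h1_nonneg[of s] h2_sum_nonneg[of s] by simp
    next
      case block
      have "W c / W s * norm (x c) = norm (x (\<kappa> (Suc (owner c)))) * (W c * norm (\<phi> c)) / W s"
        unfolding M_coordinate[OF x, of c] norm_mult by simp
      also have "\<dots> \<le> A * (W c * norm (\<phi> c)) / W s"
        by (intro divide_right_mono mult_right_mono A) (auto simp: less_imp_le)
      finally have "e s \<le> (A * (W c * norm (\<phi> c)) / W s) powr p"
        unfolding es using p0 by (intro powr_mono2) (auto simp: less_imp_le)
      also have "\<dots> = A powr p * ((W c * norm (\<phi> c)) powr p * W s powr - p)"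
        using A0 by (simp add: powr_mult powr_divide powr_minus_divide less_imp_le)
      also have "\<dots> \<le> A powr p * (B i * W s powr - p)"
        unfolding i_def by (intro mult_left_mono mult_right_mono norm_\<phi>_block block(1)) auto
      finally have es': "e s \<le> A powr p * (B i * W s powr - p)" .
      show ?thesis
      proof (cases "i = j")
        case True
        then show ?thesis using es' False h2_sum_nonneg[of s] h3_nonneg[of s] by (simp add: h1_def)
      next
        case ne: False
        then have "K \<le> \<kappa> i" using ji by (simp add: K_def \<kappa>_le_iff)
        then have "m i - \<kappa> i \<le> s" using nK block(2) by (simp add: c_def i_def)
        then have "e s \<le> h2 i s" using es' by (simp add: h2_def)
        also have "\<dots> \<le> (\<Sum>i\<in>{Suc j..n + L}. h2 i s)"
          by (rule member_le_sum) (use ne ji iL h2_nonneg in auto)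
        finally show ?thesis using h1_nonneg[of s] h3_nonneg[of s] by simp
      qed
    next
      case zero
      then have "x c = 0" using M_coordinate[OF x, of c] by simp
      then have "e s = 0" using p0 by (simp add: es)
      then show ?thesis using h1_nonneg[of s] h2_sum_nonneg[of s] h3_nonneg[of s] by simp
    qed
  qed
  have "(\<Sum>s<L. e s) \<le> (\<Sum>s<L. h1 s + (\<Sum>i\<in>{Suc j..n + L}. h2 i s) + h3 s)"
    by (rule sum_mono) (use bound in auto)
  also have "\<dots> = (\<Sum>s<L. h1 s) + (\<Sum>i\<in>{Suc j..n + L}. \<Sum>s<L. h2 i s) + (\<Sum>s<L. h3 s)"
    by (simp only: sum.distrib) (subst sum.swap, rule refl)
  also have "(\<Sum>s<L. h1 s) \<le> A powr p * (B j * V (g j))"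
  proof -
    have "(\<Sum>s<L. h1 s) = (\<Sum>s\<in>{g j..<L}. A powr p * (B j * W s powr - p))"
      unfolding h1_def by (rule sum.mono_neutral_cong_right) auto
    also have "\<dots> = A powr p * (B j * (\<Sum>s\<in>{g j..<L}. W s powr - p))"
      by (simp add: sum_distrib_left)
    also have "\<dots> \<le> A powr p * (B j * V (g j))"
      by (intro mult_left_mono sum_le_V sumW B_nonneg) auto
    finally show ?thesis .
  qed
  also have "(\<Sum>i\<in>{Suc j..n + L}. \<Sum>s<L. h2 i s) \<le> A powr p * (1 / 2) ^ j"
  proof -
    have "(\<Sum>i\<in>{Suc j..n + L}. \<Sum>s<L. h2 i s) \<le> (\<Sum>i\<in>{Suc j..n + L}. A powr p * (1 / 2) ^ i)"
      unfolding h2_def sum_distrib_left[symmetric]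
      by (intro sum_mono mult_left_mono B_v_sum_le) auto
    also have "\<dots> = A powr p * (\<Sum>i\<in>{Suc j..n + L}. (1 / 2) ^ i)"
      by (simp add: sum_distrib_left)
    also have "\<dots> \<le> A powr p * (2 * (1 / 2) ^ Suc j)"
      by (intro mult_left_mono sum_half_powers_le) auto
    finally show ?thesis by simp
  qed
  also have "(\<Sum>s<L. h3 s) \<le> 2 powr p * lp_norm p (tail K x) powr p"
  proof -
    have "(\<Sum>s<L. h3 s) = 2 powr p * (\<Sum>s<L. norm (tail K x (s + n)) powr p)"
      by (simp add: h3_def sum_distrib_left)
    also have "(\<Sum>s<L. norm (tail K x (s + n)) powr p) = (\<Sum>i\<in>{n..<L + n}. norm (tail K x i) powr p)"
      using sum.shift_bounds_nat_ivl[of "\<lambda>i. norm (tail K x i) powr p" 0 n L]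
      by (simp add: lessThan_atLeast0)
    also have "2 powr p * \<dots> \<le> 2 powr p * lp_norm p (tail K x) powr p"
      by (intro mult_left_mono sum_norm_le_lp_norm tail_lp p0 xlp) auto
    finally show ?thesis by simp
  qed
  finally show ?thesis by (simp add: e_def A_def K_def)
qed

end

section \<open>Density of visits\<close>

lemma upper_density_pos_of_frequently:
  assumes "0 < \<delta>" and "\<exists>\<^sub>F N in sequentially. \<delta> * real (N + 1) \<le> real (card (A \<inter> {0..N}))"
  shows "0 < upper_density A"
proof (rule ccontr)
  assume "\<not> ?thesis"
  then have "upper_density A < ereal \<delta>" using assms(1) by (auto simp: not_less intro: le_less_trans)
  then have "\<forall>\<^sub>F N in sequentially. ereal (real (card (A \<inter> {0..N})) / real (N + 1)) < ereal \<delta>"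
    unfolding upper_density_def by (rule Limsup_lessD)
  then have "\<forall>\<^sub>F N in sequentially. \<not> (\<delta> * real (N + 1) \<le> real (card (A \<inter> {0..N})))"
    by eventually_elim (simp add: divide_less_eq)
  then show False using assms(2) by (simp add: frequently_def)
qed

lemma not_lower_density_pos:
  assumes "\<And>\<delta>. 0 < \<delta> \<Longrightarrow> \<exists>\<^sub>F N in sequentially. real (card (A \<inter> {0..N})) \<le> \<delta> * real (N + 1)"
  shows "\<not> 0 < lower_density A"
proof
  assume "0 < lower_density A"
  then obtain \<delta> where d: "0 < ereal \<delta>" "ereal \<delta> < lower_density A" using ereal_dense2 by blast
  have "\<forall>\<^sub>F N in sequentially. ereal \<delta> < ereal (real (card (A \<inter> {0..N})) / real (N + 1))"
    using d(2) unfolding lower_density_def by (rule less_LiminfD)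
  then have "\<forall>\<^sub>F N in sequentially. \<not> (real (card (A \<inter> {0..N})) \<le> \<delta> * real (N + 1))"
    by eventually_elim (simp add: less_divide_eq)
  then show False using assms[of \<delta>] d(1) by (simp add: frequently_def)
qed

lemma not_upper_density_pos:
  assumes "\<And>\<delta>. 0 < \<delta> \<Longrightarrow> \<forall>\<^sub>F N in sequentially. real (card (A \<inter> {0..N})) \<le> \<delta> * real (N + 1)"
  shows "\<not> 0 < upper_density A"
proof
  assume "0 < upper_density A"
  then obtain \<delta> where d: "0 < ereal \<delta>" "ereal \<delta> < upper_density A" using ereal_dense2 by blast
  have "\<forall>\<^sub>F N in sequentially. real (card (A \<inter> {0..N})) \<le> \<delta> * real (N + 1)"
    using assms[of \<delta>] d(1) by simp
  then have "\<forall>\<^sub>F N in sequentially. ereal (real (card (A \<inter> {0..N})) / real (N + 1)) \<le> ereal \<delta>"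
    by eventually_elim (simp add: divide_le_eq)
  then have "upper_density A \<le> ereal \<delta>"
    unfolding upper_density_def by (rule Limsup_bounded)
  then show False using d(2) by simp
qed

lemma lp_openD:
  assumes "lp_open p U" "U \<noteq> {}"
  obtains u \<epsilon> where "u \<in> lp p" "0 < \<epsilon>" "\<And>y. y \<in> lp p \<Longrightarrow> lp_dist p y u < \<epsilon> \<Longrightarrow> y \<in> U"
  using assms unfolding lp_open_def by blast

context staged_blocks begin

text \<open>Coordinate 0 at time \<open>n\<close> is a multiple of \<open>x n\<close>. Both negative
  density results thereby reduce to counting the support of \<open>\<phi>\<close>, uniformly in
  \<open>x\<close>.\<close>

lemma \<phi>_nonzero_of_visit:
  assumes x: "x \<in> M" and n: "n \<in> N_T (bshift w) x {z \<in> lp p. 1 / 2 < norm (z 0)}"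
  shows "\<phi> n \<noteq> 0"
proof
  assume "\<phi> n = 0"
  then have "x n = 0" using M_coordinate[OF x, of n] by simp
  then have "(bshift w ^^ n) x 0 = 0" by (simp add: bshift_power)
  then show False using n by (simp add: N_T_def)
qed

lemma large_first_coordinate_nonempty: "{z \<in> lp p. 1 / 2 < norm (z 0 :: 'a)} \<noteq> {}"
proof -
  have "(\<lambda>n. if n = 0 then 1 else 0 :: 'a) \<in> lp p"
    unfolding lp_def using p by (auto intro!: summable_finite[of "{0}"] split: if_splits)
  then show ?thesis by force
qed

text \<open>The zeros of \<open>\<phi>\<close> between the blocks of a stage and the final coordinate of the stage
  make the lower density of the visits vanish.\<close>

lemma not_freq_hypercyclic:
  assumes gap: "\<And>j. j * (m j + g j * Q j) \<le> \<kappa> (Suc j)" and x: "x \<in> M"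
  shows "\<not> lp_freq_hypercyclic_vec p (bshift w) x"
proof
  define A where "A = N_T (bshift w) x {z \<in> lp p. 1 / 2 < norm (z 0)}"
  assume "lp_freq_hypercyclic_vec p (bshift w) x"
  then have "0 < lower_density A"
    using lp_open_coordinate[OF p] large_first_coordinate_nonempty
    unfolding lp_freq_hypercyclic_vec_def A_def by blast
  moreover have "\<not> 0 < lower_density A"
  proof (rule not_lower_density_pos)
    fix \<delta> :: real assume \<delta>: "0 < \<delta>"
    obtain J :: nat where J: "1 / \<delta> < real J" using reals_Archimedean2 by blast
    show "\<exists>\<^sub>F N in sequentially. real (card (A \<inter> {0..N})) \<le> \<delta> * real (N + 1)"
      unfolding frequently_sequentially
    proof
      fix N0
      define j where "j = J + N0"
      \<comment> \<open>The window stops just before the unit coordinate, so it has length exactly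
        \<open>\<kappa> (Suc j)\<close>.\<close>
      define N where "N = \<kappa> (Suc j) - 1"
      define E where "E = m j + g j * Q j"
      have N1: "N + 1 = \<kappa> (Suc j)" using \<kappa>_less_Suc[of j] by (simp add: N_def)
      have "N0 \<le> N" using le_\<kappa>[of "Suc j"] by (simp add: N_def j_def)
      have "A \<inter> {0..N} \<subseteq> {..<E}"
      proof
        fix n assume n: "n \<in> A \<inter> {0..N}"
        then have nz: "\<phi> n \<noteq> 0" using \<phi>_nonzero_of_visit[OF x] by (simp add: A_def)
        have nk: "n < \<kappa> (Suc j)" using n N1 by simp
        show "n \<in> {..<E}"
        proof (rule ccontr)
          assume "n \<notin> {..<E}"
          then have E: "E \<le> n" by simp
          then have "stage n = j" using nk \<kappa>_less_m[of j] by (intro stage_eq) (auto simp: E_def)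
          then have "\<phi> n = 0" using nk E by (simp add: \<phi>_def Let_def E_def)
          then show False using nz by simp
        qed
      qed
      then have "card (A \<inter> {0..N}) \<le> card {..<E}" by (intro card_mono) auto
      then have "real (card (A \<inter> {0..N})) \<le> real E" by simp
      also have "\<dots> \<le> \<delta> * (real j * real E)"
      proof -
        have "1 / \<delta> \<le> real j" using J by (simp add: j_def)
        then have "1 \<le> \<delta> * real j" using \<delta> by (simp add: divide_le_eq mult.commute)
        then have "1 * real E \<le> (\<delta> * real j) * real E" by (rule mult_right_mono) simp
        then show ?thesis by simp
      qed
      also have "\<dots> \<le> \<delta> * real (N + 1)"
      proof -
        have "j * E \<le> N + 1" using gap[of j] N1 by (simp add: E_def)
        then have "real j * real E \<le> real (N + 1)" by (metis of_nat_le_iff of_nat_mult)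
        then show ?thesis using \<delta> by (intro mult_left_mono) auto
      qed
      finally show "\<exists>n\<ge>N0. real (card (A \<inter> {0..n})) \<le> \<delta> * real (n + 1)"
        using \<open>N0 \<le> N\<close> by blast
    qed
  qed
  ultimately show False by blast
qed

text \<open>With a single copy, stage \<open>i\<close> has at most \<open>g i + 1\<close> nonzero
  coordinates. For \<open>m j \<le> N < m (Suc j)\<close> only stages up to \<open>j\<close> matter,
  and \<open>sparse\<close> makes \<open>j\<close> times their total count at most
  \<open>m j\<close>.\<close>

lemma not_U_freq_hypercyclic:
  assumes Q: "\<And>j. Q j = 1" and sparse: "\<And>j. j * (\<Sum>i\<le>j. g i + 1) \<le> m j" and x: "x \<in> M"
  shows "\<not> lp_U_freq_hypercyclic_vec p (bshift w) x"
proof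
  define A where "A = N_T (bshift w) x {z \<in> lp p. 1 / 2 < norm (z 0)}"
  assume "lp_U_freq_hypercyclic_vec p (bshift w) x"
  then have "0 < upper_density A"
    using lp_open_coordinate[OF p] large_first_coordinate_nonempty
    unfolding lp_U_freq_hypercyclic_vec_def A_def by blast
  moreover have "\<not> 0 < upper_density A"
  proof (rule not_upper_density_pos)
    fix \<delta> :: real assume \<delta>: "0 < \<delta>"
    obtain J :: nat where J: "1 / \<delta> < real J" using reals_Archimedean2 by blast
    have m_mono: "m i < m (Suc i)" for i
      using end_le_\<kappa>[of i] \<kappa>_less_m[of "Suc i"] by linarith
    have sm: "strict_mono m" by (rule strict_monoI_Suc) (rule m_mono)
    show "\<forall>\<^sub>F N in sequentially. real (card (A \<inter> {0..N})) \<le> \<delta> * real (N + 1)"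
      unfolding eventually_sequentially
    proof (intro exI allI impI)
      fix N assume N: "m J \<le> N"
      define j where "j = (GREATEST i. m i \<le> N)"
      have bd: "i \<le> N" if "m i \<le> N" for i
        using strict_mono_imp_increasing[OF sm, of i] that by simp
      have mj: "m j \<le> N" unfolding j_def by (rule GreatestI_nat[of _ J N]) (use N bd in auto)
      have Jj: "J \<le> j" unfolding j_def by (rule Greatest_le_nat[of _ J N]) (use N bd in auto)
      have after: "i \<le> j" if "m i \<le> N" for i
        unfolding j_def by (rule Greatest_le_nat[of _ i N]) (use that bd in auto)
      have "A \<inter> {0..N} \<subseteq> (\<Union>i\<le>j. {m i..<m i + g i} \<union> {\<kappa> (Suc i)})"
      proof
        fix n assume n: "n \<in> A \<inter> {0..N}"
        then have nz: "\<phi> n \<noteq> 0" using \<phi>_nonzero_of_visit[OF x] by (simp add: A_def)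
        define i where "i = stage n"
        have i: "n = \<kappa> (Suc i) \<or> n \<in> {m i..<m i + g i}"
          using nz unfolding i_def
          by (cases n rule: \<phi>_cases) (auto simp: Q)
        have "m i \<le> n"
          using i end_le_\<kappa>[of i] by auto
        then have "i \<le> j" using n by (intro after) auto
        then show "n \<in> (\<Union>i\<le>j. {m i..<m i + g i} \<union> {\<kappa> (Suc i)})" using i by blast
      qed
      then have "card (A \<inter> {0..N}) \<le> card (\<Union>i\<le>j. {m i..<m i + g i} \<union> {\<kappa> (Suc i)})"
        by (intro card_mono) auto
      also have "\<dots> \<le> (\<Sum>i\<le>j. card ({m i..<m i + g i} \<union> {\<kappa> (Suc i)}))"
        by (rule card_UN_le) simp
      also have "\<dots> \<le> (\<Sum>i\<le>j. g i + 1)"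
      proof (rule sum_mono)
        show "card ({m i..<m i + g i} \<union> {\<kappa> (Suc i)}) \<le> g i + 1" for i
          using card_Un_le[of "{m i..<m i + g i}" "{\<kappa> (Suc i)}"] by simp
      qed
      finally have "real (card (A \<inter> {0..N})) \<le> real (\<Sum>i\<le>j. g i + 1)" by (simp only: of_nat_le_iff)
      also have "\<dots> \<le> \<delta> * (real j * real (\<Sum>i\<le>j. g i + 1))"
      proof -
        have "1 / \<delta> \<le> real j" using J Jj by linarith
        then have "1 \<le> \<delta> * real j" using \<delta> by (simp add: divide_le_eq mult.commute)
        then have "1 * real (\<Sum>i\<le>j. g i + 1) \<le> (\<delta> * real j) * real (\<Sum>i\<le>j. g i + 1)"
          by (rule mult_right_mono) (rule of_nat_0_le_iff)
        then show ?thesis by (simp only: mult_1 mult.assoc)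
      qed
      also have "\<dots> \<le> \<delta> * real (N + 1)"
      proof -
        have "j * (\<Sum>i\<le>j. g i + 1) \<le> N + 1" using sparse[of j] mj by linarith
        then have "real j * real (\<Sum>i\<le>j. g i + 1) \<le> real (N + 1)" by (metis of_nat_le_iff of_nat_mult)
        then show ?thesis using \<delta> by (intro mult_left_mono) auto
      qed
      finally show "real (card (A \<inter> {0..N})) \<le> \<delta> * real (N + 1)" .
    qed
  qed
  ultimately show False by blast
qed

end

section \<open>Approximation of every target by every nonzero vector\<close>

text \<open>The order of the quantifiers matters: the bound \<open>b\<close> is fixed before the
  period, so that \<open>b * V G\<close> can be made small by a large \<open>G\<close>; and
  \<open>G\<close> is fixed before the stages, so that one period works infinitely often.\<close>

locale rich_staged_blocks = staged_blocks +
  assumes rich: "\<And>i u \<epsilon>. u \<in> lp p \<Longrightarrow> 0 < \<epsilon> \<Longrightarrow> \<exists>td\<in>lp p. \<exists>b. lp_dist p td u < \<epsilon> \<and>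
    (\<forall>r. \<exists>G\<ge>r. \<exists>\<^sub>F j in sequentially. \<iota> j = i \<and> t j = td \<and> g j = G \<and> B j = b)"
begin

lemma visits:
  assumes x: "x \<in> M" "x \<noteq> (\<lambda>n. 0)" and u: "u \<in> lp p" and \<epsilon>: "0 < \<epsilon>"
  obtains G where "1 \<le> G" "\<exists>\<^sub>F j in sequentially. g j = G \<and>
      (\<forall>q<Q j. lp_dist p ((bshift w ^^ (m j + q * G)) x) u < \<epsilon>)"
proof -
  have xlp: "x \<in> lp p" using x by (simp add: M_def)
  obtain n where n: "x n \<noteq> 0" using x(2) by blast
  define i where "i = owner n"
  define a where "a = x (\<kappa> (Suc i))"
  have a0: "a \<noteq> 0" using n M_coordinate[OF x(1), of n] by (auto simp: a_def i_def)
  \<comment> \<open>Vector number \<open>i\<close> enters \<open>x\<close> with coefficient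
    \<open>a\<close>, so its copies must approximate \<open>u / a\<close>.\<close>
  define v where "v s = inverse a * u s" for s
  have vlp: "v \<in> lp p" unfolding v_def[abs_def] by (rule lp_scale[OF u])
  have "0 < \<epsilon> / (2 * norm a)" using \<epsilon> a0 by simp
  from rich[OF vlp this, of i] obtain td b where td: "td \<in> lp p" "lp_dist p td v < \<epsilon> / (2 * norm a)"
    and often: "\<And>r. \<exists>G\<ge>r. \<exists>\<^sub>F j in sequentially. \<iota> j = i \<and> t j = td \<and> g j = G \<and> B j = b"
    by blast
  \<comment> \<open>Each of the three disturbances will be below \<open>\<eta>\<close>; the other
    half of \<open>\<epsilon>\<close> is reserved for the distance from \<open>a * td\<close> to
    \<open>u\<close>.\<close>
  define \<eta> where "\<eta> = (\<epsilon> / 2) powr p / 4"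
  have \<eta>: "0 < \<eta>" using \<epsilon> by (simp add: \<eta>_def)
  define Ap where "Ap = lp_norm p x powr p"
  have "(\<lambda>n. Ap * (b * V n)) \<longlonglongrightarrow> Ap * (b * 0)"
    by (intro tendsto_intros V_tendsto_0 sumW)
  then have "\<forall>\<^sub>F n in sequentially. Ap * (b * V n) < \<eta>"
    using \<eta> by (intro order_tendstoD(2)) auto
  then obtain r where r: "\<And>n. r \<le> n \<Longrightarrow> Ap * (b * V n) < \<eta>"
    by (auto simp: eventually_sequentially)
  obtain G where G: "r + 1 \<le> G" "\<exists>\<^sub>F j in sequentially. \<iota> j = i \<and> t j = td \<and> g j = G \<and> B j = b"
    using often[of "r + 1"] by blast
  have "(\<lambda>j. Ap * (1 / 2) ^ j) \<longlonglongrightarrow> Ap * 0"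
    by (intro tendsto_intros LIMSEQ_power_zero) auto
  then have ev1: "\<forall>\<^sub>F j in sequentially. Ap * (1 / 2) ^ j < \<eta>"
    using \<eta> by (intro order_tendstoD(2)) auto
  have ev2: "\<forall>\<^sub>F j in sequentially. 2 powr p * lp_norm p (tail (\<kappa> (Suc j)) x) powr p < \<eta>"
  proof -
    define e where "e = (\<eta> / 2 powr p) powr (1 / p)"
    have e: "0 < e" using \<eta> by (simp add: e_def)
    have ep: "e powr p = \<eta> / 2 powr p" using p0 \<eta> by (simp add: e_def powr_powr)
    obtain K where K: "\<And>k. K \<le> k \<Longrightarrow> lp_norm p (tail k x) < e"
      by (rule lp_norm_tail_tendsto_zero[OF p0 xlp e]) (rule that)
    have "2 powr p * lp_norm p (tail (\<kappa> (Suc j)) x) powr p < \<eta>" if "K \<le> j" for j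
    proof -
      have "K \<le> \<kappa> (Suc j)" using le_\<kappa>[of "Suc j"] that by simp
      from K[OF this] have "lp_norm p (tail (\<kappa> (Suc j)) x) powr p < e powr p"
        using p0 by (intro powr_less_mono2) (auto simp: lp_norm_nonneg)
      then show ?thesis by (simp add: ep less_divide_eq mult.commute)
    qed
    then show ?thesis by (auto simp: eventually_sequentially)
  qed
  have atu: "lp_norm p (\<lambda>s. a * td s - u s) < \<epsilon> / 2"
  proof -
    have "(\<lambda>s. a * td s - u s) = (\<lambda>s. a * (td s - v s))"
      using a0 by (auto simp: v_def right_diff_distrib)
    then have "lp_norm p (\<lambda>s. a * td s - u s) = norm a * lp_dist p td v"
      using lp_norm_scale[OF p0 lp_diff[OF p td(1) vlp], of a] by (simp add: lp_dist_def)
    also have "\<dots> < norm a * (\<epsilon> / (2 * norm a))"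
      using td(2) a0 by (intro mult_strict_left_mono) auto
    also have "\<dots> = \<epsilon> / 2" using a0 by simp
    finally show ?thesis .
  qed
  have near: "lp_dist p ((bshift w ^^ (m j + q * G)) x) u < \<epsilon>"
    if j: "\<iota> j = i" "t j = td" "g j = G" "B j = b" and q: "q < Q j"
      and small: "Ap * (1 / 2) ^ j < \<eta>" "2 powr p * lp_norm p (tail (\<kappa> (Suc j)) x) powr p < \<eta>" for j q
  proof -
    define y where "y = (bshift w ^^ (m j + q * G)) x"
    have y: "y \<in> lp p" unfolding y_def by (rule bshift_power_lp(1)[OF xlp])
    have "(\<Sum>s<L. norm (y s - a * td s) powr p) \<le> (\<epsilon> / 2) powr p" for L
    proof -
      have "(\<Sum>s<L. norm (y s - a * td s) powr p) \<le> Ap * (b * V G) + Ap * (1 / 2) ^ j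
          + 2 powr p * lp_norm p (tail (\<kappa> (Suc j)) x) powr p"
        using orbit_near_target[OF x(1) q refl, of L] by (simp add: j y_def a_def Ap_def)
      also have "\<dots> \<le> \<eta> + \<eta> + \<eta>" using r[of G] G(1) small by simp
      also have "\<dots> \<le> (\<epsilon> / 2) powr p" by (simp add: \<eta>_def)
      finally show ?thesis .
    qed
    from lp_normI(2)[OF p0 _ this] have 1: "lp_norm p (\<lambda>s. y s - a * td s) \<le> \<epsilon> / 2" using \<epsilon> by simp
    have "lp_norm p (\<lambda>s. (y s - a * td s) + (a * td s - u s))
        \<le> lp_norm p (\<lambda>s. y s - a * td s) + lp_norm p (\<lambda>s. a * td s - u s)"
      by (rule lp_norm_triangle[OF p lp_diff[OF p y lp_scale[OF td(1)]] lp_diff[OF p lp_scale[OF td(1)] u]])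
    also have "\<dots> < \<epsilon>" using 1 atu by simp
    finally show ?thesis by (simp add: lp_dist_def y_def)
  qed
  show ?thesis
  proof (rule that)
    show "1 \<le> G" using G(1) by simp
    show "\<exists>\<^sub>F j in sequentially. g j = G \<and> (\<forall>q<Q j. lp_dist p ((bshift w ^^ (m j + q * G)) x) u < \<epsilon>)"
      using frequently_eventually_frequently[OF G(2) eventually_conj[OF ev1 ev2]]
      by (rule frequently_elim1) (use near in blast)
  qed
qed

lemma hypercyclic:
  assumes Q: "\<And>j. 1 \<le> Q j" and x: "x \<in> M" "x \<noteq> (\<lambda>n. 0)"
  shows "lp_hypercyclic_vec p (bshift w) x"
  unfolding lp_hypercyclic_vec_def
proof (intro conjI allI impI)
  show xlp: "x \<in> lp p" using x by (simp add: M_def)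
  fix U :: "(nat \<Rightarrow> 'a) set" assume U: "lp_open p U \<and> U \<noteq> {}"
  then obtain u \<epsilon> where u: "u \<in> lp p" "0 < \<epsilon>" "\<And>y. y \<in> lp p \<Longrightarrow> lp_dist p y u < \<epsilon> \<Longrightarrow> y \<in> U"
    using lp_openD by blast
  obtain G where "\<exists>\<^sub>F j in sequentially. g j = G \<and>
      (\<forall>q<Q j. lp_dist p ((bshift w ^^ (m j + q * G)) x) u < \<epsilon>)"
    by (rule visits[OF x u(1,2)]) (rule that)
  from frequently_ex[OF this] obtain j
    where j: "\<forall>q<Q j. lp_dist p ((bshift w ^^ (m j + q * G)) x) u < \<epsilon>" by blast
  have "0 < Q j" using Q[of j] by simp
  then have "lp_dist p ((bshift w ^^ (m j + 0 * G)) x) u < \<epsilon>" using j by blast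
  then have "(bshift w ^^ (m j + 0 * G)) x \<in> U" by (rule u(3)[OF bshift_power_lp(1)[OF xlp]])
  then show "\<exists>n. (bshift w ^^ n) x \<in> U" by blast
qed

lemma U_freq_hypercyclic:
  assumes Q: "\<And>j. Q j = m j + 1" and x: "x \<in> M" "x \<noteq> (\<lambda>n. 0)"
  shows "lp_U_freq_hypercyclic_vec p (bshift w) x"
  unfolding lp_U_freq_hypercyclic_vec_def
proof (intro conjI allI impI)
  show xlp: "x \<in> lp p" using x by (simp add: M_def)
  fix U :: "(nat \<Rightarrow> 'a) set" assume U: "lp_open p U \<and> U \<noteq> {}"
  then obtain u \<epsilon> where u: "u \<in> lp p" "0 < \<epsilon>" "\<And>y. y \<in> lp p \<Longrightarrow> lp_dist p y u < \<epsilon> \<Longrightarrow> y \<in> U"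
    using lp_openD by blast
  define A where "A = N_T (bshift w) x U"
  obtain G where G: "1 \<le> G" and freq: "\<exists>\<^sub>F j in sequentially. g j = G \<and>
      (\<forall>q<Q j. lp_dist p ((bshift w ^^ (m j + q * G)) x) u < \<epsilon>)"
    by (rule visits[OF x u(1,2)]) (rule that)
  show "0 < upper_density (N_T (bshift w) x U)"
    unfolding A_def[symmetric]
  proof (rule upper_density_pos_of_frequently)
    show "0 < 1 / (1 + real G)" by simp
    show "\<exists>\<^sub>F N in sequentially. 1 / (1 + real G) * real (N + 1) \<le> real (card (A \<inter> {0..N}))"
      unfolding frequently_sequentially
    proof
      fix N0
      obtain j where j: "N0 \<le> j" "g j = G"
        "\<And>q. q < Q j \<Longrightarrow> lp_dist p ((bshift w ^^ (m j + q * G)) x) u < \<epsilon>"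
        using freq unfolding frequently_sequentially by blast
      \<comment> \<open>As \<open>Q j = m j + 1\<close>, the window has
        \<open>N + 1 = (1 + G) * Q j\<close> times, at least \<open>Q j\<close> of them
        visits.\<close>
      define N where "N = m j + G * Q j"
      have "j \<le> m j" using le_\<kappa>[of j] \<kappa>_less_m[of j] by simp
      then have "N0 \<le> N" using j(1) by (simp add: N_def)
      have "(\<lambda>q. m j + q * G) ` {..<Q j} \<subseteq> A \<inter> {0..N}"
      proof
        fix n assume "n \<in> (\<lambda>q. m j + q * G) ` {..<Q j}"
        then obtain q where q: "n = m j + q * G" "q < Q j" by blast
        have "(bshift w ^^ n) x \<in> U" unfolding q(1) by (rule u(3)[OF bshift_power_lp(1)[OF xlp] j(3)[OF q(2)]])
        moreover have "q * G \<le> G * Q j" using q(2) by (simp add: mult.commute)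
        ultimately show "n \<in> A \<inter> {0..N}" by (simp add: A_def N_T_def N_def q(1))
      qed
      then have "card ((\<lambda>q. m j + q * G) ` {..<Q j}) \<le> card (A \<inter> {0..N})"
        by (intro card_mono) auto
      moreover have "card ((\<lambda>q. m j + q * G) ` {..<Q j}) = Q j"
        using G by (subst card_image) (auto simp: inj_on_def)
      ultimately have "real (Q j) \<le> real (card (A \<inter> {0..N}))" by simp
      moreover have "real (N + 1) = (1 + real G) * real (Q j)"
        by (simp add: N_def Q algebra_simps)
      ultimately have "1 / (1 + real G) * real (N + 1) \<le> real (card (A \<inter> {0..N}))"
        by (simp del: of_nat_add)
      then show "\<exists>n\<ge>N0. 1 / (1 + real G) * real (n + 1) \<le> real (card (A \<inter> {0..n}))"
        using \<open>N0 \<le> N\<close> by blast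
    qed
  qed
qed

end

section \<open>Construction of the stages\<close>

text \<open>Coding the targets by lists of indices makes them countable, hence enumerable along the
  stages.\<close>

lemma finite_targets_dense:
  fixes D :: "nat \<Rightarrow> 'a::real_normed_field"
  assumes p: "1 \<le> p" and D: "\<And>x e. 0 < e \<Longrightarrow> \<exists>i. norm (D i - x) < e"
    and u: "u \<in> lp p" and \<epsilon>: "0 < \<epsilon>"
  obtains l :: "nat list" where "lp_dist p (\<lambda>s. if s < length l then D (l ! s) else 0) u < \<epsilon>"
proof -
  have p0: "0 < p" using p by simp
  have e2: "0 < \<epsilon> / 2" using \<epsilon> by simp
  obtain K where K: "lp_norm p (tail K u) < \<epsilon> / 2"
    by (rule lp_norm_tail_tendsto_zero[OF p0 u e2]) blast
  \<comment> \<open>The error is spread over the first \<open>K\<close> coordinates; the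
    \<open>+ 1\<close> covers \<open>K = 0\<close>.\<close>
  define \<delta> where "\<delta> = ((\<epsilon> / 2) powr p / (real K + 1)) powr (1 / p)"
  have \<delta>: "0 < \<delta>" using \<epsilon> by (simp add: \<delta>_def)
  have \<delta>p: "\<delta> powr p = (\<epsilon> / 2) powr p / (real K + 1)" using p0 \<epsilon> by (simp add: \<delta>_def powr_powr)
  have "\<forall>s. \<exists>i. norm (D i - u s) < \<delta>" using D[OF \<delta>] by blast
  from choice[OF this] obtain c where c: "\<And>s. norm (D (c s) - u s) < \<delta>" by blast
  define l where "l = map c [0..<K]"
  define z where "z s = (if s < length l then D (l ! s) else 0)" for s
  define h where "h s = (if s < K then z s - u s else 0)" for s
  have "(\<Sum>s<L. norm (h s) powr p) \<le> (\<epsilon> / 2) powr p" for L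
  proof -
    have "(\<Sum>s<L. norm (h s) powr p) \<le> (\<Sum>s<L. if s < K then \<delta> powr p else 0)"
    proof (rule sum_mono)
      show "norm (h s) powr p \<le> (if s < K then \<delta> powr p else 0)" for s
        using c[of s] p0 by (auto simp: h_def z_def l_def intro!: powr_mono2)
    qed
    also have "\<dots> \<le> (\<Sum>s<L + K. if s < K then \<delta> powr p else 0)"
      by (rule sum_mono2) auto
    also have "\<dots> = (\<Sum>s<K. \<delta> powr p)"
      by (rule sum.mono_neutral_cong_right) auto
    also have "\<dots> = real K * ((\<epsilon> / 2) powr p / (real K + 1))" by (simp add: \<delta>p)
    also have "\<dots> \<le> (\<epsilon> / 2) powr p"
      by (simp add: divide_le_eq mult.commute[of "real K"] mult_left_mono)
    finally show ?thesis .
  qed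
  from lp_normI[OF p0 less_imp_le[OF e2] this] have h: "h \<in> lp p" "lp_norm p h \<le> \<epsilon> / 2" by auto
  define nt where "nt s = - 1 * tail K u s" for s
  have nt: "nt \<in> lp p" "lp_norm p nt = lp_norm p (tail K u)"
    unfolding nt_def[abs_def] lp_norm_scale[OF p0 tail_lp[OF p0 u]]
    by (rule lp_scale[OF tail_lp[OF p0 u]]) simp
  have "(\<lambda>s. z s - u s) = (\<lambda>s. h s + nt s)"
    by (auto simp: h_def nt_def tail_def z_def l_def)
  then have "lp_dist p z u \<le> lp_norm p h + lp_norm p nt"
    unfolding lp_dist_def using lp_norm_triangle[OF p h(1) nt(1)] by simp
  also have "\<dots> < \<epsilon>" using h(2) nt(2) K by simp
  finally show ?thesis by (intro that[of l]) (simp add: z_def[abs_def])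
qed

context weighted_shift begin

text \<open>The number of copies is a function \<open>q\<close> of the starting point because
  \<open>m j\<close> arises only in the recursion: it is taken large against
  \<open>\<kappa> j\<close>, and then \<open>\<kappa> (Suc j)\<close> large against the end of the
  block. The two extra inequalities serve the two negative density results.\<close>

lemma staged_blocks_exist:
  fixes t :: "nat \<Rightarrow> nat \<Rightarrow> 'a::real_normed_field" and q :: "nat \<Rightarrow> nat"
  assumes sumW: "summable (\<lambda>k. W k powr - p)"
    and slow: "\<And>m N. \<exists>k\<ge>m. N \<le> k \<and> (\<forall>n\<le>N. W k \<le> 2 * W (k - n))"
    and g: "\<And>j. 1 \<le> g j" and supp: "\<And>j s. g j \<le> s \<Longrightarrow> t j s = 0"
    and B: "\<And>j s. (W s * norm (t j s)) powr p \<le> B j"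
  shows "\<exists>\<kappa> m. staged_blocks p w t B g (\<lambda>j. q (m j)) \<kappa> m \<and>
    (\<forall>j. j * (\<Sum>i\<le>j. g i + 1) \<le> m j) \<and> (\<forall>j. j * (m j + g j * q (m j)) \<le> \<kappa> (Suc j))"
proof -
  define R where "R j k m k' \<longleftrightarrow> B j * V (m - k) \<le> (1 / 2) ^ j \<and> k < m \<and> m + g j * q m \<le> k' \<and>
    (\<forall>n\<le>m + g j * q m. W k' \<le> 2 * W (k' - n)) \<and> j * (\<Sum>i\<le>j. g i + 1) \<le> m \<and> j * (m + g j * q m) \<le> k'"
    for j k m k' :: nat
  have "\<exists>\<kappa>. \<forall>j. True \<and> (\<exists>m. R j (\<kappa> j) m (\<kappa> (Suc j)))"
  proof (rule dependent_nat_choice)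
    fix k j :: nat
    have "(\<lambda>n. B j * V n) \<longlonglongrightarrow> B j * 0" by (intro tendsto_intros V_tendsto_0 sumW)
    then have "\<forall>\<^sub>F n in sequentially. B j * V n < (1 / 2) ^ j"
      by (intro order_tendstoD(2)) auto
    then obtain r where r: "\<And>n. r \<le> n \<Longrightarrow> B j * V n < (1 / 2) ^ j" by (auto simp: eventually_sequentially)
    define m where "m = k + r + 1 + j * (\<Sum>i\<le>j. g i + 1)"
    define E where "E = m + g j * q m"
    obtain k' where k': "E + j * E \<le> k'" "\<forall>n\<le>E. W k' \<le> 2 * W (k' - n)"
      using slow[of "E + j * E" E] by blast
    have "B j * V (m - k) \<le> (1 / 2) ^ j" using r[of "m - k"] by (simp add: m_def less_imp_le)
    then have "R j k m k'" using k' unfolding R_def E_def[symmetric] by (auto simp: m_def)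
    then show "\<exists>k'. True \<and> (\<exists>m. R j k m k')" by blast
  qed simp
  then obtain \<kappa> where "\<forall>j. \<exists>m. R j (\<kappa> j) m (\<kappa> (Suc j))" by blast
  from choice[OF this] obtain m where m: "\<And>j. R j (\<kappa> j) (m j) (\<kappa> (Suc j))" by blast
  have "staged_blocks p w t B g (\<lambda>j. q (m j)) \<kappa> m"
  proof (unfold_locales)
    show "summable (\<lambda>k. W k powr - p)" by (rule sumW)
  qed (use m g supp B in \<open>auto simp: R_def\<close>)
  moreover have "j * (\<Sum>i\<le>j. g i + 1) \<le> m j" "j * (m j + g j * q (m j)) \<le> \<kappa> (Suc j)" for j
    using m[of j] unfolding R_def by blast+
  ultimately show ?thesis by (intro exI[of _ \<kappa>] exI[of _ m]) simp
qed

lemma rich_staged_blocks_exist: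
  fixes q :: "nat \<Rightarrow> nat"
  assumes sumW: "summable (\<lambda>k. W k powr - p)"
    and slow: "\<And>m N. \<exists>k\<ge>m. N \<le> k \<and> (\<forall>n\<le>N. W k \<le> 2 * W (k - n))"
  shows "\<exists>(t :: nat \<Rightarrow> nat \<Rightarrow> 'a::real_normed_field) B \<iota> g \<kappa> m.
    rich_staged_blocks p w t B \<iota> g (\<lambda>j. q (m j)) \<kappa> m \<and>
    (\<forall>j. j * (\<Sum>i\<le>j. g i + 1) \<le> m j) \<and> (\<forall>j. j * (m j + g j * q (m j)) \<le> \<kappa> (Suc j))"
proof -
  obtain D :: "nat \<Rightarrow> 'a" where D: "\<And>x e. 0 < e \<Longrightarrow> \<exists>i. norm (D i - x) < e"
    by (rule dense_sequence_exists) blast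
  define target where "target l s = (if s < length l then D (l ! s) else 0)" for l :: "nat list" and s
  define Bl where "Bl l = (\<Sum>s<length l. (W s * norm (target l s)) powr p)" for l
  \<comment> \<open>The second component of the decoded pair is ignored, so each label occurs
    infinitely often.\<close>
  define label :: "nat \<Rightarrow> nat \<times> nat list \<times> nat" where "label j = from_nat (fst (prod_decode j))" for j
  define \<iota> where "\<iota> j = fst (label j)" for j
  define l where "l j = fst (snd (label j))" for j
  \<comment> \<open>The period exceeds both the requested bound and the length of the
    target.\<close>
  define g where "g j = max (snd (snd (label j))) (length (l j)) + 1" for j
  have often: "\<exists>\<^sub>F j in sequentially. label j = c" for c
    unfolding frequently_sequentially
  proof
    fix N
    have "label (prod_encode (to_nat c, N)) = c" by (simp add: label_def)
    moreover have "N \<le> prod_encode (to_nat c, N)" by (rule le_prod_encode_2)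
    ultimately show "\<exists>j\<ge>N. label j = c" by blast
  qed
  have tB: "(W s * norm (target l s)) powr p \<le> Bl l" for l s
  proof (cases "s < length l")
    case True
    then show ?thesis unfolding Bl_def by (intro member_le_sum) auto
  next
    case False
    then show ?thesis using p0 by (simp add: target_def Bl_def sum_nonneg)
  qed
  have "\<exists>\<kappa> m. staged_blocks p w (\<lambda>j. target (l j)) (\<lambda>j. Bl (l j)) g (\<lambda>j. q (m j)) \<kappa> m \<and>
    (\<forall>j. j * (\<Sum>i\<le>j. g i + 1) \<le> m j) \<and> (\<forall>j. j * (m j + g j * q (m j)) \<le> \<kappa> (Suc j))"
    by (rule staged_blocks_exist[OF sumW slow _ _ tB]) (auto simp: g_def target_def)
  then obtain \<kappa> m where sb: "staged_blocks p w (\<lambda>j. target (l j)) (\<lambda>j. Bl (l j)) g (\<lambda>j. q (m j)) \<kappa> m"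
    and gaps: "\<forall>j. j * (\<Sum>i\<le>j. g i + 1) \<le> m j" "\<forall>j. j * (m j + g j * q (m j)) \<le> \<kappa> (Suc j)"
    by blast
  have "rich_staged_blocks p w (\<lambda>j. target (l j)) (\<lambda>j. Bl (l j)) \<iota> g (\<lambda>j. q (m j)) \<kappa> m"
  proof (intro rich_staged_blocks.intro[OF sb] rich_staged_blocks_axioms.intro)
    fix i and u :: "nat \<Rightarrow> 'a" and \<epsilon> :: real assume u: "u \<in> lp p" "0 < \<epsilon>"
    obtain l0 where "lp_dist p (\<lambda>s. if s < length l0 then D (l0 ! s) else 0) u < \<epsilon>"
      using finite_targets_dense[OF p D u] by blast
    then have l0: "lp_dist p (target l0) u < \<epsilon>" by (simp add: target_def[abs_def])
    have "target l0 \<in> lp p" unfolding lp_def target_def using p0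
      by (auto intro!: summable_finite[of "{..<length l0}"] split: if_splits)
    moreover have "\<exists>G\<ge>r. \<exists>\<^sub>F j in sequentially. \<iota> j = i \<and> target (l j) = target l0 \<and> g j = G \<and> Bl (l j) = Bl l0" for r
    proof (intro exI conjI)
      show "r \<le> max r (length l0) + 1" by simp
      show "\<exists>\<^sub>F j in sequentially. \<iota> j = i \<and> target (l j) = target l0 \<and> g j = max r (length l0) + 1 \<and> Bl (l j) = Bl l0"
        using often[of "(i, l0, r)"] by (rule frequently_elim1) (simp add: \<iota>_def l_def g_def)
    qed
    ultimately show "\<exists>td\<in>lp p. \<exists>b. lp_dist p td u < \<epsilon> \<and> (\<forall>r. \<exists>G\<ge>r. \<exists>\<^sub>F j in sequentially.
        \<iota> j = i \<and> target (l j) = td \<and> g j = G \<and> Bl (l j) = b)"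
      using l0 by blast
  qed
  then show ?thesis using gaps by blast
qed

end

section \<open>The two equivalences\<close>

theorem theorem1p2:
  fixes p :: real and w :: "nat \<Rightarrow> real"
    and T :: "(nat \<Rightarrow> 'a::{real_normed_field, banach}) \<Rightarrow> (nat \<Rightarrow> 'a)"
  assumes p: "1 \<le> p"
    and wpos: "\<forall>k\<ge>1. w k > 0"
    and wbdd: "bdd_above (w ` {1..})"
    and T_def: "T = bshift w"
  shows "((summable (\<lambda>k. (\<Prod>j\<in>{1..Suc k}. w j) powr (- p)) \<and>
           (\<forall>n\<ge>1. (INF k\<in>{1..}. (\<Prod>j\<in>{1..n}. w (k + j))) \<le> 1))
        \<longleftrightarrow>
         (\<exists>M. lp_closed_inf_dim_subspace p M \<and>
              (\<forall>x\<in>M. x \<noteq> (\<lambda>n. 0) \<longrightarrow> lp_U_freq_hypercyclic_vec p T x) \<and>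
              (\<forall>x\<in>M. \<not> lp_freq_hypercyclic_vec p T x)))
      \<and> ((summable (\<lambda>k. (\<Prod>j\<in>{1..Suc k}. w j) powr (- p)) \<and>
           (\<forall>n\<ge>1. (INF k\<in>{1..}. (\<Prod>j\<in>{1..n}. w (k + j))) \<le> 1))
        \<longleftrightarrow>
         (lp_U_freq_hypercyclic p T \<and>
          (\<exists>M. lp_closed_inf_dim_subspace p M \<and>
              (\<forall>x\<in>M. x \<noteq> (\<lambda>n. 0) \<longrightarrow> lp_hypercyclic_vec p T x) \<and>
              (\<forall>x\<in>M. \<not> lp_U_freq_hypercyclic_vec p T x))))"
    (is "(?sum \<and> ?inf \<longleftrightarrow> ?ii) \<and> (?sum \<and> ?inf \<longleftrightarrow> ?iii)")
proof -
  interpret weighted_shift p w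
    using p wpos wbdd by unfold_locales auto
  \<comment> \<open>The two series differ only in the term \<open>k = 0\<close>, where
    \<open>W 0 = 1\<close>.\<close>
  have sum_iff: "?sum \<longleftrightarrow> summable (\<lambda>k. W k powr - p)"
    using summable_Suc_iff[of "\<lambda>k. W k powr - p"] by (simp add: W_def)
  have U_hc: "lp_hypercyclic_vec p T x" if "lp_U_freq_hypercyclic_vec p T x" for x :: "nat \<Rightarrow> 'a"
    unfolding lp_hypercyclic_vec_def
  proof (intro conjI allI impI)
    show "x \<in> lp p" using that by (simp add: lp_U_freq_hypercyclic_vec_def)
    fix U :: "(nat \<Rightarrow> 'a) set" assume "lp_open p U \<and> U \<noteq> {}"
    then have "0 < upper_density (N_T T x U)" using that by (simp add: lp_U_freq_hypercyclic_vec_def)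
    then have "N_T T x U \<noteq> {}" by (intro notI) (simp add: upper_density_def Limsup_const)
    then show "\<exists>n. (T ^^ n) x \<in> U" by (auto simp: N_T_def)
  qed
  have nonzero: "\<exists>x\<in>M. x \<noteq> (\<lambda>n. 0)" if M: "lp_closed_inf_dim_subspace p M" for M :: "(nat \<Rightarrow> 'a) set"
  proof -
    obtain x where "x \<in> M" "lp_norm p x = 1"
      using inf_dim_subspace_vanishing[OF p0 M, of 0] by blast
    moreover have "lp_norm p (\<lambda>n. 0 :: 'a) = 0" using p0 by (simp add: lp_norm_def)
    ultimately show ?thesis by force
  qed
  have ii_i: "?sum \<and> ?inf" if ii: ?ii
  proof -
    obtain M where M: "lp_closed_inf_dim_subspace p M"
      "\<And>x. x \<in> M \<Longrightarrow> x \<noteq> (\<lambda>n. 0) \<Longrightarrow> lp_U_freq_hypercyclic_vec p T x" using ii by blast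
    obtain x where "x \<in> M" "x \<noteq> (\<lambda>n. 0)" using nonzero[OF M(1)] by blast
    then have ?sum using M(2) summable_of_U_freq_hypercyclic_vec unfolding sum_iff T_def by blast
    moreover have ?inf
      using INF_le_one_of_hypercyclic_subspace[OF M(1)] U_hc M(2) unfolding T_def by blast
    ultimately show ?thesis ..
  qed
  have iii_i: "?sum \<and> ?inf" if iii: ?iii
  proof -
    obtain M where M: "lp_closed_inf_dim_subspace p M"
      "\<And>x. x \<in> M \<Longrightarrow> x \<noteq> (\<lambda>n. 0) \<Longrightarrow> lp_hypercyclic_vec p T x" using iii by blast
    obtain x where "lp_U_freq_hypercyclic_vec p T x" using iii unfolding lp_U_freq_hypercyclic_def by blast
    then have ?sum using summable_of_U_freq_hypercyclic_vec unfolding sum_iff T_def by blast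
    moreover have ?inf
      using INF_le_one_of_hypercyclic_subspace[OF M(1)] M(2) unfolding T_def by blast
    ultimately show ?thesis ..
  qed
  have i_ii: ?ii if i: "?sum \<and> ?inf"
  proof -
    have sumW: "summable (\<lambda>k. W k powr - p)" using i sum_iff by blast
    have slow: "\<exists>k\<ge>m. N \<le> k \<and> (\<forall>n\<le>N. W k \<le> 2 * W (k - n))" for m N
      by (rule slow_growth_points[OF sumW]) (use i in blast)
    obtain t :: "nat \<Rightarrow> nat \<Rightarrow> 'a" and B \<iota> g \<kappa> m
      where rich: "rich_staged_blocks p w t B \<iota> g (\<lambda>j. m j + 1) \<kappa> m"
        and gap: "\<And>j. j * (m j + g j * (m j + 1)) \<le> \<kappa> (Suc j)"
      using rich_staged_blocks_exist[OF sumW slow, where q = "\<lambda>n. n + 1"] by metis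
    interpret S: rich_staged_blocks p w t B \<iota> g "\<lambda>j. m j + 1" \<kappa> m by (rule rich)
    show ?ii
      unfolding T_def using S.M_subspace S.U_freq_hypercyclic[OF refl] S.not_freq_hypercyclic[OF gap] by blast
  qed
  have i_iii: ?iii if i: "?sum \<and> ?inf"
  proof -
    have sumW: "summable (\<lambda>k. W k powr - p)" using i sum_iff by blast
    have slow: "\<exists>k\<ge>m. N \<le> k \<and> (\<forall>n\<le>N. W k \<le> 2 * W (k - n))" for m N
      by (rule slow_growth_points[OF sumW]) (use i in blast)
    obtain t :: "nat \<Rightarrow> nat \<Rightarrow> 'a" and B \<iota> g \<kappa> m
      where rich: "rich_staged_blocks p w t B \<iota> g (\<lambda>j. 1) \<kappa> m"
        and sparse: "\<And>j. j * (\<Sum>i\<le>j. g i + 1) \<le> m j"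
      using rich_staged_blocks_exist[OF sumW slow, where q = "\<lambda>n. 1"] by metis
    interpret S: rich_staged_blocks p w t B \<iota> g "\<lambda>j. 1" \<kappa> m by (rule rich)
    \<comment> \<open>The sparse subspace has no such vector; a nonzero vector of the subspace from
      the other construction provides it.\<close>
    have "lp_U_freq_hypercyclic p T"
      using i_ii[OF i] nonzero unfolding lp_U_freq_hypercyclic_def by blast
    then show ?iii
      unfolding T_def using S.M_subspace S.hypercyclic[OF order_refl] S.not_U_freq_hypercyclic[OF refl sparse] by blast
  qed
  show ?thesis by (rule conjI[OF iffI[OF i_ii ii_i] iffI[OF i_iii iii_i]])
qed

end
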